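(* Let $0<p\leq 1$ be a fixed constant and let $G\sim G(n,p)$. Then with high probability (i.e. with probability tending to $1$ as $n\to\infty$) $G$ is such that Red has a winning strategy for the strong perfect matching game played on $E(G)$.
   Context: $G(n,p)$ is the binomial random graph on $n$ vertices in which each edge of $K_n$ is present independently with probability $p$. In the strong perfect matching game on $E(G)$, two players, Red and Blue, alternately claim previously unclaimed edges of $G$, exactly one edge per turn, with Red moving first. The winner is the first player whose claimed edges contain a perfect matching of $G$; if all edges are claimed and neither player has won, the game is a draw. A winning strategy for Red is one that guarantees Red wins regardless of Blue's play.
   Formalization: The number of vertices n is taken to be even (n = 2m, m → ∞), since for odd n no graph on n vertices has a perfect matching, the game is always a draw, and the claim fails. *)

theory Defs
  imports "HOL-Probability.Probability"
begin

definition Kn_edges :: "nat \<Rightarrow> nat set set" where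
  "Kn_edges n = {{u, v} | u v. u < n \<and> v < n \<and> u \<noteq> v}"

definition Gnp :: "nat \<Rightarrow> real \<Rightarrow> nat set set pmf" where
  "Gnp n p = map_pmf (\<lambda>f. {e \<in> Kn_edges n. f e})
                     (Pi_pmf (Kn_edges n) False (\<lambda>_. bernoulli_pmf p))"

definition perfect_matching :: "'a set \<Rightarrow> 'a set set \<Rightarrow> bool" where
  "perfect_matching V M \<longleftrightarrow>
     (\<forall>e\<in>M. \<exists>u v. e = {u, v} \<and> u \<noteq> v \<and> u \<in> V \<and> v \<in> V) \<and>
     (\<forall>v\<in>V. \<exists>!e. e \<in> M \<and> v \<in> e)"

definition contains_pm :: "'a set \<Rightarrow> 'a set set \<Rightarrow> bool" where
  "contains_pm V A \<longleftrightarrow> (\<exists>M\<subseteq>A. perfect_matching V M)"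

text \<open>Strong perfect matching game on the edge set E of a graph with vertex set V.
  red_wins V E R B: in the position where Red has claimed R, Blue has claimed B,
  neither has won yet, and it is Red's turn, Red has a winning strategy.
  Red wins either by completing a perfect matching now, or by making a move after
  which Blue has a move (otherwise the board is full: draw) and every Blue reply
  neither completes a Blue perfect matching nor escapes a Red win.\<close>
inductive red_wins :: "'a set \<Rightarrow> 'a set set \<Rightarrow> 'a set set \<Rightarrow> 'a set set \<Rightarrow> bool"
  for V :: "'a set" and E :: "'a set set" where
  win_now: "e \<in> E - R - B \<Longrightarrow> contains_pm V (insert e R) \<Longrightarrow> red_wins V E R B"
| win_later: "e \<in> E - R - B \<Longrightarrow> E - insert e R - B \<noteq> {} \<Longrightarrow>
     (\<forall>f \<in> E - insert e R - B.
        \<not> contains_pm V (insert f B) \<and> red_wins V E (insert e R) (insert f B)) \<Longrightarrow>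
     red_wins V E R B"

definition red_has_winning_strategy :: "nat \<Rightarrow> nat set set \<Rightarrow> bool" where
  "red_has_winning_strategy n E \<longleftrightarrow> red_wins {..<n} E {} {}"

end

theory Submission
  imports Defs "HOL-Real_Asymp.Real_Asymp"
begin

text \<open>
  Red builds a matching one edge at a time. If he reaches \<open>m - 1\<close> disjoint edges in \<open>m - 1\<close> moves while
  Blue has wasted at least one half-edge (his \<open>m - 1\<close> edges do not form a matching), Red wins by
  force: with \<open>u, v\<close> uncovered and a matching edge \<open>aa'\<close> joined to both, the move \<open>ua\<close> threatens \<open>a'v\<close>;
  after Blue's forced reply a second such edge \<open>bb'\<close>, joined to \<open>u, v, a'\<close>, gives with \<open>vb\<close> the two
  threats \<open>b'u\<close> and \<open>b'a'\<close>. More generally Red may leave \<open>2z\<close> vertices uncovered if Blue has wasted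
  enough half-edges, because every further pair costs Red a single wasted move.

  To have such gadget edges for every triple of vertices Red first claims linearly many edges inside
  small cliques, chosen by a derandomised averaging argument. If some vertex reaches linear Blue degree,
  Blue has wasted linearly many half-edges and Red can play carelessly, as long as he covers such
  vertices at once. Otherwise Red reserves a path of 11-cliques, consecutive ones completely
  joined, such that every vertex is joined to many of them. He matches the other vertices greedily,
  attaches the few remaining ones to the path, and runs through the path passing at most five
  vertices on to the next clique. A vertex that cannot be matched in this way has Blue degree at
  least five, so Blue has paid for leaving it out. If nobody is left out, Red makes Blue waste a half-edge in
  the last clique by leaving him a forced edge at a vertex that Blue has already touched.
\<close>

section \<open>Matchings, degrees and the game\<close>

text \<open>The scarce resource is time, and it is booked in \<open>card (iso B)\<close>, the number
  of vertices that Blue has not touched. If both players hold equally many edges and neither has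
  wasted any, this number equals the number of vertices Red has not covered. Each Blue edge lowers
  it by at most two. A forcing exchange takes two Red moves per pair, so Blue may lower it by four
  while only two vertices become covered; hence \<open>4 * z + 1\<close> in \<open>endgame\<close>.
  The obstacle is that Blue can play in two opposite ways: concentrate on a few vertices so that Red
  cannot match them without loss, or spread out and build a matching as fast as Red does. Blue
  degree separates the two: an unmatchable vertex has a degree that pays for leaving it out, and a
  vertex of small degree still has free edges. \<open>N1\<close>, \<open>L\<close>,
  \<open>D\<close>, \<open>G\<close>, \<open>t1\<close> are all linear in \<open>n\<close>, each
  smaller than the next by a constant factor, whereas \<open>h\<close> is a constant: linearly many
  edges create only boundedly many vertices of linear degree.\<close>

definition deg :: "'a set set \<Rightarrow> 'a \<Rightarrow> nat" where
  "deg B v = card {e \<in> B. v \<in> e}"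

definition matching :: "'a set set \<Rightarrow> bool" where
  "matching M \<longleftrightarrow> (\<forall>e\<in>M. \<forall>f\<in>M. e \<noteq> f \<longrightarrow> e \<inter> f = {})"

lemma matching_insert: "matching M \<Longrightarrow> e \<inter> \<Union>M = {} \<Longrightarrow> matching (insert e M)"
  unfolding matching_def by blast

lemma matching_subset: "matching M \<Longrightarrow> N \<subseteq> M \<Longrightarrow> matching N"
  unfolding matching_def by blast

lemma matching_Union_Diff: "matching M \<Longrightarrow> e \<in> M \<Longrightarrow> \<Union>(M - {e}) = \<Union>M - e"
  unfolding matching_def by blast

lemma card_matching_hit:
  assumes "matching M" "finite W"
  shows "card {e \<in> M. e \<inter> W \<noteq> {}} \<le> card W"
proof -
  define g where "g e = (SOME x. x \<in> e \<inter> W)" for e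
  have g: "g e \<in> e \<inter> W" if "e \<in> {e \<in> M. e \<inter> W \<noteq> {}}" for e
    using that unfolding g_def using someI_ex[of "\<lambda>x. x \<in> e \<inter> W"] by auto
  have "inj_on g {e \<in> M. e \<inter> W \<noteq> {}}"
  proof (rule inj_onI)
    fix e f assume "e \<in> {e \<in> M. e \<inter> W \<noteq> {}}" "f \<in> {e \<in> M. e \<inter> W \<noteq> {}}" "g e = g f"
    then have "g e \<in> e \<inter> f" "e \<in> M" "f \<in> M" using g[of e] g[of f] by auto
    then show "e = f" using assms(1) unfolding matching_def by blast
  qed
  moreover have "g ` {e \<in> M. e \<inter> W \<noteq> {}} \<subseteq> W" using g by blast
  ultimately show ?thesis using assms(2) by (meson card_inj_on_le)
qed

lemma deg_insert_le: "finite B \<Longrightarrow> deg (insert f B) v \<le> Suc (deg B v)"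
proof -
  assume "finite B"
  have "{e \<in> insert f B. v \<in> e} \<subseteq> insert f {e \<in> B. v \<in> e}" by auto
  then have "deg (insert f B) v \<le> card (insert f {e \<in> B. v \<in> e})"
    unfolding deg_def using \<open>finite B\<close> by (intro card_mono) auto
  also have "\<dots> \<le> Suc (deg B v)" unfolding deg_def by (simp add: card_insert_le_m1 \<open>finite B\<close> card_insert_if)
  finally show ?thesis .
qed

lemma deg_mono: "finite B' \<Longrightarrow> B \<subseteq> B' \<Longrightarrow> deg B v \<le> deg B' v"
  unfolding deg_def by (intro card_mono) auto

lemma deg_pos: "finite B \<Longrightarrow> v \<in> \<Union>B \<Longrightarrow> 1 \<le> deg B v"
  unfolding deg_def by (simp add: Suc_le_eq card_gt_0_iff) blast

lemma finite_Kn_edges [simp]: "finite (Kn_edges n)"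
  by (rule finite_subset[of _ "Pow {..<n}"]) (auto simp: Kn_edges_def)

text \<open>When Red makes a move that does not win at once, fewer than \<open>4 * n\<close> edges
  are claimed. By \<open>many_edges\<close> Blue then still has a reply, so a draw by a full board
  never arises.\<close>

locale board =
  fixes n :: nat and E :: "nat set set"
  assumes E_sub: "E \<subseteq> Kn_edges n" and many_edges: "4 * n < card E"
begin

abbreviation V :: "nat set" where "V \<equiv> {..<n}"

text \<open>The vertices untouched by Blue measure his distance from a perfect matching.\<close>

definition iso :: "nat set set \<Rightarrow> nat set" where "iso B = V - \<Union>B"

lemma finite_E [simp]: "finite E" using finite_Kn_edges E_sub finite_subset by blast

lemma E_finite_sub: "B \<subseteq> E \<Longrightarrow> finite B" using finite_E finite_subset by blast

lemma edgeE:
  assumes "e \<in> E" obtains u v where "e = {u, v}" "u \<noteq> v" "u \<in> V" "v \<in> V"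
  using assms E_sub unfolding Kn_edges_def by blast

lemma edge_card: "e \<in> E \<Longrightarrow> card e = 2" by (elim edgeE) auto
lemma edge_sub: "e \<in> E \<Longrightarrow> e \<subseteq> V" by (elim edgeE) auto
lemma edge_finite: "e \<in> E \<Longrightarrow> finite e" by (elim edgeE) auto

lemma edge_memE:
  assumes "e \<in> E" "a \<in> e" obtains b where "e = {a, b}" "a \<noteq> b"
  using assms by (elim edgeE) (auto simp: insert_commute)

lemma matching_perfect:
  assumes "M \<subseteq> E" "matching M" "\<Union>M = V"
  shows "perfect_matching V M"
  unfolding perfect_matching_def
proof (intro conjI ballI)
  fix e assume "e \<in> M"
  then have "e \<in> E" using assms by blast
  then show "\<exists>u v. e = {u, v} \<and> u \<noteq> v \<and> u \<in> V \<and> v \<in> V" by (elim edgeE) blast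
next
  fix v assume "v \<in> V"
  then obtain e where e: "e \<in> M" "v \<in> e" using assms(3) by blast
  moreover have "f = e" if "f \<in> M" "v \<in> f" for f using assms(2) that e unfolding matching_def by blast
  ultimately show "\<exists>!e. e \<in> M \<and> v \<in> e" by blast
qed

lemma contains_pmI:
  assumes "M \<subseteq> E" "M \<subseteq> R" "matching M" "V \<subseteq> \<Union>M"
  shows "contains_pm V R"
proof -
  have "\<Union>M = V" using assms edge_sub by blast
  then show ?thesis using assms matching_perfect unfolding contains_pm_def by blast
qed

lemma card_Union_matching:
  assumes "M \<subseteq> E" "matching M"
  shows "card (\<Union>M) = 2 * card M"
proof -
  have "card (\<Union>M) = sum card M"
    using assms edge_finite unfolding matching_def
    by (intro card_Union_disjoint) (auto simp: pairwise_def disjnt_def)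
  also have "\<dots> = (\<Sum>e\<in>M. 2)" using assms edge_card by (intro sum.cong) auto
  finally show ?thesis by simp
qed

lemma card_uncovered:
  assumes "M \<subseteq> E" "matching M"
  shows "card (V - \<Union>M) + 2 * card M = n"
proof -
  have "\<Union>M \<subseteq> V" using assms edge_sub by blast
  then have "card (V - \<Union>M) + card (\<Union>M) = card V"
    by (metis card_Diff_subset card_mono finite_lessThan finite_subset le_add_diff_inverse2)
  then show ?thesis using card_Union_matching[OF assms] by simp
qed

lemma finite_iso [simp]: "finite (iso B)" unfolding iso_def by simp

lemma card_iso_insert:
  assumes "f \<in> E" shows "card (iso B) \<le> card (iso (insert f B)) + 2"
proof -
  have "iso B \<subseteq> iso (insert f B) \<union> f" unfolding iso_def by auto
  then have "card (iso B) \<le> card (iso (insert f B) \<union> f)"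
    using assms edge_finite by (intro card_mono) auto
  also have "\<dots> \<le> card (iso (insert f B)) + card f" by (rule card_Un_le)
  finally show ?thesis using edge_card assms by simp
qed

lemma pm_iso: assumes "contains_pm V B" shows "iso B = {}"
proof -
  obtain M where M: "M \<subseteq> B" "perfect_matching V M" using assms unfolding contains_pm_def by blast
  have "v \<in> \<Union>M" if "v \<in> V" for v using M(2) that unfolding perfect_matching_def by blast
  then show ?thesis using M(1) unfolding iso_def by blast
qed

text \<open>The bound 3 ensures that Blue's reply, which touches two vertices, leaves one untouched,
  so he has no perfect matching. The size bound provides the legal reply that
  \<open>win_later\<close> demands.\<close>

lemma red_step:
  assumes "e \<in> E - R - B" "3 \<le> card (iso B)" "card R + card B + 1 \<le> 4 * n"
    and "\<And>f. f \<in> E - insert e R - B \<Longrightarrow> red_wins V E (insert e R) (insert f B)"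
    and fin: "finite R" "finite B"
  shows "red_wins V E R B"
proof (rule win_later[of e])
  show "e \<in> E - R - B" by fact
  show "E - insert e R - B \<noteq> {}"
  proof
    assume "E - insert e R - B = {}"
    then have "E \<subseteq> insert e R \<union> B" by blast
    then have "card E \<le> card (insert e R \<union> B)" using fin by (intro card_mono) auto
    also have "\<dots> \<le> card (insert e R) + card B" by (rule card_Un_le)
    also have "\<dots> \<le> card R + 1 + card B" using fin by (simp add: card_insert_if)
    finally show False using assms(3) many_edges by simp
  qed
  show "\<forall>f\<in>E - insert e R - B. \<not> contains_pm V (insert f B) \<and> red_wins V E (insert e R) (insert f B)"
  proof (intro ballI conjI)
    fix f assume f: "f \<in> E - insert e R - B"
    show "\<not> contains_pm V (insert f B)"
    proof
      assume "contains_pm V (insert f B)"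
      from pm_iso[OF this] have "card (iso (insert f B)) = 0" by simp
      then show False using card_iso_insert[of f B] f assms(2) by auto
    qed
    show "red_wins V E (insert e R) (insert f B)" using assms(4) f .
  qed
qed

lemma deg_sum:
  assumes "B \<subseteq> E" shows "(\<Sum>v\<in>V. deg B v) = 2 * card B"
proof -
  have fB: "finite B" using assms E_finite_sub by blast
  have "(\<Sum>v\<in>V. deg B v) = (\<Sum>v\<in>V. \<Sum>e\<in>B. if v \<in> e then 1 else 0)"
    by (simp only: deg_def sum.If_cases[OF fB]) (simp add: Collect_conj_eq Int_commute)
  also have "\<dots> = (\<Sum>e\<in>B. \<Sum>v\<in>V. if v \<in> e then 1 else 0)" by (rule sum.swap)
  also have "\<dots> = (\<Sum>e\<in>B. 2)"
  proof (rule sum.cong)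
    fix e assume "e \<in> B"
    then have "e \<in> E" using assms by blast
    then have "V \<inter> {v. v \<in> e} = e" using edge_sub by blast
    then show "(\<Sum>v\<in>V. if v \<in> e then 1 else 0) = (2::nat)" using edge_card \<open>e \<in> E\<close>
      by (simp add: sum.If_cases)
  qed simp
  finally show ?thesis by simp
qed

text \<open>The sum counts the half-edges that Blue has wasted at \<open>X\<close>; by truncation an isolated vertex
  contributes 0.\<close>
lemma iso_lower:
  assumes "B \<subseteq> E" "X \<subseteq> V"
  shows "n + (\<Sum>v\<in>X. deg B v - 1) \<le> card (iso B) + 2 * card B"
proof -
  have fB: "finite B" using assms E_finite_sub by blast
  have 1: "(\<Sum>v\<in>V. if v \<in> \<Union>B then 1 else 0) = card (V \<inter> \<Union>B)"
    by (simp only: sum.If_cases[OF finite_lessThan] Collect_mem_eq) simp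
  have 2: "(\<Sum>v\<in>V. if v \<in> X then deg B v - 1 else 0) = (\<Sum>v\<in>X. deg B v - 1)"
    using assms(2) by (simp only: sum.If_cases[OF finite_lessThan] Collect_mem_eq) (simp add: Int_absorb1)
  have "card (V \<inter> \<Union>B) + (\<Sum>v\<in>X. deg B v - 1)
      = (\<Sum>v\<in>V. (if v \<in> \<Union>B then 1 else 0) + (if v \<in> X then deg B v - 1 else 0))"
    by (simp only: sum.distrib 1 2)
  also have "\<dots> \<le> (\<Sum>v\<in>V. deg B v)"
  proof (rule sum_mono)
    fix v
    show "(if v \<in> \<Union>B then 1 else 0) + (if v \<in> X then deg B v - 1 else 0) \<le> deg B v"
      using deg_pos[OF fB, of v] by (cases "v \<in> \<Union>B"; cases "v \<in> X") simp_all
  qed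
  also have "\<dots> = 2 * card B" by (rule deg_sum) fact
  finally have 1: "card (V \<inter> \<Union>B) + (\<Sum>v\<in>X. deg B v - 1) \<le> 2 * card B" .
  have "card (iso B) + card (V \<inter> \<Union>B) = n"
    unfolding iso_def using card_Int_Diff[of V "\<Union>B"] by simp
  then show ?thesis using 1 by simp
qed

text \<open>A gadget can be broken up by matching its two ends to any two vertices of
  \<open>T\<close>. Only membership of the joining edges in \<open>E\<close> is demanded; that they
  are unclaimed is arranged by \<open>pick_gadget\<close>.\<close>

definition gadgets :: "nat set set \<Rightarrow> nat set \<Rightarrow> nat set set" where
  "gadgets M T = {e \<in> M. e \<inter> T = {} \<and> (\<forall>x\<in>T. \<forall>y\<in>e. {x, y} \<in> E)}"

text \<open>Each edge of \<open>C\<close> at a vertex of \<open>T\<close> spoils one vertex, and so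
  does each element of \<open>W\<close>. As \<open>M\<close> is a matching, a spoiled vertex lies in
  at most one gadget. In all uses \<open>C\<close> is the set of claimed edges.\<close>

lemma pick_gadget:
  assumes "matching M" "M \<subseteq> E" "finite C" "finite T" "finite W" "C \<subseteq> E"
    and "(\<Sum>t\<in>T. deg C t) + card W < card (gadgets M T)"
  obtains e where "e \<in> gadgets M T" "e \<inter> W = {}" "\<And>t y. t \<in> T \<Longrightarrow> y \<in> e \<Longrightarrow> {t, y} \<notin> C"
proof -
  define Y where "Y t = {y. {t, y} \<in> C}" for t
  have Y: "finite (Y t) \<and> card (Y t) \<le> deg C t" for t
  proof -
    have inj: "inj_on (\<lambda>y. {t, y}) (Y t)" by (auto simp: inj_on_def doubleton_eq_iff)
    have im: "(\<lambda>y. {t, y}) ` Y t \<subseteq> {e \<in> C. t \<in> e}" unfolding Y_def by auto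
    show ?thesis unfolding deg_def using card_inj_on_le[OF inj im] inj_on_finite[OF inj im] assms(3) by simp
  qed
  define W' where "W' = W \<union> (\<Union>t\<in>T. Y t)"
  have fW: "finite W'" unfolding W'_def using assms Y by auto
  have "card W' \<le> card W + card (\<Union>t\<in>T. Y t)" unfolding W'_def by (rule card_Un_le)
  also have "card (\<Union>t\<in>T. Y t) \<le> (\<Sum>t\<in>T. card (Y t))" using assms(4) by (rule card_UN_le)
  also have "(\<Sum>t\<in>T. card (Y t)) \<le> (\<Sum>t\<in>T. deg C t)" using Y by (intro sum_mono) auto
  finally have "card W' < card (gadgets M T)" using assms(7) by simp
  moreover have "card {e \<in> M. e \<inter> W' \<noteq> {}} \<le> card W'" by (rule card_matching_hit) fact+
  moreover have "finite {e \<in> M. e \<inter> W' \<noteq> {}}" using assms(2) E_finite_sub by auto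
  ultimately have "\<not> gadgets M T \<subseteq> {e \<in> M. e \<inter> W' \<noteq> {}}" by (meson card_mono leD le_trans)
  then obtain e where "e \<in> gadgets M T" "e \<inter> W' = {}" unfolding gadgets_def by blast
  then show thesis using that unfolding W'_def Y_def by blast
qed

end

section \<open>The endgame\<close>

text \<open>A rotation: \<open>u\<close> replaces \<open>a'\<close> among the covered vertices, at
  the price of a move that does not enlarge the matching.\<close>

lemma matching_swap:
  assumes "matching M" "{a, a'} \<in> M" "a \<noteq> a'" "u \<notin> \<Union>M"
  shows "matching (insert {u, a} (M - {{a, a'}}))"
    and "\<Union>(insert {u, a} (M - {{a, a'}})) = insert u (\<Union>M - {a'})"
proof -
  have U: "\<Union>(M - {{a, a'}}) = \<Union>M - {a, a'}" using matching_Union_Diff[OF assms(1,2)] .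
  show "matching (insert {u, a} (M - {{a, a'}}))"
    by (rule matching_insert) (use matching_subset[OF assms(1)] U assms(4) in auto)
  show "\<Union>(insert {u, a} (M - {{a, a'}})) = insert u (\<Union>M - {a'})"
    using U assms by auto
qed

context board begin

lemma win_free_pair:
  assumes "M \<subseteq> R" "R \<subseteq> E" "matching M" "V - \<Union>M = {x, y}" "{x, y} \<in> E - R - B"
  shows "red_wins V E R B"
proof (rule win_now)
  show "{x, y} \<in> E - R - B" by fact
  show "contains_pm V (insert {x, y} R)"
  proof (rule contains_pmI)
    show "matching (insert {x, y} M)" using assms by (intro matching_insert) auto
  qed (use assms in auto)
qed

lemma gadgetE:
  assumes "e \<in> gadgets M T" "M \<subseteq> E"
  obtains a a' where "e = {a, a'}" "a \<noteq> a'" "e \<in> M" "a \<notin> T" "a' \<notin> T" "a \<in> V" "a' \<in> V"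
    "\<And>x. x \<in> T \<Longrightarrow> {x, a} \<in> E \<and> {x, a'} \<in> E"
proof -
  have "e \<in> E" using assms unfolding gadgets_def by auto
  then obtain a a' where "e = {a, a'}" "a \<noteq> a'" "a \<in> V" "a' \<in> V" by (elim edgeE)
  then show thesis using that[of a a'] assms(1) unfolding gadgets_def by auto
qed

lemma finite_gadgets: "M \<subseteq> E \<Longrightarrow> finite (gadgets M T)"
  using E_finite_sub unfolding gadgets_def by auto

lemma card_gadgets_remove:
  assumes "M \<subseteq> E" "M' \<subseteq> E" "M - {e} \<subseteq> M'"
  shows "card (gadgets M T) \<le> card (gadgets M' T) + 1"
proof -
  have "gadgets M T \<subseteq> insert e (gadgets M' T)" using assms unfolding gadgets_def by auto
  then have "card (gadgets M T) \<le> card (insert e (gadgets M' T))"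
    using finite_gadgets[OF assms(2)] by (intro card_mono) auto
  then show ?thesis using finite_gadgets[OF assms(2)] by (simp add: card_insert_if split: if_splits)
qed

text \<open>Both alternatives for \<open>iso B\<close> leave three untouched vertices after Blue's
  forced reply \<open>{a', v}\<close>: five minus at most two, or no loss at all because
  \<open>v\<close> is touched already and \<open>a'\<close> is chosen touched.\<close>

lemma endgame_pair:
  assumes sub: "R \<subseteq> E" "B \<subseteq> E" "M \<subseteq> R" and mat: "matching M"
    and U: "V - \<Union>M = {u, v}" "u \<noteq> v"
    and gad: "\<And>T. T \<subseteq> V \<Longrightarrow> T \<noteq> {} \<Longrightarrow> card T \<le> 3 \<Longrightarrow> G \<le> card (gadgets M T)"
    and dg: "deg (R \<union> B) u \<le> q" "deg (R \<union> B) v \<le> q"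
    and hv: "card {x \<in> V. q < deg (R \<union> B) x} \<le> h"
    and isoc: "5 \<le> card (iso B) \<or> 3 \<le> card (iso B) \<and> v \<notin> iso B"
    and size: "card R + card B + 3 \<le> 4 * n" and G: "3 * q + h + 10 \<le> G"
  shows "red_wins V E R B"
proof -
  have fin: "finite R" "finite B" "M \<subseteq> E" using sub E_finite_sub by auto
  have uvV: "u \<in> V" "v \<in> V" "u \<notin> \<Union>M" "v \<notin> \<Union>M" using U by auto
  \<comment> \<open>High degrees are avoided because \<open>a'\<close> will be one of the three
    vertices that the second gadget must serve. If fewer than five vertices are untouched, these are
    avoided too, which costs at most 4.\<close>
  define W where "W = {x \<in> V. q < deg (R \<union> B) x} \<union> (if 5 \<le> card (iso B) then {} else iso B)"
  have fW: "finite W" unfolding W_def by simp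
  have cW: "card W \<le> h + 4"
  proof -
    have "card W \<le> card {x \<in> V. q < deg (R \<union> B) x} + card (if 5 \<le> card (iso B) then {} else iso B)"
      unfolding W_def by (rule card_Un_le)
    then show ?thesis using hv by (auto split: if_splits)
  qed
  have "card {u, v} \<le> 3" using U(2) by simp
  then have "G \<le> card (gadgets M {u, v})" using uvV by (intro gad) auto
  moreover have "(\<Sum>t\<in>{u, v}. deg (R \<union> B) t) \<le> 2 * q" using dg U(2) by simp
  ultimately have "(\<Sum>t\<in>{u, v}. deg (R \<union> B) t) + card W < card (gadgets M {u, v})"
    using cW G by linarith
  then obtain e where e: "e \<in> gadgets M {u, v}" "e \<inter> W = {}"
    "\<And>t y. t \<in> {u, v} \<Longrightarrow> y \<in> e \<Longrightarrow> {t, y} \<notin> R \<union> B"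
    using pick_gadget[OF mat fin(3) _ _ fW, of "R \<union> B" "{u, v}"] fin sub by auto
  obtain a a' where a: "e = {a, a'}" "a \<noteq> a'" "e \<in> M" "a \<notin> {u, v}" "a' \<notin> {u, v}" "a \<in> V" "a' \<in> V"
    "\<And>x. x \<in> {u, v} \<Longrightarrow> {x, a} \<in> E \<and> {x, a'} \<in> E"
    using gadgetE[OF e(1) fin(3)] by metis
  have da': "deg (R \<union> B) a' \<le> q" using e(2) a unfolding W_def by force
  have isoa: "5 \<le> card (iso B) \<or> a' \<notin> iso B" using e(2) a unfolding W_def by (auto split: if_splits)
  define R1 where "R1 = insert {u, a} R"
  define M1 where "M1 = insert {u, a} (M - {{a, a'}})"
  have M1: "matching M1" "\<Union>M1 = insert u (\<Union>M - {a'})"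
    unfolding M1_def using matching_swap[OF mat _ a(2) uvV(3)] a by auto
  have M1R: "M1 \<subseteq> R1" "R1 \<subseteq> E" using sub a unfolding M1_def R1_def by auto
  have UM: "\<Union>M = V - {u, v}" using U edge_sub fin(3) by blast
  have U1: "V - \<Union>M1 = {a', v}" using M1(2) UM uvV(1,2) U(2) a(2,4-7) by auto
  show ?thesis
  proof (rule red_step[of "{u, a}"])
    show "{u, a} \<in> E - R - B" using e(3)[of u a] a by auto
    show "3 \<le> card (iso B)" using isoc by auto
    show "card R + card B + 1 \<le> 4 * n" using size by simp
    fix f assume f: "f \<in> E - insert {u, a} R - B"
    show "red_wins V E (insert {u, a} R) (insert f B)"
    proof (cases "f = {a', v}")
      case False
      have "{a', v} \<noteq> {u, a}" using a U by (auto simp: doubleton_eq_iff)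
      moreover have "{a', v} \<notin> R \<union> B" using e(3)[of v a'] a by (auto simp: insert_commute)
      ultimately have "{a', v} \<in> E - R1 - insert f B"
        using False a(8)[of v] unfolding R1_def by (auto simp: insert_commute)
      then have "red_wins V E R1 (insert f B)" by (rule win_free_pair[OF M1R(1,2) M1(1) U1])
      then show ?thesis unfolding R1_def .
    next
      case f_eq: True
      define B1 where "B1 = insert f B"
      have B1: "B1 \<subseteq> E" "finite B1" using f sub fin unfolding B1_def by auto
      have iso1: "3 \<le> card (iso B1)"
      proof (cases "5 \<le> card (iso B)")
        case True
        then show ?thesis using card_iso_insert[of f B] f unfolding B1_def by auto
      next
        case False
        then have "iso B1 = iso B" using isoc isoa f_eq unfolding B1_def iso_def by auto
        then show ?thesis using isoc by auto
      qed
      have sub2: "R1 \<union> B1 = insert f (insert {u, a} (R \<union> B))" unfolding R1_def B1_def by auto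
      have dinc: "deg (R1 \<union> B1) x \<le> deg (R \<union> B) x + 2" for x
        unfolding sub2 using deg_insert_le[of "insert {u, a} (R \<union> B)" f x] deg_insert_le[of "R \<union> B" "{u, a}" x] fin by simp
      define T where "T = {u, v, a'}"
      have cT: "card T = 3" unfolding T_def using U a by auto
      have "G \<le> card (gadgets M T)" using cT uvV a by (intro gad) (auto simp: T_def)
      moreover have "(\<Sum>t\<in>T. deg (R1 \<union> B1) t) \<le> 3 * q + 6"
        unfolding T_def using U a da' dg dinc[of u] dinc[of v] dinc[of a'] by auto
      ultimately have "(\<Sum>t\<in>T. deg (R1 \<union> B1) t) + card ({}::nat set) < card (gadgets M T)"
        using G by simp
      then obtain e' where e': "e' \<in> gadgets M T"
        "\<And>t y. t \<in> T \<Longrightarrow> y \<in> e' \<Longrightarrow> {t, y} \<notin> R1 \<union> B1"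
        using pick_gadget[OF mat fin(3), of "R1 \<union> B1" T "{}"] B1 M1R fin E_finite_sub
        by (auto simp: T_def)
      obtain b b' where b: "e' = {b, b'}" "b \<noteq> b'" "e' \<in> M" "b \<notin> T" "b' \<notin> T" "b \<in> V" "b' \<in> V"
        "\<And>x. x \<in> T \<Longrightarrow> {x, b} \<in> E \<and> {x, b'} \<in> E"
        using gadgetE[OF e'(1) fin(3)] by metis
      have bu: "b \<noteq> u" "b \<noteq> v" "b \<noteq> a'" "b' \<noteq> u" "b' \<noteq> v" "b' \<noteq> a'" using b unfolding T_def by auto
      have ee': "e' \<noteq> e" using a(1) b(1) bu by (auto simp: doubleton_eq_iff)
      have "e \<inter> e' = {}" using mat ee' a(3) b(3) unfolding matching_def by blast
      then have ab: "b \<noteq> a" "b' \<noteq> a" using a(1) b(1) by auto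
      define R2 where "R2 = insert {v, b} R1"
      have R2E: "R2 \<subseteq> E" using M1R b(8)[of v] unfolding R2_def T_def by auto
      have "red_wins V E R1 B1"
      proof (rule red_step[of "{v, b}"])
        show "{v, b} \<in> E - R1 - B1" using e'(2)[of v b] b unfolding T_def by auto
        show "3 \<le> card (iso B1)" by fact
        have "card R1 \<le> card R + 1" "card B1 \<le> card B + 1" unfolding R1_def B1_def
          using fin by (auto simp: card_insert_if)
        then show "card R1 + card B1 + 1 \<le> 4 * n" using size by simp
        show "finite R1" "finite B1" using B1 M1R E_finite_sub by auto
        fix f' assume f': "f' \<in> E - insert {v, b} R1 - B1"
        have free: "{t, b'} \<in> E - R2 - B1" if "t \<in> {u, a'}" for t
        proof -
          have "t \<in> T" using that unfolding T_def by auto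
          moreover have "{t, b'} \<noteq> {v, b}" using that b(2) bu U(2) a(5) by (auto simp: doubleton_eq_iff)
          ultimately show ?thesis using e'(2)[of t b'] b(1) b(8)[of t] unfolding R2_def by auto
        qed
        \<comment> \<open>Both completions use \<open>{v, b}\<close>. If \<open>{u, b'}\<close> is
          free, the edge \<open>{a, a'}\<close> is kept and \<open>M\<close> is rotated. If Blue
          took it, \<open>{u, a}\<close> is used instead, so \<open>M1\<close> is rotated and the
          last pair is \<open>a'\<close>, \<open>b'\<close>.\<close>
        show "red_wins V E (insert {v, b} R1) (insert f' B1)"
        proof (cases "f' = {u, b'}")
          case False
          define M2 where "M2 = insert {v, b} (M - {{b, b'}})"
          have M2: "matching M2" "\<Union>M2 = insert v (\<Union>M - {b'})"
            unfolding M2_def using matching_swap[OF mat _ b(2) uvV(4)] b by auto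
          have "V - \<Union>M2 = {u, b'}" using M2(2) UM uvV(1,2) U(2) bu b(2,6,7) by auto
          moreover have "M2 \<subseteq> R2" using sub unfolding M2_def R2_def R1_def by auto
          moreover have "{u, b'} \<in> E - R2 - insert f' B1" using free[of u] False by auto
          ultimately have "red_wins V E R2 (insert f' B1)" using R2E M2(1) by (intro win_free_pair)
          then show ?thesis unfolding R2_def .
        next
          case True
          define M2 where "M2 = insert {v, b} (M1 - {{b, b'}})"
          have "{b, b'} \<in> M1" using b ee' a unfolding M1_def by auto
          moreover have "v \<notin> \<Union>M1" using U1 by auto
          ultimately have M2: "matching M2" "\<Union>M2 = insert v (\<Union>M1 - {b'})"
            unfolding M2_def using matching_swap[OF M1(1) _ b(2)] by auto
          have "V - \<Union>M2 = {a', b'}" using M2(2) M1(2) UM uvV(1,2) U(2) bu b(2,6,7) a(2,4-7) ab by auto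
          moreover have "M2 \<subseteq> R2" using M1R unfolding M2_def R2_def by auto
          moreover have "{a', b'} \<in> E - R2 - insert f' B1"
            using free[of a'] True a(5) bu by (auto simp: doubleton_eq_iff)
          ultimately have "red_wins V E R2 (insert f' B1)" using R2E M2(1) by (intro win_free_pair)
          then show ?thesis unfolding R2_def .
        qed
      qed
      then show ?thesis unfolding R1_def B1_def .
    qed
  qed (use fin in auto)
qed

text \<open>Each induction step spends the two moves \<open>{u, a}\<close> and
  \<open>{a', x}\<close> on one pair, and Blue's two replies remove at most four untouched vertices.
  The four new edges raise degrees by at most 4 and one gadget is used up, so \<open>q\<close>
  becomes \<open>q + 4\<close> and \<open>G\<close> becomes \<open>G - 1\<close>; the term
  \<open>20 * z\<close> absorbs this.\<close>

lemma endgame: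
  assumes sub: "R \<subseteq> E" "B \<subseteq> E" "M \<subseteq> R" and mat: "matching M"
    and U: "card (V - \<Union>M) = 2 * z" "1 \<le> z"
    and gad: "\<And>T. T \<subseteq> V \<Longrightarrow> T \<noteq> {} \<Longrightarrow> card T \<le> 3 \<Longrightarrow> G \<le> card (gadgets M T)"
    and dg: "\<And>v. v \<in> V - \<Union>M \<Longrightarrow> deg (R \<union> B) v \<le> q"
    and hv: "card {x \<in> V. q < deg (R \<union> B) x} \<le> h"
    and isoc: "4 * z + 1 \<le> card (iso B) \<or> z = 1 \<and> 3 \<le> card (iso B) \<and> (V - \<Union>M) \<inter> iso B = {}"
    and size: "card R + card B + 4 * z \<le> 4 * n" and G: "3 * q + h + 20 * z \<le> G"
  shows "red_wins V E R B"
  using assms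
proof (induction z arbitrary: R B M q G)
  case 0
  then show ?case by simp
next
  case (Suc z)
  note sub = Suc.prems(1-3) and mat = Suc.prems(4) and U = Suc.prems(5) and gad = Suc.prems(7)
    and dg = Suc.prems(8) and hv = Suc.prems(9) and isoc = Suc.prems(10) and size = Suc.prems(11)
    and G = Suc.prems(12)
  have fin: "finite R" "finite B" "M \<subseteq> E" using sub E_finite_sub by auto
  show ?case
  proof (cases "z = 0")
    case True
    then have "card (V - \<Union>M) = 2" using U by simp
    then obtain u v where uv: "V - \<Union>M = {u, v}" "u \<noteq> v" by (meson card_2_iff)
    show ?thesis
    proof (rule endgame_pair[OF sub mat uv gad _ _ hv])
      show "5 \<le> card (iso B) \<or> 3 \<le> card (iso B) \<and> v \<notin> iso B" using isoc uv True by auto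
      show "deg (R \<union> B) u \<le> q" "deg (R \<union> B) v \<le> q" using dg uv by auto
      show "card R + card B + 3 \<le> 4 * n" using size by simp
      show "3 * q + h + 10 \<le> G" using G by simp
    qed
  next
    case False
    then have iso: "4 * Suc z + 1 \<le> card (iso B)" using isoc by auto
    have "3 \<le> card (V - \<Union>M)" using U False by simp
    then obtain T where T: "T \<subseteq> V - \<Union>M" "card T = 3" by (elim obtain_subset_with_card_n) auto
    then obtain u v w where uvw: "T = {u, v, w}" "u \<noteq> v" "u \<noteq> w" "v \<noteq> w" by (auto simp: card_3_iff)
    have TV: "u \<in> V" "v \<in> V" "w \<in> V" "u \<notin> \<Union>M" "v \<notin> \<Union>M" "w \<notin> \<Union>M" using T uvw by auto
    have "G \<le> card (gadgets M T)" using T by (intro gad) auto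
    moreover have "(\<Sum>t\<in>T. deg (R \<union> B) t) \<le> (\<Sum>t\<in>T. q)" using T dg by (intro sum_mono) auto
    ultimately have "(\<Sum>t\<in>T. deg (R \<union> B) t) + card ({}::nat set) < card (gadgets M T)"
      using G T by simp
    then obtain e where e: "e \<in> gadgets M T" "\<And>t y. t \<in> T \<Longrightarrow> y \<in> e \<Longrightarrow> {t, y} \<notin> R \<union> B"
      using pick_gadget[OF mat fin(3), of "R \<union> B" T "{}"] fin sub uvw by auto
    obtain a a' where a: "e = {a, a'}" "a \<noteq> a'" "e \<in> M" "a \<notin> T" "a' \<notin> T" "a \<in> V" "a' \<in> V"
      "\<And>x. x \<in> T \<Longrightarrow> {x, a} \<in> E \<and> {x, a'} \<in> E"
      using gadgetE[OF e(1) fin(3)] by metis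
    define R1 where "R1 = insert {u, a} R"
    define M1 where "M1 = insert {u, a} (M - {{a, a'}})"
    have M1: "matching M1" "\<Union>M1 = insert u (\<Union>M - {a'})"
      unfolding M1_def using matching_swap[OF mat _ a(2) TV(4)] a by auto
    have M1R: "M1 \<subseteq> R1" "R1 \<subseteq> E" using sub a(8)[of u] uvw unfolding M1_def R1_def by auto
    show ?thesis
    proof (rule red_step[of "{u, a}"])
      show "{u, a} \<in> E - R - B" using e(2)[of u a] a uvw by auto
      show "3 \<le> card (iso B)" using iso by simp
      show "card R + card B + 1 \<le> 4 * n" using size by simp
      fix f assume f: "f \<in> E - insert {u, a} R - B"
      define B1 where "B1 = insert f B"
      have B1: "B1 \<subseteq> E" "finite B1" using f sub fin unfolding B1_def by auto
      have cR1: "card R1 \<le> card R + 1" "card B1 \<le> card B + 1" unfolding R1_def B1_def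
        using fin by (auto simp: card_insert_if)
      \<comment> \<open>Blue's single reply cannot be both \<open>{a', v}\<close> and
        \<open>{a', w}\<close>, so Red completes the exchange at the other one. This is why three
        uncovered vertices are taken.\<close>
      obtain x where x: "x \<in> {v, w}" "f \<noteq> {a', x}" using uvw by (metis doubleton_eq_iff insertCI)
      have xT: "x \<in> T" "x \<noteq> u" "x \<in> V" "x \<notin> \<Union>M" "x \<noteq> a'" "x \<noteq> a" using x uvw TV a by auto
      have ax: "{a', x} \<in> E - R1 - B1"
      proof -
        have "{a', x} \<noteq> {u, a}" using xT a uvw by (auto simp: doubleton_eq_iff)
        moreover have "{a', x} \<notin> R \<union> B" using e(2)[of x a'] a xT by (auto simp: insert_commute)
        ultimately show ?thesis using x a(8)[of x] xT unfolding R1_def B1_def by (auto simp: insert_commute)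
      qed
      define R2 where "R2 = insert {a', x} R1"
      define M2 where "M2 = insert {a', x} M1"
      have R2E: "R2 \<subseteq> E" "finite R2" "finite R1" using M1R ax E_finite_sub unfolding R2_def by auto
      have M2: "matching M2" "M2 \<subseteq> R2" "M2 \<subseteq> E"
        unfolding M2_def R2_def using M1R ax M1 xT a uvw by (auto intro!: matching_insert)
      have a'M: "a \<in> \<Union>M" "a' \<in> \<Union>M" using a by auto
      have UM2: "V - \<Union>M2 = (V - \<Union>M) - {u, x}"
        unfolding M2_def using M1(2) a'M TV by auto
      have "red_wins V E R1 B1"
      proof (rule red_step[OF ax])
        have iso1: "4 * Suc z + 1 \<le> card (iso B1) + 2"
          using iso card_iso_insert[of f B] f unfolding B1_def by auto
        then show "3 \<le> card (iso B1)" by simp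
        show "card R1 + card B1 + 1 \<le> 4 * n" using cR1 size by simp
        show "finite R1" "finite B1" using R2E B1 by auto
        fix f' assume f': "f' \<in> E - insert {a', x} R1 - B1"
        define B2 where "B2 = insert f' B1"
        have B2: "B2 \<subseteq> E" "finite B2" using f' B1 unfolding B2_def by auto
        have cR2: "card R2 \<le> card R1 + 1" "card B2 \<le> card B1 + 1" unfolding R2_def B2_def
          using R2E B1 by (auto simp: card_insert_if)
        have "R2 \<union> B2 = insert {u, a} (insert f (insert {a', x} (insert f' (R \<union> B))))"
          unfolding R2_def B2_def R1_def B1_def by auto
        then have dinc: "deg (R2 \<union> B2) y \<le> deg (R \<union> B) y + 4" for y
          using deg_insert_le[of "insert f (insert {a', x} (insert f' (R \<union> B)))" "{u, a}" y]
            deg_insert_le[of "insert {a', x} (insert f' (R \<union> B))" f y]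
            deg_insert_le[of "insert f' (R \<union> B)" "{a', x}" y]
            deg_insert_le[of "R \<union> B" f' y] fin by simp
        have "red_wins V E R2 B2"
        proof (rule Suc.IH[OF R2E(1) B2(1) M2(2) M2(1), where q = "q + 4" and G = "G - 1"])
          have "card ((V - \<Union>M) - {u, x}) = card (V - \<Union>M) - card {u, x}"
            using TV xT by (intro card_Diff_subset) auto
          then show "card (V - \<Union>M2) = 2 * z" using U xT unfolding UM2 by simp
          show "1 \<le> z" using False by simp
          show "G - 1 \<le> card (gadgets M2 T)" if "T \<subseteq> V" "T \<noteq> {}" "card T \<le> 3" for T
          proof -
            have "card (gadgets M T) \<le> card (gadgets M2 T) + 1"
              by (rule card_gadgets_remove[where e = "{a, a'}"]) (use fin M2 in \<open>auto simp: M2_def M1_def\<close>)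
            then show ?thesis using gad[OF that] by simp
          qed
          show "deg (R2 \<union> B2) y \<le> q + 4" if "y \<in> V - \<Union>M2" for y
            using dinc[of y] dg[of y] that unfolding UM2 by auto
          have "{x \<in> V. q + 4 < deg (R2 \<union> B2) x} \<subseteq> {x \<in> V. q < deg (R \<union> B) x}"
            using dinc by (auto dest!: less_le_trans[OF _ dinc])
          then have "card {x \<in> V. q + 4 < deg (R2 \<union> B2) x} \<le> card {x \<in> V. q < deg (R \<union> B) x}"
            by (intro card_mono) auto
          then show "card {x \<in> V. q + 4 < deg (R2 \<union> B2) x} \<le> h" using hv by simp
          have "card (iso B1) \<le> card (iso B2) + 2" unfolding B2_def using card_iso_insert f' by auto
          then show "4 * z + 1 \<le> card (iso B2) \<or> z = 1 \<and> 3 \<le> card (iso B2) \<and> (V - \<Union>M2) \<inter> iso B2 = {}"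
            using iso1 by simp
          show "card R2 + card B2 + 4 * z \<le> 4 * n" using cR1 cR2 size by simp
          show "3 * (q + 4) + h + 20 * z \<le> G - 1" using G by simp
        qed
        then show "red_wins V E (insert {a', x} R1) (insert f' B1)" unfolding R2_def B2_def .
      qed
      then show "red_wins V E (insert {u, a} R) (insert f B)" unfolding R1_def B1_def .
    qed (use fin in auto)
  qed
qed

end

section \<open>Blue with a heavy vertex\<close>

text \<open>Eleven vertices: one may be lost when a leftover vertex is attached, five to the
  vertices passed on from the preceding unit, and five must remain so that a vertex with only Blue
  edges to them has Blue degree at least five.\<close>

definition unit :: "nat \<Rightarrow> nat set" where
  "unit j = {11 * j..<11 * j + 11}"

lemma finite_unit [simp]: "finite (unit j)" unfolding unit_def by simp
lemma card_unit [simp]: "card (unit j) = 11" unfolding unit_def by simp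

lemma unit_disjoint: "i \<noteq> j \<Longrightarrow> unit i \<inter> unit j = {}"
  unfolding unit_def by auto

text \<open>For \<open>T = {}\<close> this says only that the unit is a clique.\<close>

definition joined_in :: "nat set set \<Rightarrow> nat set \<Rightarrow> nat \<Rightarrow> bool" where
  "joined_in E T j \<longleftrightarrow> unit j \<inter> T = {} \<and> (\<forall>x\<in>unit j. \<forall>y\<in>unit j \<union> T. x \<noteq> y \<longrightarrow> {x, y} \<in> E)"

abbreviation (in board) joined :: "nat set \<Rightarrow> nat \<Rightarrow> bool" where
  "joined \<equiv> joined_in E"

text \<open>\<open>D\<close> is the Blue degree from which a vertex counts as heavy and \<open>h\<close> bounds the number of heavy
  vertices. \<open>t1\<close> moves are spent on gadgets, which leaves \<open>G\<close> of them for every triple. \<open>L\<close> is the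
  length of the path of cliques, \<open>N1\<close> bounds the size of a set without free edges, and \<open>N2\<close> the
  number of vertices still uncovered when the endgame starts.\<close>
locale strategy = board n E for n :: nat and E :: "nat set set" +
  fixes m D h G N1 N2 t1 L N :: nat and c :: real
  assumes n_even: "n = 2 * m"
    and c_pos: "0 < c" and c_le: "c \<le> 1"
    and units_fit: "11 * N \<le> n"
    and many_joined: "\<And>T. T \<subseteq> {..<n} \<Longrightarrow> T \<noteq> {} \<Longrightarrow> card T \<le> 14 \<Longrightarrow>
          c * N \<le> card {j \<in> {..<N}. joined T j}"
    and dense: "\<And>X. X \<subseteq> {..<n} \<Longrightarrow> N1 < card X \<Longrightarrow> 4 * n < card {e \<in> E. e \<subseteq> X}"
    and D_ge: "4 \<le> D" "N2 + 2 * h + 2 \<le> D"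
    and h_ge: "2 * n < (h + 1) * D"
    and N2_def: "N2 = N1 + 11 * L" and N1_ge: "3 \<le> N1" and N2_le: "N2 \<le> n"
    and L_pos: "1 \<le> L"
    and G_ge: "3 * (D + 2 * h + 2) + 2 * h + 10 * N2 \<le> G"
    and c_ge: "2 * real (D + 4 * t1 + 4 * h + 4 + L) \<le> c * N"
    and gadget_weight: "real n ^ 3 * (1 - c / 4) ^ t1 \<le> (1 / 2) ^ G"
    and path_weight: "real n ^ 3 * (1 - c / 4) ^ L \<le> (1 / 2) ^ (N1 + 1)"
begin

lemma unit_sub: "j < N \<Longrightarrow> unit j \<subseteq> V"
  using units_fit unfolding unit_def by auto

text \<open>Every unit joined to \<open>{u}\<close> supplies the neighbour \<open>11 * j\<close>,
  and \<open>many_joined\<close> with \<open>c_ge\<close> provides enough such units.\<close>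

lemma min_degree:
  assumes "u \<in> V" shows "2 * (D + 4 * t1 + 4 * h + 4 + L) \<le> card {y \<in> V. {u, y} \<in> E}"
proof -
  define J where "J = {j \<in> {..<N}. joined {u} j}"
  have "c * N \<le> card J" unfolding J_def using assms by (intro many_joined) auto
  then have 1: "2 * (D + 4 * t1 + 4 * h + 4 + L) \<le> card J" using c_ge by linarith
  have "(\<lambda>j. 11 * j) ` J \<subseteq> {y \<in> V. {u, y} \<in> E}"
  proof
    fix y assume "y \<in> (\<lambda>j. 11 * j) ` J"
    then obtain j where j: "j < N" "joined {u} j" "y = 11 * j" unfolding J_def by auto
    then have "y \<in> unit j" unfolding unit_def by auto
    then show "y \<in> {y \<in> V. {u, y} \<in> E}" using j unit_sub[OF j(1)] unfolding joined_in_def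
      by (auto simp: insert_commute)
  qed
  then have "card J \<le> card {y \<in> V. {u, y} \<in> E}"
    by (intro card_inj_on_le[of "\<lambda>j. 11 * j"]) (auto simp: inj_on_def)
  then show ?thesis using 1 by simp
qed

definition heavy :: "nat set set \<Rightarrow> nat set" where
  "heavy B = {v \<in> V. D \<le> deg B v}"

lemma finite_heavy [simp]: "finite (heavy B)" unfolding heavy_def by simp

lemma heavy_mono: "finite B' \<Longrightarrow> B \<subseteq> B' \<Longrightarrow> heavy B \<subseteq> heavy B'"
  unfolding heavy_def using deg_mono[of B' B] by (auto intro: le_trans)

lemma card_heavy:
  assumes "B \<subseteq> E" shows "card (heavy B) * D \<le> 2 * card B"
proof -
  have "card (heavy B) * D = (\<Sum>v\<in>heavy B. D)" by simp
  also have "\<dots> \<le> (\<Sum>v\<in>heavy B. deg B v)" unfolding heavy_def by (intro sum_mono) auto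
  also have "\<dots> \<le> (\<Sum>v\<in>V. deg B v)" unfolding heavy_def by (intro sum_mono2) auto
  finally show ?thesis using deg_sum[OF assms] by simp
qed

lemma card_heavy_le:
  assumes "B \<subseteq> E" "card B \<le> n" shows "card (heavy B) \<le> h"
proof (rule ccontr)
  assume "\<not> card (heavy B) \<le> h"
  then have "(h + 1) * D \<le> card (heavy B) * D" by (intro mult_right_mono) auto
  also have "\<dots> \<le> 2 * n" using card_heavy[OF assms(1)] assms(2) by simp
  finally show False using h_ge by simp
qed

text \<open>A single heavy vertex already accounts for \<open>D - 1\<close> wasted half-edges. This
  is the reserve that \<open>slow_win\<close> spends.\<close>

lemma iso_heavy:
  assumes "B \<subseteq> E" "v \<in> heavy B"
  shows "n + D \<le> card (iso B) + 2 * card B + 1"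
  using iso_lower[OF assms(1), of "{v}"] assms(2) unfolding heavy_def by auto

lemma deg_Un_le: "deg (R \<union> B) v \<le> deg R v + deg B v"
proof -
  have "{e \<in> R \<union> B. v \<in> e} = {e \<in> R. v \<in> e} \<union> {e \<in> B. v \<in> e}" by auto
  then show ?thesis unfolding deg_def by (simp add: card_Un_le)
qed

lemma deg_matching_le:
  assumes "matching M" "M \<subseteq> R" "R \<subseteq> E" "card R \<le> card M + k"
  shows "deg R v \<le> k + 1"
proof -
  have fR: "finite R" using assms E_finite_sub by blast
  then have fM: "finite M" using assms finite_subset by blast
  have "{e \<in> R. v \<in> e} \<subseteq> {e \<in> M. e \<inter> {v} \<noteq> {}} \<union> (R - M)" by auto
  then have "deg R v \<le> card ({e \<in> M. e \<inter> {v} \<noteq> {}} \<union> (R - M))"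
    unfolding deg_def using fR fM by (intro card_mono) auto
  also have "\<dots> \<le> card {e \<in> M. e \<inter> {v} \<noteq> {}} + card (R - M)" by (rule card_Un_le)
  also have "\<dots> \<le> 1 + k"
    using card_matching_hit[OF assms(1), of "{v}"] card_Diff_subset[OF fM assms(2)] assms(4) by simp
  finally show ?thesis by simp
qed

lemma free_edge:
  assumes "X \<subseteq> V" "N1 < card X" "R \<subseteq> E" "B \<subseteq> E" "card R + card B \<le> 4 * n"
  obtains e where "e \<in> E - R - B" "e \<subseteq> X"
proof -
  have "\<not> {e \<in> E. e \<subseteq> X} \<subseteq> R \<union> B"
  proof
    assume "{e \<in> E. e \<subseteq> X} \<subseteq> R \<union> B"
    then have "card {e \<in> E. e \<subseteq> X} \<le> card (R \<union> B)"
      using assms E_finite_sub by (intro card_mono) auto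
    then show False using dense[OF assms(1,2)] card_Un_le[of R B] assms(5) by linarith
  qed
  then show thesis using that by blast
qed

text \<open>Once Blue has a vertex of degree \<open>D\<close> he has wasted so many half-edges that Red can afford
  a few wasted moves, which he uses to keep his uncovered vertices at low Blue degree: a heavy
  uncovered vertex is exchanged for the partner of one of its neighbours.\<close>
lemma slow_win:
  assumes "R \<subseteq> E" "B \<subseteq> E" "M \<subseteq> R" "matching M" "card R = card B"
    and "card R \<le> card M + card (heavy B \<inter> \<Union>M)"
    and "\<And>v. v \<in> V - \<Union>M \<Longrightarrow> deg B v \<le> D + card (heavy B \<inter> \<Union>M) + 1"
    and "heavy B \<noteq> {}"
    and "\<And>T. T \<subseteq> V \<Longrightarrow> T \<noteq> {} \<Longrightarrow> card T \<le> 3 \<Longrightarrow> G \<le> card (gadgets M T) + card (heavy B \<inter> \<Union>M)"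
    and "V - \<Union>M \<noteq> {}"
  shows "red_wins V E R B"
  using assms
\<comment> \<open>The number of covered heavy vertices is the account for all losses. Every wasted
  move covers a new heavy vertex, a covered one stays covered, and there are at most
  \<open>h\<close>. Lost gadgets and the growth of Blue degrees at uncovered vertices are charged to
  the same account.\<close>
proof (induction "card E - card R" arbitrary: R B M rule: less_induct)
  case less
  note sub = less.prems(1-3) and mat = less.prems(4) and RB = less.prems(5) and RM = less.prems(6)
    and dg = less.prems(7) and hne = less.prems(8) and gad = less.prems(9) and Une = less.prems(10)
  have fin: "finite R" "finite B" "M \<subseteq> E" "finite M" using sub E_finite_sub by auto
  have UM: "\<Union>M \<subseteq> V" using fin edge_sub by blast
  have cU: "card (V - \<Union>M) + 2 * card M = n" by (rule card_uncovered[OF fin(3) mat])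
  have hc: "card (heavy B \<inter> \<Union>M) \<le> card (heavy B)" by (intro card_mono) auto
  \<comment> \<open>\<open>card_heavy_le\<close> needs a bound on \<open>card B\<close> first. By
    \<open>4 \<le> D\<close> there are at most \<open>card B / 2\<close> heavy vertices, so at most
    half of Red's moves are wasted and \<open>card R \<le> 2 * card M \<le> n\<close>.\<close>
  have "4 * card (heavy B) \<le> card (heavy B) * D" using D_ge by simp
  then have "4 * card (heavy B) \<le> 2 * card B" using card_heavy[OF sub(2)] by linarith
  then have Rn: "card R \<le> n" using RM hc cU RB by linarith
  then have ch: "card (heavy B) \<le> h" using card_heavy_le sub(2) RB by simp
  then have hch: "card (heavy B \<inter> \<Union>M) \<le> h" using hc by simp
  obtain v0 where "v0 \<in> heavy B" using hne by blast
  then have iso: "n + D \<le> card (iso B) + 2 * card B + 1" using iso_heavy sub(2) by blast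
  have dR: "deg R v \<le> h + 1" for v using deg_matching_le[OF mat sub(3,1), of h] RM hch by simp
  have dU: "deg (R \<union> B) v \<le> D + 2 * h + 2" if "v \<in> V - \<Union>M" for v
    using deg_Un_le[of R B v] dR[of v] dg[OF that] hch by simp
  have "even n" using n_even by simp
  then have "even (card (V - \<Union>M))" using cU by (metis dvd_add_left_iff dvd_triv_left)
  then obtain z where z: "card (V - \<Union>M) = 2 * z" by (elim evenE)
  have z1: "1 \<le> z" using z Une by (cases z) auto
  show ?case
  proof (cases "card (V - \<Union>M) \<le> N2")
    case True
    show ?thesis
    proof (rule endgame[OF sub mat z z1, where q = "D + 2 * h + 2" and h = h and G = "G - h"])
      show "G - h \<le> card (gadgets M T)" if "T \<subseteq> V" "T \<noteq> {}" "card T \<le> 3" for T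
        using gad[OF that] hch by simp
      show "deg (R \<union> B) v \<le> D + 2 * h + 2" if "v \<in> V - \<Union>M" for v using dU[OF that] .
      have "{x \<in> V. D + 2 * h + 2 < deg (R \<union> B) x} \<subseteq> heavy B"
      proof
        fix x assume "x \<in> {x \<in> V. D + 2 * h + 2 < deg (R \<union> B) x}"
        then show "x \<in> heavy B" using deg_Un_le[of R B x] dR[of x] unfolding heavy_def by auto
      qed
      then have "card {x \<in> V. D + 2 * h + 2 < deg (R \<union> B) x} \<le> card (heavy B)" by (intro card_mono) auto
      then show "card {x \<in> V. D + 2 * h + 2 < deg (R \<union> B) x} \<le> h" using ch by simp
      \<comment> \<open>This is where \<open>N2 + 2 * h + 2 \<le> D\<close> enters: to the
        \<open>2 * z\<close> uncovered vertices the heavy vertex adds \<open>D - 1\<close>, Red's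
        wasted moves subtract at most \<open>2 * h\<close>, and
        \<open>2 * z \<le> N2\<close>.\<close>
      show "4 * z + 1 \<le> card (iso B) \<or> z = 1 \<and> 3 \<le> card (iso B) \<and> (V - \<Union>M) \<inter> iso B = {}"
        using iso cU RB RM hch z True D_ge by linarith
      show "card R + card B + 4 * z \<le> 4 * n" using Rn RB z True N2_le by linarith
      show "3 * (D + 2 * h + 2) + h + 20 * z \<le> G - h" using G_ge z True by linarith
    qed
  next
    case False
    have iso3: "3 \<le> card (iso B)" using iso cU RB RM hch False D_ge N2_def N1_ge by linarith
    have size: "card R + card B + 1 \<le> 4 * n" using Rn RB N2_le N2_def N1_ge by linarith
    have measure: "card E - card (insert e R) < card E - card R" if "e \<in> E - R - B" for e
    proof -
      have "card (insert e R) \<le> card E" using that sub by (intro card_mono) auto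
      then show ?thesis using that fin by simp
    qed
    have direct: ?thesis if e: "e \<in> E - R - B" "e \<subseteq> V - \<Union>M"
      and hv: "heavy B \<inter> (V - \<Union>M) = {} \<or> heavy B \<inter> e \<noteq> {}" for e
    proof (rule red_step[OF e(1) iso3 size])
      fix f assume f: "f \<in> E - insert e R - B"
      define M' where "M' = insert e M"
      have UM': "\<Union>M' = e \<union> \<Union>M" unfolding M'_def by simp
      have mono: "heavy B \<subseteq> heavy (insert f B)" using fin by (intro heavy_mono) auto
      have c1: "card (heavy B \<inter> \<Union>M) \<le> card (heavy (insert f B) \<inter> \<Union>M')"
        using mono UM' by (intro card_mono) auto
      have c2: "card (heavy B \<inter> \<Union>M) + 1 \<le> card (heavy (insert f B) \<inter> \<Union>M')" if eh: "heavy B \<inter> e \<noteq> {}"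
      proof -
        obtain x where x: "x \<in> heavy B" "x \<in> e" using eh by blast
        then have "insert x (heavy B \<inter> \<Union>M) \<subseteq> heavy (insert f B) \<inter> \<Union>M'" using mono UM' by auto
        then have "card (insert x (heavy B \<inter> \<Union>M)) \<le> card (heavy (insert f B) \<inter> \<Union>M')" by (intro card_mono) auto
        moreover have "x \<notin> heavy B \<inter> \<Union>M" using x(2) e(2) by auto
        ultimately show ?thesis by simp
      qed
      have M': "matching M'" unfolding M'_def using mat e(2) by (intro matching_insert) auto
      show "red_wins V E (insert e R) (insert f B)"
      proof (rule less.hyps[OF measure[OF e(1)], where M = M'])
        show "insert e R \<subseteq> E" "insert f B \<subseteq> E" "M' \<subseteq> insert e R" using e f sub unfolding M'_def by auto
        show "matching M'" by fact
        show "card (insert e R) = card (insert f B)" using e f fin RB by simp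
        have "e \<notin> M" using e(1) sub by auto
        then show "card (insert e R) \<le> card M' + card (heavy (insert f B) \<inter> \<Union>M')"
          using e RM c1 fin unfolding M'_def by simp
        \<comment> \<open>Either the move covers a heavy vertex and the raised count pays for Blue's
          new edge, or no uncovered vertex was heavy and the degree was below
          \<open>D\<close>.\<close>
        show "deg (insert f B) v \<le> D + card (heavy (insert f B) \<inter> \<Union>M') + 1" if "v \<in> V - \<Union>M'" for v
        proof (cases "heavy B \<inter> e \<noteq> {}")
          case True
          then show ?thesis using c2 dg[of v] deg_insert_le[of B f v] fin that UM' by auto
        next
          case False
          then have "v \<notin> heavy B" using hv that UM' by blast
          then show ?thesis using deg_insert_le[of B f v] fin that unfolding heavy_def by auto
        qed
        show "heavy (insert f B) \<noteq> {}" using mono hne by auto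
        show "G \<le> card (gadgets M' T) + card (heavy (insert f B) \<inter> \<Union>M')"
          if T: "T \<subseteq> V" "T \<noteq> {}" "card T \<le> 3" for T
        proof -
          have "gadgets M T \<subseteq> gadgets M' T" unfolding gadgets_def M'_def by auto
          then have "card (gadgets M T) \<le> card (gadgets M' T)"
            using fin(3) e finite_gadgets[of M'] unfolding M'_def by (intro card_mono) auto
          then show ?thesis using gad[OF T] c1 by linarith
        qed
        have "card (V - \<Union>M) \<le> card (V - \<Union>M') + card e"
        proof -
          have "card (V - \<Union>M) \<le> card ((V - \<Union>M') \<union> e)"
            using UM' e(1) edge_finite by (intro card_mono) auto
          then show ?thesis using card_Un_le[of "V - \<Union>M'" e] by linarith
        qed
        then have "0 < card (V - \<Union>M')" using edge_card[of e] e(1) False N2_def N1_ge by auto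
        then show "V - \<Union>M' \<noteq> {}" by (metis card.empty less_irrefl)
      qed
    qed (use fin in auto)
    show ?thesis
    proof (cases "heavy B \<inter> (V - \<Union>M) = {}")
      case True
      have "N1 < card (V - \<Union>M)" using False N2_def by simp
      moreover have "card R + card B \<le> 4 * n" using size by simp
      ultimately obtain e where "e \<in> E - R - B" "e \<subseteq> V - \<Union>M"
        using free_edge[of "V - \<Union>M" R B] sub by blast
      then show ?thesis using direct True by blast
    next
      case hvU: False
      then obtain u where u: "u \<in> heavy B" "u \<in> V - \<Union>M" by blast
      define X where "X = {y \<in> V. {u, y} \<in> E}"
      define F where "F = {y. {u, y} \<in> R \<union> B}"
      \<comment> \<open>Choosing \<open>y\<close> outside these edges ensures that the rotation
        exposes no heavy vertex: the partner \<open>a'\<close> of \<open>y\<close> has Blue degree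
        below \<open>D\<close>.\<close>
      define MH where "MH = {e \<in> M. e \<inter> heavy B \<noteq> {}}"
      have F: "finite F" "card F \<le> D + 2 * h + 2"
      proof -
        have inj: "inj_on (\<lambda>y. {u, y}) F" by (auto simp: inj_on_def doubleton_eq_iff)
        have im: "(\<lambda>y. {u, y}) ` F \<subseteq> {e \<in> R \<union> B. u \<in> e}" unfolding F_def by auto
        have f: "finite {e \<in> R \<union> B. u \<in> e}" using fin by auto
        show "finite F" using inj_on_finite[OF inj im f] .
        have "card F \<le> deg (R \<union> B) u" unfolding deg_def using card_inj_on_le[OF inj im f] .
        then show "card F \<le> D + 2 * h + 2" using dU[OF u(2)] by simp
      qed
      have "card MH \<le> h" unfolding MH_def using card_matching_hit[OF mat, of "heavy B"] ch by simp
      moreover have MH: "MH \<subseteq> E" "matching MH" using fin(3) matching_subset[OF mat, of MH] unfolding MH_def by auto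
      ultimately have cMH: "card (\<Union>MH) \<le> 2 * h" using card_Union_matching by simp
      have "\<not> X \<subseteq> F \<union> \<Union>MH"
      proof
        assume *: "X \<subseteq> F \<union> \<Union>MH"
        have "\<Union>MH \<subseteq> V" using MH edge_sub by blast
        then have "finite (\<Union>MH)" using finite_subset by blast
        then have "card X \<le> card (F \<union> \<Union>MH)" using * F by (intro card_mono) auto
        also have "\<dots> \<le> D + 2 * h + 2 + 2 * h" using card_Un_le[of F "\<Union>MH"] F cMH by linarith
        finally show False using min_degree[of u] u unfolding X_def by auto
      qed
      then obtain y where y: "{u, y} \<in> E" "y \<in> V" "{u, y} \<notin> R \<union> B" "y \<notin> \<Union>MH"
        unfolding X_def F_def by blast
      show ?thesis
      proof (cases "y \<in> \<Union>M")
        case False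
        show ?thesis by (rule direct[of "{u, y}"]) (use y u False in auto)
      next
        case True
        then obtain e where e: "e \<in> M" "y \<in> e" by blast
        then have "e \<in> E" using fin(3) by blast
        then obtain a' where a': "e = {y, a'}" "y \<noteq> a'" using edge_memE[OF _ e(2)] by metis
        have a'h: "a' \<notin> heavy B" using y(4) e a' unfolding MH_def by auto
        define M' where "M' = insert {u, y} (M - {{y, a'}})"
        have M': "matching M'" "\<Union>M' = insert u (\<Union>M - {a'})"
          unfolding M'_def using matching_swap[OF mat _ a'(2)] e a' u by auto
        have a'M: "a' \<in> \<Union>M" using e a' by auto
        have uyM: "{u, y} \<notin> M" using u by auto
        have cM': "card M' = card M"
        proof -
          have "card M' = Suc (card (M - {{y, a'}}))"
            unfolding M'_def using fin uyM by (intro card_insert_disjoint) auto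
          also have "\<dots> = card M" using e a' fin by (metis card_Suc_Diff1)
          finally show ?thesis .
        qed
        have M'E: "M' \<subseteq> insert {u, y} R" "M' \<subseteq> E" using sub y fin unfolding M'_def by auto
        show ?thesis
        proof (rule red_step[of "{u, y}", OF _ iso3 size])
          show uy: "{u, y} \<in> E - R - B" using y by auto
          fix f assume f: "f \<in> E - insert {u, y} R - B"
          have mono: "heavy B \<subseteq> heavy (insert f B)" using fin by (intro heavy_mono) auto
          have c2: "card (heavy B \<inter> \<Union>M) + 1 \<le> card (heavy (insert f B) \<inter> \<Union>M')"
          proof -
            have "insert u (heavy B \<inter> \<Union>M) \<subseteq> heavy (insert f B) \<inter> \<Union>M'" using mono M'(2) u a'h by auto
            then have "card (insert u (heavy B \<inter> \<Union>M)) \<le> card (heavy (insert f B) \<inter> \<Union>M')" by (intro card_mono) auto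
            then show ?thesis using u by simp
          qed
          show "red_wins V E (insert {u, y} R) (insert f B)"
          proof (rule less.hyps[OF measure[OF uy], where M = M'])
            show "insert {u, y} R \<subseteq> E" "insert f B \<subseteq> E" using y f sub by auto
            show "M' \<subseteq> insert {u, y} R" by fact
            show "matching M'" by fact
            show "card (insert {u, y} R) = card (insert f B)" using uy f fin RB by simp
            show "card (insert {u, y} R) \<le> card M' + card (heavy (insert f B) \<inter> \<Union>M')"
              using uy RM c2 fin cM' by simp
            show "deg (insert f B) v \<le> D + card (heavy (insert f B) \<inter> \<Union>M') + 1" if "v \<in> V - \<Union>M'" for v
            proof (cases "v = a'")
              case True
              then show ?thesis using deg_insert_le[of B f v] fin that a'h unfolding heavy_def by auto
            next
              case False
              then have "v \<in> V - \<Union>M" using that M'(2) by auto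
              then show ?thesis using c2 dg[of v] deg_insert_le[of B f v] fin by auto
            qed
            show "heavy (insert f B) \<noteq> {}" using mono hne by auto
            show "G \<le> card (gadgets M' T) + card (heavy (insert f B) \<inter> \<Union>M')"
              if T: "T \<subseteq> V" "T \<noteq> {}" "card T \<le> 3" for T
            proof -
              have "M - {{y, a'}} \<subseteq> M'" unfolding M'_def by auto
              from card_gadgets_remove[OF fin(3) M'E(2) this, of T] show ?thesis
                using gad[OF T] c2 by linarith
            qed
            have "a' \<noteq> u" using a'h u by auto
            then have "a' \<in> V - \<Union>M'" using M'(2) a'M UM by auto
            then show "V - \<Union>M' \<noteq> {}" by auto
          qed
        qed (use fin in auto)
      qed
    qed
  qed
qed

end

section \<open>Choosing cliques by averaging\<close>

context board begin

lemma joined_Un: "joined (S \<union> T) j \<Longrightarrow> joined S j \<and> joined T j"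
  unfolding joined_in_def by auto

definition triples :: "nat set set" where
  "triples = {T. T \<subseteq> V \<and> T \<noteq> {} \<and> card T \<le> 3}"

lemma finite_triples [simp]: "finite triples"
  by (rule finite_subset[of _ "Pow V"]) (auto simp: triples_def)

lemma card_triples: "card triples \<le> n ^ 3"
proof -
  have "triples \<subseteq> (\<lambda>(x, y, z). {x, y, z}) ` (V \<times> V \<times> V)"
  proof
    fix T assume "T \<in> triples"
    then have T: "T \<subseteq> V" "T \<noteq> {}" "card T \<le> 3" unfolding triples_def by auto
    have fT: "finite T" using T(1) finite_subset by blast
    then have "card T \<in> {1, 2, 3}" using T card_gt_0_iff[of T] by auto
    then have "\<exists>x y z. T = {x, y, z}"
      by (elim insertE) (auto simp: card_1_singleton_iff card_2_iff card_3_iff)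
    then obtain x y z where "T = {x, y, z}" by blast
    then show "T \<in> (\<lambda>(x, y, z). {x, y, z}) ` (V \<times> V \<times> V)" using T(1) by force
  qed
  then have "card triples \<le> card ((\<lambda>(x, y, z). {x, y, z}) ` (V \<times> V \<times> V))" by (intro card_mono) auto
  also have "\<dots> \<le> card (V \<times> V \<times> V)" by (intro card_image_le) auto
  also have "\<dots> = n ^ 3" by (simp add: card_cartesian_product power3_eq_cube)
  finally show ?thesis .
qed

text \<open>An exponential potential. All summands are positive, so a total of at most
  \<open>(1 / 2) ^ K\<close> forces every triple to have at least \<open>K\<close> joined units in
  \<open>S\<close>.\<close>

definition weight :: "nat set \<Rightarrow> real" where
  "weight S = (\<Sum>T\<in>triples. (1 / 2) ^ card {j \<in> S. joined T j})"

lemma weight_empty: "weight {} \<le> real n ^ 3"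
proof -
  have "weight {} = real (card triples)" unfolding weight_def by simp
  also have "\<dots> \<le> real (n ^ 3)" using card_triples by (simp only: of_nat_le_iff)
  finally show ?thesis by simp
qed

lemma weight_count:
  assumes "weight S \<le> (1 / 2) ^ K" "T \<in> triples"
  shows "K \<le> card {j \<in> S. joined T j}"
proof -
  have "(1 / 2 :: real) ^ card {j \<in> S. joined T j} \<le> weight S"
    unfolding weight_def using assms(2)
    by (intro member_le_sum[of T triples "\<lambda>T. (1 / 2) ^ card {j \<in> S. joined T j}"]) auto
  then have "(1 / 2 :: real) ^ card {j \<in> S. joined T j} \<le> (1 / 2) ^ K" using assms(1) by (rule order_trans)
  then show ?thesis by (subst (asm) power_decreasing_iff) auto
qed

end

context strategy begin

text \<open>Derandomisation: on average over the admissible units the weight drops by this factor.\<close>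
lemma weight_step:
  assumes "S \<subseteq> F" "F \<subseteq> {..<N}" "real (card F) \<le> c * N / 2" "C \<subseteq> V" "card C \<le> 11"
  obtains j where "j \<in> {..<N} - F" "joined C j" "weight (insert j S) \<le> (1 - c / 4) * weight S"
proof -
  define w where "w T = (1 / 2 :: real) ^ card {j \<in> S. joined T j}" for T
  define J where "J = {j \<in> {..<N} - F. joined C j}"
  define g where "g j = (\<Sum>T\<in>triples. if joined T j then w T else 0)" for j
  have fJ: "finite J" unfolding J_def by auto
  have w0: "0 < w T" for T unfolding w_def by simp
  have "0 < 2 * real (D + 4 * t1 + 4 * h + 4 + L)" using D_ge by simp
  then have "0 < c * N" using c_ge by (rule less_le_trans)
  then have Npos: "0 < N" by (cases N) auto
  then have "0 < n" using units_fit by simp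
  then have "{0} \<in> triples" unfolding triples_def by auto
  then have W0: "0 < weight S" unfolding weight_def by (intro sum_pos) auto
  have cnt: "c * N / 2 \<le> card {j \<in> J. joined T j}" if "T \<in> triples" for T
  proof -
    have T: "T \<subseteq> V" "T \<noteq> {}" "card T \<le> 3" using that unfolding triples_def by auto
    \<comment> \<open>The origin of 14: a triple together with one unit of 11 vertices.\<close>
    have "card (T \<union> C) \<le> 14" using T assms card_Un_le[of T C] by simp
    then have "c * N \<le> card {j \<in> {..<N}. joined (T \<union> C) j}" using T assms by (intro many_joined) auto
    moreover have "card {j \<in> {..<N}. joined (T \<union> C) j} \<le> card ({j \<in> J. joined T j} \<union> F)"
      unfolding J_def using assms(2) finite_subset[OF assms(2)] by (intro card_mono) (auto dest: joined_Un)
    moreover have "card ({j \<in> J. joined T j} \<union> F) \<le> card {j \<in> J. joined T j} + card F" by (rule card_Un_le)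
    ultimately show ?thesis using assms(3) by linarith
  qed
  \<comment> \<open>Double counting: every triple is joined to at least \<open>c * N / 2\<close>
    units of \<open>J\<close>, and \<open>J\<close> has at most \<open>N\<close> elements. So some
    unit is joined to triples carrying a \<open>c / 2\<close> fraction of the weight, and adding it
    halves their share.\<close>
  have "\<exists>j\<in>J. c / 2 * weight S \<le> g j"
  proof (rule ccontr)
    assume "\<not> ?thesis"
    then have less: "g j < c / 2 * weight S" if "j \<in> J" for j using that by force
    have "c * N / 2 \<le> card {j \<in> J. joined {0} j}" by (rule cnt) fact
    then have "J \<noteq> {}" using \<open>0 < c * N\<close> by (cases "J = {}") auto
    then have "(\<Sum>j\<in>J. g j) < (\<Sum>j\<in>J. c / 2 * weight S)" using fJ less by (intro sum_strict_mono) auto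
    also have "\<dots> = card J * (c / 2 * weight S)" by simp
    also have "\<dots> \<le> N * (c / 2 * weight S)"
    proof (rule mult_right_mono)
      have "card J \<le> card {..<N}" unfolding J_def by (intro card_mono) auto
      then show "real (card J) \<le> real N" by simp
      show "0 \<le> c / 2 * weight S" using c_pos W0 by simp
    qed
    finally have 1: "(\<Sum>j\<in>J. g j) < c * N / 2 * weight S" by (simp add: algebra_simps)
    have "c * N / 2 * weight S = (\<Sum>T\<in>triples. c * N / 2 * w T)"
      unfolding weight_def w_def by (simp add: sum_distrib_left)
    also have "\<dots> \<le> (\<Sum>T\<in>triples. card {j \<in> J. joined T j} * w T)"
      using cnt w0 by (intro sum_mono mult_right_mono) (auto intro: less_imp_le)
    also have "\<dots> = (\<Sum>T\<in>triples. \<Sum>j\<in>J. if joined T j then w T else 0)"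
      by (intro sum.cong refl) (simp add: sum.inter_filter[OF fJ, symmetric])
    also have "\<dots> = (\<Sum>j\<in>J. g j)" unfolding g_def by (rule sum.swap)
    finally show False using 1 by simp
  qed
  then obtain j where j: "j \<in> J" "c / 2 * weight S \<le> g j" by blast
  have jS: "j \<notin> S" using j assms(1) unfolding J_def by auto
  have fS: "finite S" using finite_subset[OF subset_trans[OF assms(1,2)]] by simp
  have "weight (insert j S) = (\<Sum>T\<in>triples. w T - (1 / 2) * (if joined T j then w T else 0))"
    unfolding weight_def
  proof (intro sum.cong refl)
    fix T
    have "{i \<in> insert j S. joined T i} = (if joined T j then insert j {i \<in> S. joined T i} else {i \<in> S. joined T i})"
      by auto
    then show "(1 / 2) ^ card {i \<in> insert j S. joined T i} = w T - 1 / 2 * (if joined T j then w T else 0)"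
      using jS fS unfolding w_def by auto
  qed
  also have "\<dots> = weight S - (1 / 2) * g j"
    unfolding sum_subtractf g_def weight_def w_def by (simp add: sum_distrib_left)
  finally have "weight (insert j S) \<le> (1 - c / 4) * weight S" using j(2) by (simp add: algebra_simps)
  then show thesis using that j(1) unfolding J_def by blast
qed

text \<open>The path grows at its head, with \<open>weight_step\<close> applied to the current head
  as \<open>C\<close>, so linking the units does not interfere with reducing the weight. The bound
  \<open>N1 + 1\<close> exceeds the number of leftover vertices, each of which is to get a unit of
  its own.\<close>

lemma path_exists:
  assumes "F \<subseteq> {..<N}" "card F \<le> 2 * (t1 + h)"
  obtains js where "distinct js" "length js = L" "set js \<subseteq> {..<N} - F"
    "successively (\<lambda>i j. joined (unit j) i) js" "\<And>j. j \<in> set js \<Longrightarrow> joined {} j"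
    "\<And>v. v \<in> V \<Longrightarrow> N1 + 1 \<le> card {j \<in> set js. joined {v} j}"
proof -
  have "\<exists>js. distinct js \<and> length js = l \<and> set js \<subseteq> {..<N} - F \<and>
      successively (\<lambda>i j. joined (unit j) i) js \<and> (\<forall>j\<in>set js. joined {} j) \<and>
      weight (set js) \<le> real n ^ 3 * (1 - c / 4) ^ l" if "l \<le> L" for l
    using that
  proof (induction l)
    case 0
    show ?case using weight_empty by (intro exI[of _ "[]"]) auto
  next
    case (Suc l)
    then obtain js where js: "distinct js" "length js = l" "set js \<subseteq> {..<N} - F"
      "successively (\<lambda>i j. joined (unit j) i) js" "\<forall>j\<in>set js. joined {} j"
      "weight (set js) \<le> real n ^ 3 * (1 - c / 4) ^ l" by auto
    \<comment> \<open>The first unit to be chosen has nothing to be linked to.\<close>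
    define C where "C = (if js = [] then {} else unit (hd js))"
    have "card (set js \<union> F) \<le> L + 2 * (t1 + h)"
      using card_Un_le[of "set js" F] js assms(2) Suc.prems distinct_card[of js] by simp
    then have "card (set js \<union> F) \<le> D + 4 * t1 + 4 * h + 4 + L" by simp
    then have "real (card (set js \<union> F)) \<le> real (D + 4 * t1 + 4 * h + 4 + L)" by (simp only: of_nat_le_iff)
    then have cF: "real (card (set js \<union> F)) \<le> c * N / 2" using c_ge by argo
    have CV: "C \<subseteq> V"
    proof (cases js)
      case (Cons i js')
      then have "i < N" using js(3) by auto
      then show ?thesis using unit_sub Cons unfolding C_def by simp
    qed (simp add: C_def)
    have FF: "set js \<union> F \<subseteq> {..<N}" using js(3) assms(1) by auto
    have "card C \<le> 11" unfolding C_def by simp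
    then obtain j where j: "j \<in> {..<N} - (set js \<union> F)" "joined C j"
      "weight (insert j (set js)) \<le> (1 - c / 4) * weight (set js)"
      using weight_step[OF Un_upper1 FF cF CV] by blast
    have "weight (set (j # js)) \<le> (1 - c / 4) * weight (set js)" using j by simp
    also have "\<dots> \<le> (1 - c / 4) * (real n ^ 3 * (1 - c / 4) ^ l)"
      using js c_le by (intro mult_left_mono) auto
    finally have "weight (set (j # js)) \<le> real n ^ 3 * (1 - c / 4) ^ Suc l" by (simp add: algebra_simps)
    moreover have "successively (\<lambda>i j. joined (unit j) i) (j # js)"
      using js(4) j(2) unfolding C_def by (cases js) auto
    moreover have "joined {} j" using j(2) unfolding joined_in_def by auto
    ultimately show ?case using js j by (intro exI[of _ "j # js"]) auto
  qed
  from this[of L] obtain js where js: "distinct js" "length js = L" "set js \<subseteq> {..<N} - F"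
      "successively (\<lambda>i j. joined (unit j) i) js" "\<forall>j\<in>set js. joined {} j"
      "weight (set js) \<le> real n ^ 3 * (1 - c / 4) ^ L" by auto
  then have "weight (set js) \<le> (1 / 2) ^ (N1 + 1)" using path_weight by linarith
  then have "N1 + 1 \<le> card {j \<in> set js. joined {v} j}" if "v \<in> V" for v
    using weight_count[of "set js" "N1 + 1" "{v}"] that unfolding triples_def by auto
  then show thesis using that js by blast
qed

end

section \<open>Blue without heavy vertices\<close>

lemma card_le_deg:
  assumes "finite B" "\<And>y. y \<in> Y \<Longrightarrow> {x, y} \<in> B"
  shows "card Y \<le> deg B x"
  unfolding deg_def
  by (rule card_inj_on_le[of "\<lambda>y. {x, y}"]) (use assms in \<open>auto simp: inj_on_def doubleton_eq_iff\<close>)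

context board begin

definition clique :: "nat set \<Rightarrow> bool" where
  "clique C \<longleftrightarrow> (\<forall>x\<in>C. \<forall>y\<in>C. x \<noteq> y \<longrightarrow> {x, y} \<in> E)"

lemma clique_subset: "clique C \<Longrightarrow> C' \<subseteq> C \<Longrightarrow> clique C'"
  unfolding clique_def by blast

lemma joined_clique: "joined T j \<Longrightarrow> clique (unit j)"
  unfolding joined_in_def clique_def by auto

text \<open>By \<open>iso_lower\<close> a vertex of Blue degree two would raise the number of
  untouched vertices above this bound.\<close>

lemma disjoint_edges_of_iso:
  assumes "B \<subseteq> E" "card (iso B) + 2 * card B \<le> n"
  shows "matching B"
  unfolding matching_def
proof (intro ballI impI)
  fix e f assume ef: "e \<in> B" "f \<in> B" "e \<noteq> f"
  show "e \<inter> f = {}"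
  proof (rule ccontr)
    assume "e \<inter> f \<noteq> {}"
    then obtain x where x: "x \<in> e" "x \<in> f" by blast
    have fB: "finite B" using assms E_finite_sub by blast
    have "card {e, f} \<le> deg B x" unfolding deg_def using ef x fB by (intro card_mono) auto
    then have "2 \<le> deg B x" using ef by simp
    moreover have "x \<in> V" using x ef assms edge_sub by blast
    ultimately show False using iso_lower[OF assms(1), of "{x}"] assms(2) by simp
  qed
qed

end

context strategy begin

text \<open>Red has wasted nothing: his whole edge set is the matching, so \<open>R\<close> takes
  the role of both \<open>R\<close> and \<open>M\<close> in the endgame.\<close>

definition fast :: "nat set set \<Rightarrow> nat set set \<Rightarrow> bool" where
  "fast R B \<longleftrightarrow> R \<subseteq> E \<and> B \<subseteq> E \<and> matching R \<and> card R = card B \<and> heavy B = {} \<and>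
     (\<forall>T. T \<subseteq> V \<longrightarrow> T \<noteq> {} \<longrightarrow> card T \<le> 3 \<longrightarrow> G \<le> card (gadgets R T))"

lemma fastD:
  assumes "fast R B"
  shows "R \<subseteq> E" "B \<subseteq> E" "matching R" "card R = card B" "heavy B = {}" "finite R" "finite B"
    "\<And>T. T \<subseteq> V \<Longrightarrow> T \<noteq> {} \<Longrightarrow> card T \<le> 3 \<Longrightarrow> G \<le> card (gadgets R T)"
    "card (V - \<Union>R) + 2 * card B = n" "even (card (V - \<Union>R))"
proof -
  show *: "R \<subseteq> E" "B \<subseteq> E" "matching R" "card R = card B" "heavy B = {}"
    "\<And>T. T \<subseteq> V \<Longrightarrow> T \<noteq> {} \<Longrightarrow> card T \<le> 3 \<Longrightarrow> G \<le> card (gadgets R T)"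
    using assms unfolding fast_def by auto
  then show "finite R" "finite B" using E_finite_sub by auto
  show **: "card (V - \<Union>R) + 2 * card B = n" using card_uncovered[OF *(1,3)] *(4) by simp
  have "card (V - \<Union>R) = 2 * (m - card B)" using ** n_even by simp
  then show "even (card (V - \<Union>R))" by simp
qed

text \<open>Red's uncovered vertices number \<open>n - 2 * card B\<close>, which is what Blue would
  have left untouched without any waste. The surplus over it is what the two final lemmas have to
  produce.\<close>

lemma fast_waste:
  assumes "fast R B" "X \<subseteq> V"
  shows "card (V - \<Union>R) + (\<Sum>v\<in>X. deg B v - 1) \<le> card (iso B)"
  using iso_lower[OF fastD(2)[OF assms(1)] assms(2)] fastD(9)[OF assms(1)] by linarith

lemma card_uncovered_insert:
  assumes "e \<in> E" "e \<inter> \<Union>R = {}"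
  shows "V - \<Union>(insert e R) = (V - \<Union>R) - e" "card ((V - \<Union>R) - e) + 2 = card (V - \<Union>R)"
proof -
  show "V - \<Union>(insert e R) = (V - \<Union>R) - e" by auto
  have "e \<subseteq> V - \<Union>R" using assms edge_sub by blast
  then show "card ((V - \<Union>R) - e) + 2 = card (V - \<Union>R)"
    using edge_card[OF assms(1)] edge_finite[OF assms(1)]
    by (metis card_Diff_subset card_mono finite_Diff finite_lessThan le_add_diff_inverse2)
qed

text \<open>If Blue's reply creates a heavy vertex, \<open>slow_win\<close> with
  \<open>M = R\<close> finishes the game. Hence only replies that keep the position fast have to be
  answered.\<close>

lemma fast_step:
  assumes fst: "fast R B" and e: "e \<in> E - R - B" "e \<inter> \<Union>R = {}" and U: "3 \<le> card (V - \<Union>R)"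
    and cont: "\<And>f. f \<in> E - insert e R - B \<Longrightarrow> fast (insert e R) (insert f B) \<Longrightarrow>
      red_wins V E (insert e R) (insert f B)"
  shows "red_wins V E R B"
proof -
  note F = fastD[OF fst]
  show ?thesis
  proof (rule red_step[OF e(1)])
    show "3 \<le> card (iso B)" using fast_waste[OF fst, of "{}"] U by simp
    have "3 \<le> n" using F(9) U by linarith
    then show "card R + card B + 1 \<le> 4 * n" using F(4,9) by linarith
    show "finite R" "finite B" using F by auto
    fix f assume f: "f \<in> E - insert e R - B"
    have sub: "insert e R \<subseteq> E" "insert f B \<subseteq> E" using e f F by auto
    have mat: "matching (insert e R)" using F(3) e(2) by (rule matching_insert)
    have card: "card (insert e R) = card (insert f B)" using e f F by simp
    have gad: "G \<le> card (gadgets (insert e R) T)" if "T \<subseteq> V" "T \<noteq> {}" "card T \<le> 3" for T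
    proof -
      have "gadgets R T \<subseteq> gadgets (insert e R) T" unfolding gadgets_def by auto
      then have "card (gadgets R T) \<le> card (gadgets (insert e R) T)"
        using finite_gadgets[OF sub(1)] by (intro card_mono) auto
      then show ?thesis using F(8)[OF that] by linarith
    qed
    show "red_wins V E (insert e R) (insert f B)"
    proof (cases "heavy (insert f B) = {}")
      case True
      then show ?thesis using cont[OF f] sub mat card gad unfolding fast_def by blast
    next
      case False
      show ?thesis
      proof (rule slow_win[OF sub order_refl mat card _ _ False])
        show "card (insert e R) \<le> card (insert e R) + card (heavy (insert f B) \<inter> \<Union>(insert e R))" by simp
        show "deg (insert f B) v \<le> D + card (heavy (insert f B) \<inter> \<Union>(insert e R)) + 1"
          if "v \<in> V - \<Union>(insert e R)" for v
        proof -
          have "v \<notin> heavy B" using F(5) by simp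
          then show ?thesis using deg_insert_le[OF F(7), of f v] that unfolding heavy_def by auto
        qed
        show "G \<le> card (gadgets (insert e R) T) + card (heavy (insert f B) \<inter> \<Union>(insert e R))"
          if "T \<subseteq> V" "T \<noteq> {}" "card T \<le> 3" for T using gad[OF that] by simp
        have "card (V - \<Union>(insert e R)) + 2 = card (V - \<Union>R)"
          using card_uncovered_insert[of e R] e by simp
        then have "card (V - \<Union>(insert e R)) \<noteq> 0" using U by linarith
        then show "V - \<Union>(insert e R) \<noteq> {}" by (metis card.empty)
      qed
    qed
  qed
qed

text \<open>Without heavy vertices every degree is below the threshold used here, so the exceptional
  set of \<open>endgame\<close> is empty.\<close>

lemma fast_endgame:
  assumes fst: "fast R B" and U: "card (V - \<Union>R) \<le> N2" "V - \<Union>R \<noteq> {}"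
    and iso: "2 * card (V - \<Union>R) + 1 \<le> card (iso B) \<or>
      card (V - \<Union>R) = 2 \<and> 3 \<le> card (iso B) \<and> (V - \<Union>R) \<inter> iso B = {}"
  shows "red_wins V E R B"
proof -
  note F = fastD[OF fst]
  obtain z where z: "card (V - \<Union>R) = 2 * z" using F(10) by (elim evenE)
  have z1: "1 \<le> z" using z U(2) by (cases z) auto
  have dR: "deg R v \<le> 1" for v using deg_matching_le[OF F(3) order_refl F(1), of 0] by simp
  have dB: "deg B v < D" if "v \<in> V" for v using F(5) that unfolding heavy_def by force
  have dq: "deg (R \<union> B) v \<le> D + 2 * h + 2" if "v \<in> V" for v
    using deg_Un_le[of R B v] dR[of v] dB[OF that] by simp
  show ?thesis
  proof (rule endgame[OF F(1,2) order_refl F(3) z z1, where q = "D + 2 * h + 2" and h = h and G = G])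
    show "G \<le> card (gadgets R T)" if "T \<subseteq> V" "T \<noteq> {}" "card T \<le> 3" for T using F(8)[OF that] .
    show "deg (R \<union> B) v \<le> D + 2 * h + 2" if "v \<in> V - \<Union>R" for v using dq that by simp
    have none: "{x \<in> V. D + 2 * h + 2 < deg (R \<union> B) x} = {}" using leD[OF dq] by blast
    show "card {x \<in> V. D + 2 * h + 2 < deg (R \<union> B) x} \<le> h" unfolding none by simp
    show "4 * z + 1 \<le> card (iso B) \<or> z = 1 \<and> 3 \<le> card (iso B) \<and> (V - \<Union>R) \<inter> iso B = {}"
      using iso z by auto
    show "card R + card B + 4 * z \<le> 4 * n" using F(4,9) z by linarith
    show "3 * (D + 2 * h + 2) + h + 20 * z \<le> G" using G_ge z U(1) by linarith
  qed
qed

lemma uncovered_edge: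
  assumes "fast R B" "x \<in> V - \<Union>R" "{x, y} \<in> E" "{x, y} \<notin> B"
  shows "{x, y} \<in> E - R - B"
  using assms by auto

lemma blue_clique_deg:
  assumes "finite B" "finite C" "x \<in> C" "\<And>y. y \<in> C \<Longrightarrow> x \<noteq> y \<Longrightarrow> {x, y} \<in> B"
  shows "card C - 1 \<le> deg B x"
proof -
  have "card (C - {x}) \<le> deg B x" using assms by (intro card_le_deg) auto
  then show ?thesis using assms by simp
qed

text \<open>Free pairs of \<open>C\<close> are played until \<open>C\<close> is a Blue clique. Then
  a dumped vertex wastes at least 4 half-edges and a vertex of \<open>C\<close> at least
  \<open>card C - 2\<close>. For \<open>card C \<le> 2\<close> the waste at the dumped vertices
  alone pays for everything, as \<open>card Dm + 3 \<le> 4 * card Dm\<close>; for larger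
  \<open>C\<close> its vertices pay for themselves.\<close>

lemma final_with_dumps:
  assumes "fast R B" "V - \<Union>R = Dm \<union> C" "Dm \<inter> C = {}" "Dm \<noteq> {}" "clique C"
    and "\<And>x. x \<in> Dm \<Longrightarrow> 5 \<le> deg B x" and "card (V - \<Union>R) \<le> N2"
  shows "red_wins V E R B"
  using assms
proof (induction "card C" arbitrary: R B C rule: less_induct)
  case less
  note fst = less.prems(1) and U = less.prems(2,3) and Dne = less.prems(4) and cl = less.prems(5)
    and dD = less.prems(6) and UN = less.prems(7)
  note F = fastD[OF fst]
  have fC: "finite C" "finite Dm" using U(1) by (metis finite_Diff finite_Un finite_lessThan)+
  have cU: "card (V - \<Union>R) = card Dm + card C" using U fC by (simp add: card_Un_disjoint)
  have d1: "1 \<le> card Dm" using Dne fC by (simp add: Suc_le_eq card_gt_0_iff)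
  show ?case
  proof (cases "\<exists>x\<in>C. \<exists>y\<in>C. x \<noteq> y \<and> {x, y} \<notin> B")
    case True
    then obtain x y where xy: "x \<in> C" "y \<in> C" "x \<noteq> y" "{x, y} \<notin> B" by blast
    have xyU: "x \<in> V - \<Union>R" "y \<in> V - \<Union>R" using xy U by auto
    have "{x, y} \<in> E" using cl xy unfolding clique_def by blast
    then have e: "{x, y} \<in> E - R - B" "{x, y} \<inter> \<Union>R = {}" "{x, y} \<in> E" using uncovered_edge[OF fst xyU(1)] xy xyU by auto
    have "card {x, y} \<le> card C" using xy fC by (intro card_mono) auto
    then have c2: "2 \<le> card C" using xy by simp
    show ?thesis
    proof (rule fast_step[OF fst e(1,2)])
      show "3 \<le> card (V - \<Union>R)" using cU d1 c2 by simp
      fix f assume f: "f \<in> E - insert {x, y} R - B" and fst': "fast (insert {x, y} R) (insert f B)"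
      show "red_wins V E (insert {x, y} R) (insert f B)"
      proof (rule less.hyps[OF _ fst', where C = "C - {x, y}"])
        show "card (C - {x, y}) < card C" using xy fC by (intro psubset_card_mono) auto
        show "V - \<Union>(insert {x, y} R) = Dm \<union> (C - {x, y})" using U xy by auto
        show "Dm \<inter> (C - {x, y}) = {}" using U by auto
        show "Dm \<noteq> {}" by fact
        show "clique (C - {x, y})" using cl by (rule clique_subset) auto
        show "5 \<le> deg (insert f B) v" if "v \<in> Dm" for v
          using dD[OF that] deg_mono[OF _ subset_insertI[of B f], of v] F(7) by simp
        show "card (V - \<Union>(insert {x, y} R)) \<le> N2" using card_uncovered_insert[OF e(3,2)] UN by simp
      qed
    qed
  next
    case False
    then have dC: "card C - 1 \<le> deg B x" if "x \<in> C" for x using blue_clique_deg[OF F(7) fC(1) that] that by blast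
    have "(\<Sum>v\<in>Dm \<union> C. deg B v - 1) = (\<Sum>v\<in>Dm. deg B v - 1) + (\<Sum>v\<in>C. deg B v - 1)"
      using U fC by (intro sum.union_disjoint) auto
    moreover have "(\<Sum>v\<in>Dm. 4) \<le> (\<Sum>v\<in>Dm. deg B v - 1)"
    proof (intro sum_mono)
      fix v assume "v \<in> Dm"
      from dD[OF this] show "4 \<le> deg B v - 1" by simp
    qed
    moreover have "(\<Sum>v\<in>C. card C - 2) \<le> (\<Sum>v\<in>C. deg B v - 1)"
    proof (intro sum_mono)
      fix v assume "v \<in> C"
      from dC[OF this] show "card C - 2 \<le> deg B v - 1" by simp
    qed
    ultimately have w: "4 * card Dm + card C * (card C - 2) \<le> (\<Sum>v\<in>Dm \<union> C. deg B v - 1)" by simp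
    have "card Dm + card C + 1 \<le> 4 * card Dm + card C * (card C - 2)"
    proof (cases "card C \<le> 2")
      case True
      then show ?thesis using d1 by simp
    next
      case False
      then have "card C * 1 \<le> card C * (card C - 2)" by (intro mult_le_mono2) simp
      then show ?thesis using d1 by linarith
    qed
    moreover have "Dm \<union> C \<subseteq> V" using U by auto
    ultimately have "2 * card (V - \<Union>R) + 1 \<le> card (iso B)" using fast_waste[OF fst, of "Dm \<union> C"] w cU by linarith
    then show ?thesis using fast_endgame[OF fst UN] Dne U by auto
  qed
qed

text \<open>Without dumped vertices Red must make Blue waste a half-edge. He keeps an uncovered vertex
  \<open>w\<close> that Blue already touches and, at four vertices, leaves a free pair at \<open>w\<close>: Blue has to take it.\<close>
lemma final_without_dumps:
  assumes "fast R B" "clique (V - \<Union>R)" "card (V - \<Union>R) \<le> N2" "V - \<Union>R \<noteq> {}"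
    and "6 \<le> card (V - \<Union>R) \<or> card (V - \<Union>R) + 1 \<le> card (iso B) \<or>
         (4 \<le> card (V - \<Union>R) \<and> \<not> V - \<Union>R \<subseteq> iso B)"
  shows "red_wins V E R B"
  using assms
proof (induction "card (V - \<Union>R)" arbitrary: R B rule: less_induct)
  case less
  define C where "C = V - \<Union>R"
  note fst = less.prems(1) and cl = less.prems(2)[folded C_def] and UN = less.prems(3)[folded C_def]
    and Une = less.prems(4)[folded C_def] and cond = less.prems(5)[folded C_def]
  note F = fastD[OF fst]
  have fC: "finite C" unfolding C_def by simp
  have ev: "even (card C)" using F(10) unfolding C_def .
  have isoC: "card C \<le> card (iso B)" using fast_waste[OF fst, of "{}"] unfolding C_def by simp
  have c0: "card C \<noteq> 0" using Une fC by simp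
  have edge: "{x, y} \<in> E - R - B" "{x, y} \<inter> \<Union>R = {}" "{x, y} \<in> E"
    if "x \<in> C" "y \<in> C" "x \<noteq> y" "{x, y} \<notin> B" for x y
  proof -
    show "{x, y} \<in> E" using cl that unfolding clique_def by blast
    then show "{x, y} \<in> E - R - B" using uncovered_edge[OF fst, of x y] that unfolding C_def by auto
    show "{x, y} \<inter> \<Union>R = {}" using that unfolding C_def by auto
  qed
  \<comment> \<open>\<open>nxt\<close> offers the condition that the induction hypothesis needs for
    \<open>C - {x, y}\<close>, with cardinalities shifted by two, or an immediate win.\<close>
  have play: ?case
    if xy: "x \<in> C" "y \<in> C" "x \<noteq> y" "{x, y} \<notin> B" and c4: "4 \<le> card C"
    and nxt: "\<And>f. f \<in> E - insert {x, y} R - B \<Longrightarrow> fast (insert {x, y} R) (insert f B) \<Longrightarrow>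
        8 \<le> card C \<or> card C \<le> card (iso (insert f B)) + 1 \<or>
          (6 \<le> card C \<and> \<not> C - {x, y} \<subseteq> iso (insert f B)) \<or> red_wins V E (insert {x, y} R) (insert f B)"
    for x y
  proof (rule fast_step[OF fst edge(1,2)[OF xy]])
    show "3 \<le> card (V - \<Union>R)" using c4 unfolding C_def by simp
    fix f assume f: "f \<in> E - insert {x, y} R - B" and fst': "fast (insert {x, y} R) (insert f B)"
    have U': "V - \<Union>(insert {x, y} R) = C - {x, y}" unfolding C_def by auto
    have cU': "card (C - {x, y}) + 2 = card C" using card_uncovered_insert(2)[OF edge(3,2)[OF xy]] unfolding C_def .
    show "red_wins V E (insert {x, y} R) (insert f B)"
    proof (cases "red_wins V E (insert {x, y} R) (insert f B)")
      case False
      show ?thesis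
      proof (rule less.hyps[OF _ fst'])
        show "card (V - \<Union>(insert {x, y} R)) < card (V - \<Union>R)" using cU' unfolding U' C_def[symmetric] by simp
        show "clique (V - \<Union>(insert {x, y} R))" unfolding U' using cl by (rule clique_subset) auto
        show "card (V - \<Union>(insert {x, y} R)) \<le> N2" unfolding U' using UN cU' by simp
        have "card (C - {x, y}) \<noteq> 0" using cU' c4 by linarith
        then show "V - \<Union>(insert {x, y} R) \<noteq> {}" unfolding U' by (metis card.empty)
        show "6 \<le> card (V - \<Union>(insert {x, y} R)) \<or>
          card (V - \<Union>(insert {x, y} R)) + 1 \<le> card (iso (insert f B)) \<or>
          (4 \<le> card (V - \<Union>(insert {x, y} R)) \<and> \<not> V - \<Union>(insert {x, y} R) \<subseteq> iso (insert f B))"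
          unfolding U' using nxt[OF f fst'] cU' False by linarith
      qed
    qed simp
  qed
  have c2: "card C = 2 \<or> 4 \<le> card C" using ev c0 by presburger
  show ?case
  proof (cases "\<exists>x\<in>C. \<exists>y\<in>C. x \<noteq> y \<and> {x, y} \<notin> B")
    case False
    then have allB: "{x, y} \<in> B" if "x \<in> C" "y \<in> C" "x \<noteq> y" for x y using that by blast
    then have dC: "card C - 1 \<le> deg B x" if "x \<in> C" for x using blue_clique_deg[OF F(7) fC that] that by blast
    have "(\<Sum>v\<in>C. card C - 2) \<le> (\<Sum>v\<in>C. deg B v - 1)"
    proof (intro sum_mono)
      fix v assume "v \<in> C"
      from dC[OF this] show "card C - 2 \<le> deg B v - 1" by simp
    qed
    then have "card C + card C * (card C - 2) \<le> card (iso B)"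
      using fast_waste[OF fst, of C] unfolding C_def by simp
    moreover have "card C + 1 \<le> card C * (card C - 2)" if "4 \<le> card C"
    proof -
      have "card C * 2 \<le> card C * (card C - 2)" using that by (intro mult_le_mono2) simp
      then show ?thesis using that by linarith
    qed
    \<comment> \<open>A Blue edge on the last two vertices wastes nothing by itself, but both ends
      are touched, which is what the second alternative of \<open>fast_endgame\<close> asks
      for.\<close>
    moreover have "C \<inter> iso B = {}" if "card C = 2"
    proof -
      obtain x y where xy: "C = {x, y}" "x \<noteq> y" using \<open>card C = 2\<close> by (meson card_2_iff)
      then have "{x, y} \<in> B" using allB by auto
      then show ?thesis using xy unfolding iso_def by auto
    qed
    ultimately have "2 * card C + 1 \<le> card (iso B) \<or> card C = 2 \<and> 3 \<le> card (iso B) \<and> C \<inter> iso B = {}"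
      using c2 cond by linarith
    then show ?thesis using fast_endgame[OF fst] UN Une unfolding C_def by blast
  next
    case True
    then obtain x y where xy: "x \<in> C" "y \<in> C" "x \<noteq> y" "{x, y} \<notin> B" by blast
    show ?thesis
    proof (cases "card C = 2")
      case True
      have "{x, y} = C" using xy True fC by (intro card_subset_eq) auto
      then have "V - \<Union>R = {x, y}" unfolding C_def by simp
      then show ?thesis using win_free_pair[OF order_refl F(1,3)] edge(1)[OF xy] by blast
    next
      case False
      then have c4: "4 \<le> card C" using c2 by simp
      show ?thesis
      proof (cases "card C + 1 \<le> card (iso B)")
        case True
        show ?thesis
        proof (rule play[OF xy c4])
          fix f assume "f \<in> E - insert {x, y} R - B"
          then show "8 \<le> card C \<or> card C \<le> card (iso (insert f B)) + 1 \<or>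
              (6 \<le> card C \<and> \<not> C - {x, y} \<subseteq> iso (insert f B)) \<or> red_wins V E (insert {x, y} R) (insert f B)"
            using card_iso_insert[of f B] True by auto
        qed
      next
        case False
        then have isoeq: "card (iso B) = card C" using isoC by simp
        \<comment> \<open>Without surplus Blue has wasted nothing, so at most one Blue edge meets
          any vertex. This limits how he can block pairs in \<open>C\<close>.\<close>
        then have mB: "matching B" using disjoint_edges_of_iso[OF F(2)] F(9) unfolding C_def by simp
        have oneB: "e = e'" if "e \<in> B" "e' \<in> B" "a \<in> e" "a \<in> e'" for e e' a
          using mB that unfolding matching_def by blast
        show ?thesis
        proof (cases "C \<subseteq> iso B")
          case True
          then have "C = iso B" using isoeq by (intro card_subset_eq) auto
          have c6: "6 \<le> card C" using cond True False by simp
          show ?thesis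
          proof (rule play[OF xy c4])
            fix f assume f: "f \<in> E - insert {x, y} R - B" and fst': "fast (insert {x, y} R) (insert f B)"
            \<comment> \<open>Here \<open>C\<close> is the set of all vertices untouched by Blue.
              His reply either touches one of those that remain in \<open>C\<close>, or has an end
              that he touched before and so wastes a half-edge.\<close>
            have "card C \<le> card (iso (insert f B)) + 1 \<or> \<not> C - {x, y} \<subseteq> iso (insert f B)"
            proof (rule disjCI)
              assume "\<not> \<not> C - {x, y} \<subseteq> iso (insert f B)"
              then have sub: "C - {x, y} \<subseteq> iso (insert f B)" by simp
              have "\<not> f \<subseteq> C"
              proof
                assume "f \<subseteq> C"
                then have "f \<subseteq> {x, y}" using sub unfolding iso_def by auto
                moreover have "card f = 2" "card {x, y} = 2" using edge_card f xy by auto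
                ultimately have "f = {x, y}" by (intro card_subset_eq) auto
                then show False using f by auto
              qed
              then obtain a where a: "a \<in> f" "a \<notin> iso B" using \<open>C = iso B\<close> by auto
              have "f \<in> E" using f by auto
              then obtain b where b: "f = {a, b}" using edge_memE[OF _ a(1)] by metis
              have "iso B \<subseteq> insert b (iso (insert f B))" using a b unfolding iso_def by auto
              then have "card (iso B) \<le> card (insert b (iso (insert f B)))" by (intro card_mono) auto
              then show "card C \<le> card (iso (insert f B)) + 1" using isoeq by (simp add: card_insert_if split: if_splits)
            qed
            then show "8 \<le> card C \<or> card C \<le> card (iso (insert f B)) + 1 \<or>
              (6 \<le> card C \<and> \<not> C - {x, y} \<subseteq> iso (insert f B)) \<or> red_wins V E (insert {x, y} R) (insert f B)"
              using c6 by blast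
          qed
        next
          case ntouch: False
          then obtain w where w: "w \<in> C" "w \<notin> iso B" by blast
          then obtain ew where ew: "ew \<in> B" "w \<in> ew" unfolding iso_def C_def by auto
          show ?thesis
          proof (cases "6 \<le> card C")
            case True
            then have "3 \<le> card (C - {w})" using w fC by simp
            then obtain T where T: "T \<subseteq> C - {w}" "card T = 3" by (elim obtain_subset_with_card_n) auto
            then obtain a b d where abd: "T = {a, b, d}" "a \<noteq> b" "a \<noteq> d" "b \<noteq> d" by (auto simp: card_3_iff)
            have "{a, b} \<notin> B \<or> {a, d} \<notin> B" using oneB[of "{a, b}" "{a, d}" a] abd by (auto simp: doubleton_eq_iff)
            then obtain b' where b': "b' \<in> {b, d}" "{a, b'} \<notin> B" by blast
            have ab: "a \<in> C" "b' \<in> C" "a \<noteq> b'" "w \<noteq> a" "w \<noteq> b'" using T abd b' by auto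
            show ?thesis
            proof (rule play[OF ab(1,2,3) b'(2) c4])
              fix f
              have "w \<in> C - {a, b'}" "w \<notin> iso (insert f B)" using w ab unfolding iso_def by auto
              then show "8 \<le> card C \<or> card C \<le> card (iso (insert f B)) + 1 \<or>
                (6 \<le> card C \<and> \<not> C - {a, b'} \<subseteq> iso (insert f B)) \<or> red_wins V E (insert {a, b'} R) (insert f B)"
                using True by blast
            qed
          next
            case False
            then have "card C = 4" using c4 ev by presburger
            then have "card (C - {w}) = 3" using w fC by simp
            then obtain a b d where abd: "C - {w} = {a, b, d}" "a \<noteq> b" "a \<noteq> d" "b \<noteq> d" by (auto simp: card_3_iff)
            have Ceq: "C = {w, a, b, d}" and wn: "w \<noteq> a" "w \<noteq> b" "w \<noteq> d" using abd w by auto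
            \<comment> \<open>There are three splits of \<open>C\<close> into two pairs. Disjoint
              Blue edges inside \<open>C\<close> spoil at most one of them, since two such edges
              form a single split.\<close>
            have "\<exists>r s t. C = {w, r, s, t} \<and> distinct [w, r, s, t] \<and> {w, r} \<notin> B \<and> {s, t} \<notin> B"
            proof -
              have 1: "\<not> ({w, r} \<in> B \<and> {w, s} \<in> B)" if "r \<noteq> s" for r s
                using oneB[of "{w, r}" "{w, s}" w] that by (auto simp: doubleton_eq_iff)
              have 2: "\<not> ({r, s} \<in> B \<and> {r, t} \<in> B)" if "s \<noteq> t" for r s t
                using oneB[of "{r, s}" "{r, t}" r] that by (auto simp: doubleton_eq_iff)
              have 3: "\<not> ({s, r} \<in> B \<and> {r, t} \<in> B)" if "s \<noteq> t" for r s t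
                using 2[OF that, of r] by (simp add: insert_commute)
              have 4: "\<not> ({s, r} \<in> B \<and> {t, r} \<in> B)" if "s \<noteq> t" for r s t
                using 2[OF that, of r] by (simp add: insert_commute)
              have "({w, a} \<notin> B \<and> {b, d} \<notin> B) \<or> ({w, b} \<notin> B \<and> {a, d} \<notin> B) \<or> ({w, d} \<notin> B \<and> {a, b} \<notin> B)"
                using 1[of a b] 1[of a d] 1[of b d] 2[of b d a] 3[of a d b] 4[of a b d]
                  abd wn by blast
              then show ?thesis
              proof (elim disjE conjE)
                assume "{w, a} \<notin> B" "{b, d} \<notin> B"
                moreover have "C = {w, a, b, d}" using Ceq by blast
                moreover have "distinct [w, a, b, d]" using wn abd(2-4) by auto
                ultimately show ?thesis by blast
              next
                assume "{w, b} \<notin> B" "{a, d} \<notin> B"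
                moreover have "C = {w, b, a, d}" using Ceq by blast
                moreover have "distinct [w, b, a, d]" using wn abd(2-4) by auto
                ultimately show ?thesis by blast
              next
                assume "{w, d} \<notin> B" "{a, b} \<notin> B"
                moreover have "C = {w, d, a, b}" using Ceq by blast
                moreover have "distinct [w, d, a, b]" using wn abd(2-4) by auto
                ultimately show ?thesis by blast
              qed
            qed
            then obtain r s t where rst: "C = {w, r, s, t}" "distinct [w, r, s, t]" "{w, r} \<notin> B" "{s, t} \<notin> B"
              by blast
            show ?thesis
            proof (rule play[of s t])
              show "s \<in> C" "t \<in> C" "s \<noteq> t" "{s, t} \<notin> B" "4 \<le> card C" using rst c4 by auto
              fix f assume f: "f \<in> E - insert {s, t} R - B" and fst': "fast (insert {s, t} R) (insert f B)"
              \<comment> \<open>Red takes \<open>{s, t}\<close> and threatens \<open>{w, r}\<close>.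
                The only defence is to take that edge, whose end \<open>w\<close> Blue has already
                touched, so he loses a half-edge.\<close>
              have "card C \<le> card (iso (insert f B)) + 1 \<or> red_wins V E (insert {s, t} R) (insert f B)"
              proof (cases "f = {w, r}")
                case True
                have iso': "iso B \<subseteq> insert r (iso (insert f B))" using w(2) True unfolding iso_def by auto
                then have "card (iso B) \<le> card (insert r (iso (insert f B)))" by (intro card_mono) auto
                then have "card C \<le> card (iso (insert f B)) + 1" using isoeq by (simp add: card_insert_if split: if_splits)
                then show ?thesis ..
              next
                case False
                have "red_wins V E (insert {s, t} R) (insert f B)"
                proof (rule win_free_pair[of "insert {s, t} R"])
                  show "insert {s, t} R \<subseteq> insert {s, t} R" by simp
                  show "insert {s, t} R \<subseteq> E" "matching (insert {s, t} R)" using fastD[OF fst'] by auto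
                  have "V - \<Union>(insert {s, t} R) = C - {s, t}" unfolding C_def by auto
                  then show "V - \<Union>(insert {s, t} R) = {w, r}" using rst by auto
                  have "{w, r} \<in> E - R - B" using edge(1)[of w r] rst by auto
                  moreover have "{w, r} \<noteq> {s, t}" using rst(2) by (auto simp: doubleton_eq_iff)
                  ultimately show "{w, r} \<in> E - insert {s, t} R - insert f B" using False by auto
                qed
                then show ?thesis ..
              qed
              then show "8 \<le> card C \<or> card C \<le> card (iso (insert f B)) + 1 \<or>
                (6 \<le> card C \<and> \<not> C - {s, t} \<subseteq> iso (insert f B)) \<or> red_wins V E (insert {s, t} R) (insert f B)"
                by blast
            qed
          qed
        qed
      qed
    qed
  qed
qed

end

section \<open>Absorbing leftover vertices into the path of cliques\<close>

lemma card_units_hit: "finite W \<Longrightarrow> card {j \<in> {..<N}. unit j \<inter> W \<noteq> {}} \<le> card W"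
proof -
  assume "finite W"
  have "{j \<in> {..<N}. unit j \<inter> W \<noteq> {}} \<subseteq> (\<lambda>x. x div 11) ` W"
  proof
    fix j assume "j \<in> {j \<in> {..<N}. unit j \<inter> W \<noteq> {}}"
    then obtain x where x: "x \<in> unit j" "x \<in> W" by blast
    then have "x div 11 = j" unfolding unit_def by auto
    then show "j \<in> (\<lambda>x. x div 11) ` W" using x by auto
  qed
  then have "card {j \<in> {..<N}. unit j \<inter> W \<noteq> {}} \<le> card ((\<lambda>x. x div 11) ` W)"
    using \<open>finite W\<close> by (intro card_mono) auto
  also have "\<dots> \<le> card W" using \<open>finite W\<close> by (rule card_image_le)
  finally show ?thesis .
qed

context strategy begin

text \<open>\<open>Dm\<close> collects the vertices given up, \<open>C\<close> is the clique being
  processed and \<open>js\<close> the path ahead. If \<open>C\<close> has at least six vertices and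
  no free pair, it is a Blue clique and one of them can be given up; so at most five are matched
  into the next unit. Hence \<open>min 5 (card C)\<close>: the unit keeps five vertices, and a
  vertex of \<open>C\<close> with only Blue edges to it can be given up as well.\<close>

lemma path_win:
  assumes "fast R B" "V - \<Union>R = Dm \<union> C \<union> (\<Union>j\<in>set js. unit j - \<Union>R)"
    and "Dm \<inter> C = {}" "\<And>j. j \<in> set js \<Longrightarrow> (Dm \<union> C) \<inter> unit j = {}"
    and "\<And>x. x \<in> Dm \<Longrightarrow> 5 \<le> deg B x" "clique C" "distinct js"
    and "successively (\<lambda>i j. joined (unit j) i) js" "\<And>j. j \<in> set js \<Longrightarrow> joined {} j"
    and "\<And>x y. js \<noteq> [] \<Longrightarrow> x \<in> C \<Longrightarrow> y \<in> unit (hd js) \<Longrightarrow> {x, y} \<in> E"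
    and "js \<noteq> [] \<Longrightarrow> 5 + min 5 (card C) \<le> card (unit (hd js) - \<Union>R)"
    and "\<And>j. j \<in> set (tl js) \<Longrightarrow> 10 \<le> card (unit j - \<Union>R)"
    and "js = [] \<Longrightarrow> Dm \<noteq> {} \<or> 6 \<le> card C"
    and "card (V - \<Union>R) \<le> N2"
  shows "red_wins V E R B"
  using assms
\<comment> \<open>Entering a unit adds at most 11 to \<open>card C\<close> and removes 12.\<close>
proof (induction "12 * length js + card C" arbitrary: R B Dm C js rule: less_induct)
  case less
  note fst = less.prems(1) and U = less.prems(2) and disj = less.prems(3,4) and dD = less.prems(5)
    and cl = less.prems(6) and dist = less.prems(7) and succ = less.prems(8) and jo = less.prems(9)
    and link = less.prems(10) and cnt = less.prems(11) and cnt' = less.prems(12) and fin = less.prems(13)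
    and UN = less.prems(14)
  note F = fastD[OF fst]
  have fC: "finite C" using U by (metis finite_Diff finite_Un finite_lessThan)
  have mono: "deg B v \<le> deg (insert f B) v" for v f using F(7) by (intro deg_mono) auto
  show ?case
  proof (cases js)
    case Nil
    then have U0: "V - \<Union>R = Dm \<union> C" using U by simp
    show ?thesis
    proof (cases "Dm = {}")
      case False
      show ?thesis by (rule final_with_dumps[OF fst U0 disj(1) False cl dD UN])
    next
      case True
      then have UC: "V - \<Union>R = C" using U0 by simp
      have c6: "6 \<le> card C" using fin Nil True by simp
      then have "C \<noteq> {}" by auto
      then show ?thesis using c6 cl UN by (intro final_without_dumps[OF fst]) (simp_all only: UC simp_thms)
    qed
  next
    case (Cons j js')
    have cntj: "5 + min 5 (card C) \<le> card (unit j - \<Union>R)" using cnt Cons by simp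
    have dj: "(Dm \<union> C) \<inter> unit j = {}" using disj(2)[of j] Cons by simp
    have linkj: "{x, y} \<in> E" if "x \<in> C" "y \<in> unit j" for x y using link[of x y] that Cons by simp
    have "unit j - \<Union>R \<subseteq> V - \<Union>R" using U Cons by auto
    then have "card (unit j - \<Union>R) \<le> card (V - \<Union>R)" by (intro card_mono) auto
    then have U3: "3 \<le> card (V - \<Union>R)" using cntj by linarith
    have dump: ?thesis if x: "x \<in> C" "5 \<le> deg B x" for x
    proof (rule less.hyps[OF _ fst, where Dm = "insert x Dm" and C = "C - {x}" and js = js])
      have cC: "card (C - {x}) < card C" using x fC by (intro psubset_card_mono) auto
      then show "12 * length js + card (C - {x}) < 12 * length js + card C" by simp
      show "V - \<Union>R = insert x Dm \<union> (C - {x}) \<union> (\<Union>j\<in>set js. unit j - \<Union>R)" using U x by auto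
      show "insert x Dm \<inter> (C - {x}) = {}" using disj by auto
      show "(insert x Dm \<union> (C - {x})) \<inter> unit i = {}" if "i \<in> set js" for i using disj(2)[OF that] x by auto
      show "5 \<le> deg B y" if "y \<in> insert x Dm" for y using dD x that by auto
      show "clique (C - {x})" using cl by (rule clique_subset) auto
      show "5 + min 5 (card (C - {x})) \<le> card (unit (hd js) - \<Union>R)" if "js \<noteq> []"
        using cnt[OF that] cC by linarith
      show "js = [] \<Longrightarrow> insert x Dm \<noteq> {} \<or> 6 \<le> card (C - {x})" by simp
    qed (use dist succ jo link cnt' UN in auto)
    show ?thesis
    proof (cases "\<exists>x\<in>C. \<exists>y\<in>C. x \<noteq> y \<and> {x, y} \<notin> B")
      case True
      then obtain x y where xy: "x \<in> C" "y \<in> C" "x \<noteq> y" "{x, y} \<notin> B" by blast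
      have xyU: "x \<in> V - \<Union>R" "y \<in> V - \<Union>R" using xy U by auto
      have eE: "{x, y} \<in> E" using cl xy unfolding clique_def by blast
      have e: "{x, y} \<in> E - R - B" "{x, y} \<inter> \<Union>R = {}" using uncovered_edge[OF fst xyU(1) eE] xy xyU by auto
      show ?thesis
      proof (rule fast_step[OF fst e U3])
        fix f assume f: "f \<in> E - insert {x, y} R - B" and fst': "fast (insert {x, y} R) (insert f B)"
        have un: "unit i - \<Union>(insert {x, y} R) = unit i - \<Union>R" if "i \<in> set js" for i
          using disj(2)[OF that] xy by auto
        show "red_wins V E (insert {x, y} R) (insert f B)"
        proof (rule less.hyps[OF _ fst', where Dm = Dm and C = "C - {x, y}" and js = js])
          have cC: "card (C - {x, y}) < card C" using xy fC by (intro psubset_card_mono) auto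
          then show "12 * length js + card (C - {x, y}) < 12 * length js + card C" by simp
          have "V - \<Union>(insert {x, y} R) = (V - \<Union>R) - {x, y}" by auto
          also have "\<dots> = Dm \<union> (C - {x, y}) \<union> (\<Union>j\<in>set js. unit j - \<Union>R)"
            unfolding U using xy disj by auto
          finally show "V - \<Union>(insert {x, y} R) = Dm \<union> (C - {x, y}) \<union> (\<Union>j\<in>set js. unit j - \<Union>(insert {x, y} R))"
            using un by simp
          show "Dm \<inter> (C - {x, y}) = {}" using disj by auto
          show "(Dm \<union> (C - {x, y})) \<inter> unit i = {}" if "i \<in> set js" for i using disj(2)[OF that] by auto
          show "5 \<le> deg (insert f B) v" if "v \<in> Dm" for v using dD[OF that] mono[of v f] by simp
          show "clique (C - {x, y})" using cl by (rule clique_subset) auto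
          show "5 + min 5 (card (C - {x, y})) \<le> card (unit (hd js) - \<Union>(insert {x, y} R))" if "js \<noteq> []"
            using cnt[OF that] cC un[of "hd js"] that by simp
          show "10 \<le> card (unit i - \<Union>(insert {x, y} R))" if "i \<in> set (tl js)" for i
            using cnt'[OF that] un[of i] that by (simp add: list.set_sel(2) Cons)
          show "js = [] \<Longrightarrow> Dm \<noteq> {} \<or> 6 \<le> card (C - {x, y})" using Cons by simp
          show "card (V - \<Union>(insert {x, y} R)) \<le> N2" using card_uncovered_insert[OF eE e(2)] UN by simp
        qed (use dist succ jo link in auto)
      qed
    next
      case False
      then have allB: "{x, y} \<in> B" if "x \<in> C" "y \<in> C" "x \<noteq> y" for x y using that by blast
      show ?thesis
      proof (cases "C = {}")
        case True
        define C' where "C' = unit j - \<Union>R"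
        have djs: "distinct js'" "j \<notin> set js'" using dist Cons by auto
        have jcl: "clique (unit j)" using jo[of j] Cons joined_clique by auto
        have unj: "unit j \<inter> unit i = {}" if "i \<in> set js'" for i using djs that by (intro unit_disjoint) auto
        show ?thesis
        proof (rule less.hyps[OF _ fst, where Dm = Dm and C = C' and js = js'])
          have "card C' \<le> 11" unfolding C'_def using card_mono[OF finite_unit Diff_subset, of j "\<Union>R"] by simp
          then show "12 * length js' + card C' < 12 * length js + card C" using Cons by simp
          show U': "V - \<Union>R = Dm \<union> C' \<union> (\<Union>j\<in>set js'. unit j - \<Union>R)" using U True Cons unfolding C'_def by auto
          show "Dm \<inter> C' = {}" using dj unfolding C'_def by auto
          show "(Dm \<union> C') \<inter> unit i = {}" if "i \<in> set js'" for i
            using disj(2)[of i] unj[OF that] that Cons unfolding C'_def by auto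
          show "clique C'" unfolding C'_def using jcl by (rule clique_subset) auto
          show "successively (\<lambda>i j. joined (unit j) i) js'" using succ Cons by (cases js') auto
          show "{x, y} \<in> E" if "js' \<noteq> []" "x \<in> C'" "y \<in> unit (hd js')" for x y
          proof -
            have "joined (unit (hd js')) j" using succ Cons that(1) by (cases js') auto
            moreover have "x \<noteq> y" using unj[of "hd js'"] that unfolding C'_def by auto
            ultimately show ?thesis using that unfolding joined_in_def C'_def by auto
          qed
          show "5 + min 5 (card C') \<le> card (unit (hd js') - \<Union>R)" if "js' \<noteq> []"
            using cnt'[of "hd js'"] that Cons by simp
          show "10 \<le> card (unit i - \<Union>R)" if "i \<in> set (tl js')" for i
            using cnt'[of i] that Cons by (cases js') auto
          \<comment> \<open>Parity: the last unit keeps at least five vertices. If nothing was given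
            up they are all the uncovered vertices, whose number is even, so there are at least
            six.\<close>
          show "Dm \<noteq> {} \<or> 6 \<le> card C'" if "js' = []"
          proof (rule disjCI)
            assume "\<not> 6 \<le> card C'"
            show "Dm \<noteq> {}"
            proof
              assume "Dm = {}"
              then have "V - \<Union>R = C'" using U' that by simp
              then have "even (card C')" using F(10) by simp
              moreover have "5 \<le> card C'" using cntj unfolding C'_def by simp
              ultimately show False using \<open>\<not> 6 \<le> card C'\<close> by presburger
            qed
          qed
        qed (use djs dD UN jo Cons in auto)
      next
        case False
        then obtain x where x: "x \<in> C" by blast
        show ?thesis
        proof (cases "6 \<le> card C")
          case True
          then have "5 \<le> deg B x" using blue_clique_deg[OF F(7) fC x] allB x by force
          then show ?thesis using dump x by blast
        next
          case c5: False
          show ?thesis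
          proof (cases "\<exists>y\<in>unit j - \<Union>R. {x, y} \<notin> B")
            case False
            then have "card (unit j - \<Union>R) \<le> deg B x" using F(7) by (intro card_le_deg) auto
            then show ?thesis using dump[OF x] cntj by simp
          next
            case True
            then obtain y where y: "y \<in> unit j" "y \<notin> \<Union>R" "{x, y} \<notin> B" by blast
            have xyU: "x \<in> V - \<Union>R" "y \<in> V - \<Union>R" using x y U Cons by auto
            have eE: "{x, y} \<in> E" using linkj x y by blast
            have e: "{x, y} \<in> E - R - B" "{x, y} \<inter> \<Union>R = {}" using uncovered_edge[OF fst xyU(1) eE] y xyU by auto
            have yn: "y \<notin> Dm \<union> C" using dj y by auto
            have yi: "y \<notin> unit i" if "i \<in> set js'" for i using unit_disjoint[of j i] y that dist Cons by auto
            have un: "unit i - \<Union>(insert {x, y} R) = unit i - \<Union>R" if "i \<in> set js'" for i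
              using disj(2)[of i] that x yi[OF that] Cons by auto
            have unj: "unit j - \<Union>(insert {x, y} R) = (unit j - \<Union>R) - {y}" using dj x by auto
            show ?thesis
            proof (rule fast_step[OF fst e U3])
              fix f assume f: "f \<in> E - insert {x, y} R - B" and fst': "fast (insert {x, y} R) (insert f B)"
              show "red_wins V E (insert {x, y} R) (insert f B)"
              proof (rule less.hyps[OF _ fst', where Dm = Dm and C = "C - {x}" and js = js])
                have cC: "card (C - {x}) + 1 = card C" using x fC by (metis Suc_eq_plus1 card_Suc_Diff1)
                then show "12 * length js + card (C - {x}) < 12 * length js + card C" by simp
                have "V - \<Union>(insert {x, y} R) = (V - \<Union>R) - {x, y}" by auto
                also have "\<dots> = Dm \<union> (C - {x}) \<union> ((unit j - \<Union>R) - {y}) \<union> (\<Union>j\<in>set js'. unit j - \<Union>R)"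
                  unfolding U using x yn yi disj dj Cons by auto
                finally show "V - \<Union>(insert {x, y} R) = Dm \<union> (C - {x}) \<union> (\<Union>j\<in>set js. unit j - \<Union>(insert {x, y} R))"
                  using un unj Cons by auto
                show "Dm \<inter> (C - {x}) = {}" using disj by auto
                show "(Dm \<union> (C - {x})) \<inter> unit i = {}" if "i \<in> set js" for i using disj(2)[OF that] by auto
                show "5 \<le> deg (insert f B) v" if "v \<in> Dm" for v using dD[OF that] mono[of v f] by simp
                show "clique (C - {x})" using cl by (rule clique_subset) auto
                have "card ((unit j - \<Union>R) - {y}) + 1 = card (unit j - \<Union>R)"
                  using y by (metis DiffI Suc_eq_plus1 card_Suc_Diff1 finite_Diff finite_unit)
                then show "5 + min 5 (card (C - {x})) \<le> card (unit (hd js) - \<Union>(insert {x, y} R))"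
                  using cntj c5 cC unj Cons by simp
                show "10 \<le> card (unit i - \<Union>(insert {x, y} R))" if "i \<in> set (tl js)" for i
                  using cnt'[OF that] un[of i] that Cons by simp
                show "js = [] \<Longrightarrow> Dm \<noteq> {} \<or> 6 \<le> card (C - {x})" using Cons by simp
                show "card (V - \<Union>(insert {x, y} R)) \<le> N2" using card_uncovered_insert[OF eE e(2)] UN by simp
              qed (use dist succ jo link in auto)
            qed
          qed
        qed
      qed
    qed
  qed
qed

lemma inject_win:
  assumes "fast R B" "V - \<Union>R = Dm \<union> Y \<union> (\<Union>j\<in>set js. unit j - \<Union>R)" "Dm \<inter> Y = {}"
    and "\<And>j. j \<in> set js \<Longrightarrow> (Dm \<union> Y) \<inter> unit j = {}"
    and "\<And>x. x \<in> Dm \<Longrightarrow> 5 \<le> deg B x" "distinct js" "js \<noteq> []"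
    and "successively (\<lambda>i j. joined (unit j) i) js" "\<And>j. j \<in> set js \<Longrightarrow> joined {} j"
    and "I \<subseteq> set js" "\<And>j. j \<in> set js - I \<Longrightarrow> unit j \<inter> \<Union>R = {}"
    and "\<And>j. j \<in> I \<Longrightarrow> 10 \<le> card (unit j - \<Union>R)"
    and "card I + card Y \<le> N1" "\<And>v. v \<in> V \<Longrightarrow> N1 + 1 \<le> card {j \<in> set js. joined {v} j}"
    and "card (V - \<Union>R) \<le> N2"
  shows "red_wins V E R B"
  using assms
proof (induction "card Y" arbitrary: R B Dm Y I)
  case 0
  note fst = "0.prems"(1) and U = "0.prems"(2)
  have "finite Y" using U by (metis finite_Diff finite_Un finite_lessThan)
  then have Y: "Y = {}" using 0 by simp
  have cnt: "10 \<le> card (unit j - \<Union>R)" if "j \<in> set js" for j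
  proof (cases "j \<in> I")
    case True
    then show ?thesis using "0.prems"(12) by blast
  next
    case False
    then have "unit j - \<Union>R = unit j" using "0.prems"(11)[of j] that by auto
    then show ?thesis by simp
  qed
  show ?case
  proof (rule path_win[OF fst, where Dm = Dm and C = "{}" and js = js])
    show "V - \<Union>R = Dm \<union> {} \<union> (\<Union>j\<in>set js. unit j - \<Union>R)" using U Y by simp
    show "(Dm \<union> {}) \<inter> unit j = {}" if "j \<in> set js" for j using "0.prems"(4)[OF that] by auto
    show "5 + min 5 (card ({}::nat set)) \<le> card (unit (hd js) - \<Union>R)" using cnt[of "hd js"] "0.prems"(7) by simp
    show "10 \<le> card (unit j - \<Union>R)" if "j \<in> set (tl js)" for j using cnt that by (meson list.set_sel(2) "0.prems"(7))
  qed (use 0 in \<open>auto simp: clique_def\<close>)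
next
  case (Suc k)
  note fst = Suc.prems(1) and U = Suc.prems(2) and disj = Suc.prems(3,4) and dD = Suc.prems(5)
    and dist = Suc.prems(6) and jsne = Suc.prems(7) and succ = Suc.prems(8) and jo = Suc.prems(9)
    and I = Suc.prems(10) and unt = Suc.prems(11) and cntI = Suc.prems(12) and cIY = Suc.prems(13)
    and nbr = Suc.prems(14) and UN = Suc.prems(15)
  note F = fastD[OF fst]
  have fY: "finite Y" using U by (metis finite_Diff finite_Un finite_lessThan)
  obtain y where y: "y \<in> Y" using Suc.hyps(2) by fastforce
  have yV: "y \<in> V - \<Union>R" using y U by auto
  have cY: "card (Y - {y}) = k" using y Suc.hyps(2) fY by simp
  have fI: "finite I" using I finite_subset by blast
  have "\<not> {j \<in> set js. joined {y} j} \<subseteq> I"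
  proof
    assume "{j \<in> set js. joined {y} j} \<subseteq> I"
    then have "card {j \<in> set js. joined {y} j} \<le> card I" using fI by (intro card_mono) auto
    then show False using nbr[of y] yV cIY by auto
  qed
  then obtain j where j: "j \<in> set js" "joined {y} j" "j \<notin> I" by blast
  have uj: "unit j \<inter> \<Union>R = {}" using unt j by blast
  have dj: "(Dm \<union> Y) \<inter> unit j = {}" using disj(2) j by blast
  show ?case
  proof (cases "\<exists>x\<in>unit j. {y, x} \<notin> B")
    case False
    then have "card (unit j) \<le> deg B y" using F(7) by (intro card_le_deg) auto
    then have d5: "5 \<le> deg B y" by simp
    show ?thesis
    proof (rule Suc.hyps(1)[OF _ fst, where Dm = "insert y Dm" and Y = "Y - {y}" and I = I])
      show "k = card (Y - {y})" using cY by simp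
      show "V - \<Union>R = insert y Dm \<union> (Y - {y}) \<union> (\<Union>j\<in>set js. unit j - \<Union>R)" using U y by auto
      show "insert y Dm \<inter> (Y - {y}) = {}" using disj by auto
      show "(insert y Dm \<union> (Y - {y})) \<inter> unit i = {}" if "i \<in> set js" for i using disj(2)[OF that] y by auto
      show "5 \<le> deg B x" if "x \<in> insert y Dm" for x using dD d5 that by auto
      show "card I + card (Y - {y}) \<le> N1" using cIY cY Suc.hyps(2) by simp
    qed (use dist jsne succ jo I unt cntI nbr UN in auto)
  next
    case True
    then obtain x where x: "x \<in> unit j" "{y, x} \<notin> B" by blast
    have xU: "x \<in> V - \<Union>R" using x j U uj by auto
    have xy: "x \<noteq> y" using dj x y by auto
    have "{x, y} \<in> E" using j(2) x xy unfolding joined_in_def by blast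
    then have eE: "{y, x} \<in> E" by (simp add: insert_commute)
    have e: "{y, x} \<in> E - R - B" "{y, x} \<inter> \<Union>R = {}" using uncovered_edge[OF fst yV eE] x xU yV by auto
    have "unit j \<subseteq> V - \<Union>R" using U j uj by auto
    then have "card (unit j) \<le> card (V - \<Union>R)" by (intro card_mono) auto
    then have U3: "3 \<le> card (V - \<Union>R)" by simp
    have un: "unit i - \<Union>(insert {y, x} R) = unit i - \<Union>R" "{y, x} \<inter> unit i = {}" if "i \<in> set js" "i \<noteq> j" for i
    proof -
      have "x \<notin> unit i" using unit_disjoint[of i j] that x by auto
      moreover have "y \<notin> unit i" using disj(2)[OF that(1)] y by auto
      ultimately show "unit i - \<Union>(insert {y, x} R) = unit i - \<Union>R" "{y, x} \<inter> unit i = {}" by auto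
    qed
    have unj: "unit j - \<Union>(insert {y, x} R) = (unit j - \<Union>R) - {x}" using dj y by auto
    show ?thesis
    proof (rule fast_step[OF fst e U3])
      fix f assume f: "f \<in> E - insert {y, x} R - B" and fst': "fast (insert {y, x} R) (insert f B)"
      show "red_wins V E (insert {y, x} R) (insert f B)"
      proof (rule Suc.hyps(1)[OF _ fst', where Dm = Dm and Y = "Y - {y}" and I = "insert j I"])
        show "k = card (Y - {y})" using cY by simp
        have yx: "y \<notin> Dm" "x \<notin> Dm \<union> Y" using disj y dj x by auto
        have split: "(\<Union>i\<in>set js. unit i - \<Union>(insert {y, x} R)) = (\<Union>i\<in>set js. unit i - \<Union>R) - {y, x}"
          by auto
        have "V - \<Union>(insert {y, x} R) = (V - \<Union>R) - {y, x}" by auto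
        also have "\<dots> = Dm \<union> (Y - {y}) \<union> ((\<Union>i\<in>set js. unit i - \<Union>R) - {y, x})"
          unfolding U using yx by auto
        finally show "V - \<Union>(insert {y, x} R) = Dm \<union> (Y - {y}) \<union> (\<Union>i\<in>set js. unit i - \<Union>(insert {y, x} R))"
          unfolding split .
        show "Dm \<inter> (Y - {y}) = {}" using disj by auto
        show "(Dm \<union> (Y - {y})) \<inter> unit i = {}" if "i \<in> set js" for i using disj(2)[OF that] by auto
        show "5 \<le> deg (insert f B) v" if "v \<in> Dm" for v
          using dD[OF that] deg_mono[OF _ subset_insertI[of B f], of v] F(7) by simp
        show "insert j I \<subseteq> set js" using j I by auto
        show "unit i \<inter> \<Union>(insert {y, x} R) = {}" if "i \<in> set js - insert j I" for i
        proof -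
          have "unit i \<inter> \<Union>R = {}" using unt that by auto
          moreover have "{y, x} \<inter> unit i = {}" using un(2) that by auto
          ultimately show ?thesis by auto
        qed
        show "10 \<le> card (unit i - \<Union>(insert {y, x} R))" if "i \<in> insert j I" for i
        proof (cases "i = j")
          case True
          have "unit j - \<Union>(insert {y, x} R) = unit j - {x}" using unj uj by auto
          then show ?thesis using True x by simp
        next
          case False
          then show ?thesis using un(1)[of i] that I cntI by auto
        qed
        show "card (insert j I) + card (Y - {y}) \<le> N1" using cIY cY Suc.hyps(2) j fI by simp
        show "card (V - \<Union>(insert {y, x} R)) \<le> N2" using card_uncovered_insert[OF eE e(2)] UN by simp
      qed (use dist jsne succ jo nbr in auto)
    qed
  qed
qed

text \<open>Once \<open>X\<close> contains no free edge, density forces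
  \<open>card X \<le> N1\<close>. Together with the \<open>L\<close> reserved units this is the
  value of \<open>N2\<close>.\<close>

lemma greedy_win:
  assumes "fast R B" "V - \<Union>R = X \<union> (\<Union>j\<in>set js. unit j)"
    and "\<And>j. j \<in> set js \<Longrightarrow> X \<inter> unit j = {}" "distinct js" "length js = L"
    and "successively (\<lambda>i j. joined (unit j) i) js" "\<And>j. j \<in> set js \<Longrightarrow> joined {} j"
    and "\<And>v. v \<in> V \<Longrightarrow> N1 + 1 \<le> card {j \<in> set js. joined {v} j}"
  shows "red_wins V E R B"
  using assms
proof (induction "card X" arbitrary: R B X rule: less_induct)
  case less
  note fst = less.prems(1) and U = less.prems(2) and disj = less.prems(3)
  note F = fastD[OF fst]
  have fX: "finite X" using U by (metis finite_Diff finite_Un finite_lessThan)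
  have jsne: "js \<noteq> []" using less.prems(5) L_pos by auto
  have un: "unit j \<inter> \<Union>R = {}" if "j \<in> set js" for j using U that by auto
  show ?case
  proof (cases "\<exists>e\<in>E - R - B. e \<subseteq> X")
    case True
    then obtain e where e: "e \<in> E - R - B" "e \<subseteq> X" by blast
    have eE: "e \<in> E" "e \<inter> \<Union>R = {}" using e U by auto
    have "unit (hd js) \<subseteq> V - \<Union>R" using U jsne by auto
    then have "card (unit (hd js)) \<le> card (V - \<Union>R)" by (intro card_mono) auto
    then have U3: "3 \<le> card (V - \<Union>R)" by simp
    show ?thesis
    proof (rule fast_step[OF fst e(1) eE(2) U3])
      fix f assume fst': "fast (insert e R) (insert f B)"
      show "red_wins V E (insert e R) (insert f B)"
      proof (rule less.hyps[OF _ fst', where X = "X - e"])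
        have "e \<noteq> {}" using edge_card[OF eE(1)] by auto
        then show "card (X - e) < card X" using e fX by (intro psubset_card_mono) auto
        have "V - \<Union>(insert e R) = (V - \<Union>R) - e" by auto
        also have "\<dots> = (X - e) \<union> (\<Union>j\<in>set js. unit j)" unfolding U using e disj by auto
        finally show "V - \<Union>(insert e R) = (X - e) \<union> (\<Union>j\<in>set js. unit j)" .
        show "(X - e) \<inter> unit j = {}" if "j \<in> set js" for j using disj[OF that] by auto
      qed (use less.prems in auto)
    qed
  next
    case False
    have "card X \<le> N1"
    proof (rule ccontr)
      assume "\<not> card X \<le> N1"
      moreover have "X \<subseteq> V" using U by auto
      moreover have "card R + card B \<le> 4 * n" using F(4,9) by linarith
      ultimately show False using False free_edge[of X R B] F(1,2) by (metis not_le)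
    qed
    have "card (V - \<Union>R) \<le> card X + card (\<Union>j\<in>set js. unit j)" unfolding U by (rule card_Un_le)
    also have "card (\<Union>j\<in>set js. unit j) \<le> (\<Sum>j\<in>set js. card (unit j))" by (rule card_UN_le) simp
    also have "\<dots> = 11 * L" using distinct_card[OF less.prems(4)] less.prems(5) by simp
    finally have UN: "card (V - \<Union>R) \<le> N2" using \<open>card X \<le> N1\<close> N2_def by simp
    show ?thesis
    proof (rule inject_win[OF fst, where Dm = "{}" and Y = X and I = "{}" and js = js])
      have "(\<Union>j\<in>set js. unit j - \<Union>R) = (\<Union>j\<in>set js. unit j)" using un by auto
      then show "V - \<Union>R = {} \<union> X \<union> (\<Union>j\<in>set js. unit j - \<Union>R)" using U by simp
      show "card ({}::nat set) + card X \<le> N1" using \<open>card X \<le> N1\<close> by simp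
    qed (use less.prems jsne UN un in auto)
  qed
qed

text \<open>The path has to avoid the units Red has touched; a matching of at most
  \<open>t1 + h\<close> edges touches at most twice as many.\<close>

lemma fast_win:
  assumes fst: "fast R B" and "card R \<le> t1 + h"
  shows "red_wins V E R B"
proof -
  note F = fastD[OF fst]
  define W where "W = {j \<in> {..<N}. unit j \<inter> \<Union>R \<noteq> {}}"
  have "\<Union>R \<subseteq> V" using F(1) edge_sub by blast
  then have "finite (\<Union>R)" using finite_subset by blast
  then have "card W \<le> card (\<Union>R)" unfolding W_def by (rule card_units_hit)
  then have cW: "card W \<le> 2 * (t1 + h)" using card_Union_matching[OF F(1,3)] assms(2) by simp
  have WN: "W \<subseteq> {..<N}" unfolding W_def by auto
  obtain js where js: "distinct js" "length js = L" "set js \<subseteq> {..<N} - W"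
    "successively (\<lambda>i j. joined (unit j) i) js" "\<And>j. j \<in> set js \<Longrightarrow> joined {} j"
    "\<And>v. v \<in> V \<Longrightarrow> N1 + 1 \<le> card {j \<in> set js. joined {v} j}"
    by (rule path_exists[OF WN cW], rule that; blast)
  have un: "unit j \<subseteq> V - \<Union>R" if "j \<in> set js" for j
    using js(3) that unit_sub[of j] unfolding W_def by auto
  show ?thesis
  proof (rule greedy_win[OF fst _ _ js(1,2,4,5,6), where X = "(V - \<Union>R) - (\<Union>j\<in>set js. unit j)"])
    show "V - \<Union>R = (V - \<Union>R) - (\<Union>j\<in>set js. unit j) \<union> (\<Union>j\<in>set js. unit j)" using un by blast
    show "((V - \<Union>R) - (\<Union>j\<in>set js. unit j)) \<inter> unit j = {}" if "j \<in> set js" for j using that by blast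
  qed
qed

section \<open>The opening: building gadgets\<close>

definition gedge :: "nat \<Rightarrow> nat set" where "gedge j = {11 * j, 11 * j + 1}"

lemma gedge_sub: "gedge j \<subseteq> unit j" unfolding gedge_def unit_def by auto

lemma inj_gedge: "inj gedge" unfolding gedge_def inj_def by (auto simp: doubleton_eq_iff)

text \<open>A move is a gadget edge found by \<open>weight_step\<close> or, as soon as a heavy
  vertex is uncovered, an edge that covers it. So the moves beyond \<open>card S\<close> are counted
  by covered heavy vertices. After \<open>t1\<close> gadget moves \<open>gadget_weight\<close>
  yields \<open>G\<close> gadgets for every triple, and \<open>fast_win\<close> or
  \<open>slow_win\<close> takes over.\<close>

lemma gadget_phase:
  assumes "R \<subseteq> E" "B \<subseteq> E" "matching R" "card R = card B" "S \<subseteq> {..<N}" "card S \<le> t1"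
    and "\<And>j. j \<in> S \<Longrightarrow> gedge j \<in> R"
    and "card R \<le> card S + card (heavy B \<inter> \<Union>R)"
    and "weight S \<le> real n ^ 3 * (1 - c / 4) ^ card S"
    and "\<And>v. v \<in> V - \<Union>R \<Longrightarrow> deg B v \<le> D + card (heavy B \<inter> \<Union>R) + 1"
  shows "red_wins V E R B"
  using assms
proof (induction "card E - card R" arbitrary: R B S rule: less_induct)
  case less
  note sub = less.prems(1,2) and mat = less.prems(3) and RB = less.prems(4) and S = less.prems(5,6)
    and SR = less.prems(7) and RM = less.prems(8) and wt = less.prems(9) and dg = less.prems(10)
  have fin: "finite R" "finite B" "finite S"
    using sub E_finite_sub finite_subset[OF S(1)] by auto
  have cU: "card (V - \<Union>R) + 2 * card R = n" by (rule card_uncovered[OF sub(1) mat])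
  have hc: "card (heavy B \<inter> \<Union>R) \<le> card (heavy B)" by (intro card_mono) auto
  have Rn: "card R \<le> n" using cU by linarith
  then have ch: "card (heavy B) \<le> h" using card_heavy_le sub(2) RB by simp
  then have Rt: "card R \<le> t1 + h" using RM hc S by linarith
  have "c * N \<le> 1 * real N" using c_le by (intro mult_right_mono) auto
  then have "2 * real (D + 4 * t1 + 4 * h + 4 + L) \<le> real N" using c_ge by simp
  then have "2 * (D + 4 * t1 + 4 * h + 4 + L) \<le> N" by linarith
  then have big: "2 * (D + 4 * t1 + 4 * h + 4 + L) \<le> n" using units_fit by linarith
  have U3: "3 \<le> card (V - \<Union>R)" using big cU Rt by simp
  have iso3: "3 \<le> card (iso B)" using iso_lower[OF sub(2), of "{}"] cU RB U3 by simp
  have size: "card R + card B + 1 \<le> 4 * n" using Rn RB U3 cU by linarith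
  have UR: "\<Union>R \<subseteq> V" "\<Union>B \<subseteq> V" using sub edge_sub by blast+
  then have fU: "finite (\<Union>R)" "finite (\<Union>B)" using finite_subset by blast+
  show ?case
  proof (cases "card S = t1")
    case True
    have gad: "G \<le> card (gadgets R T)" if "T \<subseteq> V" "T \<noteq> {}" "card T \<le> 3" for T
    proof -
      have "weight S \<le> (1 / 2) ^ G" using wt gadget_weight True by simp
      then have "G \<le> card {j \<in> S. joined T j}" using that by (intro weight_count) (auto simp: triples_def)
      also have "\<dots> = card (gedge ` {j \<in> S. joined T j})"
        using inj_gedge by (intro card_image[symmetric]) (auto simp: inj_on_def inj_def)
      also have "\<dots> \<le> card (gadgets R T)"
      proof (rule card_mono)
        show "finite (gadgets R T)" using finite_gadgets sub by blast
        show "gedge ` {j \<in> S. joined T j} \<subseteq> gadgets R T"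
        proof
          fix e assume "e \<in> gedge ` {j \<in> S. joined T j}"
          then obtain j where j: "j \<in> S" "joined T j" "e = gedge j" by auto
          have "e \<inter> T = {}" using j gedge_sub[of j] unfolding joined_in_def by auto
          moreover have "{x, y} \<in> E" if "x \<in> T" "y \<in> e" for x y
          proof -
            have "y \<in> unit j" "x \<noteq> y" using that j gedge_sub[of j] \<open>e \<inter> T = {}\<close> by auto
            then have "{y, x} \<in> E" using j(2) that unfolding joined_in_def by auto
            then show ?thesis by (simp add: insert_commute)
          qed
          ultimately show "e \<in> gadgets R T" using SR[OF j(1)] j(3) unfolding gadgets_def by auto
        qed
      qed
      finally show ?thesis .
    qed
    show ?thesis
    proof (cases "heavy B = {}")
      case True
      then have "fast R B" using sub mat RB gad unfolding fast_def by blast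
      then show ?thesis using fast_win Rt by blast
    next
      case False
      have "V - \<Union>R \<noteq> {}" using U3 by (metis card.empty not_numeral_le_zero)
      then show ?thesis using slow_win[OF sub order_refl mat RB _ dg False] gad trans_le_add1 by blast
    qed
  next
    case False
    then have St: "card S < t1" using S by simp
    have measure: "card E - card (insert e R) < card E - card R" if "e \<in> E - R - B" for e
    proof -
      have "card (insert e R) \<le> card E" using that sub by (intro card_mono) auto
      then show ?thesis using that fin by simp
    qed
    show ?thesis
    proof (cases "heavy B \<inter> (V - \<Union>R) = {}")
      case True
      \<comment> \<open>Units touched by either player are excluded, so \<open>gedge j\<close> is
        free and disjoint from Red's edges. Each player has at most \<open>t1 + h\<close> edges,
        whence \<open>4 * t1 + 4 * h\<close> in \<open>c_ge\<close>.\<close>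
      define W where "W = {j \<in> {..<N}. unit j \<inter> (\<Union>R \<union> \<Union>B) \<noteq> {}}"
      have "card (\<Union>B) \<le> 2 * card B"
      proof -
        have "card (\<Union>B) \<le> sum card B" using card_Union_le_sum_card by blast
        also have "\<dots> = (\<Sum>e\<in>B. 2)" using sub edge_card by (intro sum.cong) auto
        finally show ?thesis by simp
      qed
      then have "card (\<Union>R \<union> \<Union>B) \<le> 4 * t1 + 4 * h"
        using card_Un_le[of "\<Union>R" "\<Union>B"] card_Union_matching[OF sub(1) mat] RB Rt by simp
      then have "card W \<le> 4 * t1 + 4 * h"
        using card_units_hit[of "\<Union>R \<union> \<Union>B" N] fU unfolding W_def by simp
      then have "card W \<le> D + 4 * t1 + 4 * h + 4 + L" by simp
      then have "real (card W) \<le> real (D + 4 * t1 + 4 * h + 4 + L)" by (simp only: of_nat_le_iff)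
      then have cW: "real (card W) \<le> c * N / 2" using c_ge by argo
      have SW: "S \<subseteq> W"
      proof
        fix j assume "j \<in> S"
        then have "11 * j \<in> unit j \<inter> \<Union>R" "j < N" using SR[of j] S unfolding gedge_def unit_def by auto
        then show "j \<in> W" unfolding W_def by blast
      qed
      have "W \<subseteq> {..<N}" unfolding W_def by auto
      then obtain j where j: "j \<in> {..<N} - W" "joined {} j" "weight (insert j S) \<le> (1 - c / 4) * weight S"
        using weight_step[OF SW _ cW, of "{}"] by auto
      have jU: "unit j \<inter> \<Union>R = {}" "unit j \<inter> \<Union>B = {}" "j \<notin> S" using j(1) SW unfolding W_def by auto
      have gE: "gedge j \<in> E"
      proof -
        have "11 * j \<in> unit j" "11 * j + 1 \<in> unit j" unfolding unit_def by auto
        then show ?thesis using j(2) unfolding joined_in_def gedge_def by auto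
      qed
      have gne: "gedge j \<noteq> {}" unfolding gedge_def by simp
      have gR: "gedge j \<inter> \<Union>R = {}" "gedge j \<inter> \<Union>B = {}" using gedge_sub[of j] jU by blast+
      then have e: "gedge j \<in> E - R - B" using gE gne by blast
      show ?thesis
      proof (rule red_step[OF e iso3 size])
        fix f assume f: "f \<in> E - insert (gedge j) R - B"
        have mono: "heavy B \<subseteq> heavy (insert f B)" using fin by (intro heavy_mono) auto
        have c1: "card (heavy B \<inter> \<Union>R) \<le> card (heavy (insert f B) \<inter> \<Union>(insert (gedge j) R))"
          using mono by (intro card_mono) auto
        show "red_wins V E (insert (gedge j) R) (insert f B)"
        proof (rule less.hyps[OF measure[OF e], where S = "insert j S"])
          show "insert (gedge j) R \<subseteq> E" "insert f B \<subseteq> E" using gE f sub by auto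
          show "matching (insert (gedge j) R)" using mat gR by (intro matching_insert) auto
          show "card (insert (gedge j) R) = card (insert f B)" using e f fin RB by simp
          show "insert j S \<subseteq> {..<N}" using S j by auto
          show "card (insert j S) \<le> t1" using jU fin St by simp
          show "gedge i \<in> insert (gedge j) R" if "i \<in> insert j S" for i using SR that by auto
          show "card (insert (gedge j) R) \<le> card (insert j S) + card (heavy (insert f B) \<inter> \<Union>(insert (gedge j) R))"
            using e fin jU RM c1 by simp
          have "weight (insert j S) \<le> (1 - c / 4) * (real n ^ 3 * (1 - c / 4) ^ card S)"
            using order_trans[OF j(3) mult_left_mono[OF wt]] c_le by simp
          then show "weight (insert j S) \<le> real n ^ 3 * (1 - c / 4) ^ card (insert j S)"
            using jU fin by (simp add: algebra_simps)
          show "deg (insert f B) v \<le> D + card (heavy (insert f B) \<inter> \<Union>(insert (gedge j) R)) + 1"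
            if "v \<in> V - \<Union>(insert (gedge j) R)" for v
          proof -
            have "v \<notin> heavy B" using True that by auto
            then show ?thesis using deg_insert_le[of B f v] fin that unfolding heavy_def by auto
          qed
        qed
      qed (use fin in auto)
    next
      case hv: False
      then obtain u where u: "u \<in> heavy B" "u \<in> V - \<Union>R" by blast
      define X where "X = {y \<in> V. {u, y} \<in> E}"
      define Fb where "Fb = {y. {u, y} \<in> B}"
      have Fb: "finite Fb" "card Fb \<le> D + h + 1"
      proof -
        have inj: "inj_on (\<lambda>y. {u, y}) Fb" by (auto simp: inj_on_def doubleton_eq_iff)
        have im: "(\<lambda>y. {u, y}) ` Fb \<subseteq> B" unfolding Fb_def by auto
        show "finite Fb" using inj_on_finite[OF inj im fin(2)] .
        have "card Fb \<le> deg B u" using fin(2) by (rule card_le_deg) (simp add: Fb_def)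
        then show "card Fb \<le> D + h + 1" using dg[OF u(2)] hc ch by linarith
      qed
      have "\<not> X \<subseteq> Fb \<union> \<Union>R"
      proof
        assume *: "X \<subseteq> Fb \<union> \<Union>R"
        then have "card X \<le> card (Fb \<union> \<Union>R)" using Fb fU by (intro card_mono) auto
        also have "\<dots> \<le> D + h + 1 + 2 * (t1 + h)"
          using card_Un_le[of Fb "\<Union>R"] Fb card_Union_matching[OF sub(1) mat] Rt by simp
        finally show False using min_degree[of u] u unfolding X_def by auto
      qed
      then obtain y where y: "{u, y} \<in> E" "y \<in> V" "{u, y} \<notin> B" "y \<notin> \<Union>R"
        unfolding X_def Fb_def by blast
      have e: "{u, y} \<in> E - R - B" using y u by auto
      show ?thesis
      proof (rule red_step[OF e iso3 size])
        fix f assume f: "f \<in> E - insert {u, y} R - B"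
        have mono: "heavy B \<subseteq> heavy (insert f B)" using fin by (intro heavy_mono) auto
        have c2: "card (heavy B \<inter> \<Union>R) + 1 \<le> card (heavy (insert f B) \<inter> \<Union>(insert {u, y} R))"
        proof -
          have "insert u (heavy B \<inter> \<Union>R) \<subseteq> heavy (insert f B) \<inter> \<Union>(insert {u, y} R)" using mono u by auto
          then have "card (insert u (heavy B \<inter> \<Union>R)) \<le> card (heavy (insert f B) \<inter> \<Union>(insert {u, y} R))" by (intro card_mono) auto
          then show ?thesis using u by simp
        qed
        show "red_wins V E (insert {u, y} R) (insert f B)"
        proof (rule less.hyps[OF measure[OF e], where S = S])
          show "insert {u, y} R \<subseteq> E" "insert f B \<subseteq> E" using y f sub by auto
          show "matching (insert {u, y} R)" using mat u y by (intro matching_insert) auto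
          show "card (insert {u, y} R) = card (insert f B)" using e f fin RB by simp
          show "S \<subseteq> {..<N}" "card S \<le> t1" using S by auto
          show "gedge i \<in> insert {u, y} R" if "i \<in> S" for i using SR that by auto
          show "card (insert {u, y} R) \<le> card S + card (heavy (insert f B) \<inter> \<Union>(insert {u, y} R))"
            using e fin RM c2 by simp
          show "weight S \<le> real n ^ 3 * (1 - c / 4) ^ card S" by fact
          show "deg (insert f B) v \<le> D + card (heavy (insert f B) \<inter> \<Union>(insert {u, y} R)) + 1"
            if "v \<in> V - \<Union>(insert {u, y} R)" for v
            using dg[of v] c2 deg_insert_le[of B f v] fin that by auto
        qed
      qed (use fin in auto)
    qed
  qed
qed

theorem strategy_red_wins: "red_has_winning_strategy n E"
  unfolding red_has_winning_strategy_def
  by (rule gadget_phase[where S = "{}"]) (auto simp: matching_def deg_def weight_empty)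

end

section \<open>Pseudorandomness of the random graph\<close>

lemma prod_one_plus_Pow:
  fixes a :: "'a \<Rightarrow> 'b :: comm_semiring_1"
  assumes "finite J"
  shows "(\<Prod>j\<in>J. 1 + a j) = (\<Sum>I\<in>Pow J. \<Prod>j\<in>I. a j)"
  using prod_add[OF assms, of a "\<lambda>_. 1"] by (simp add: add.commute)

lemma set_Gnp: "set_pmf (Gnp n p) \<subseteq> Pow (Kn_edges n)"
  unfolding Gnp_def by auto

lemma finite_set_Gnp [simp]: "finite (set_pmf (Gnp n p))"
  using finite_subset[OF set_Gnp] by auto

lemma prob_Gnp_supset:
  assumes p: "0 \<le> p" "p \<le> 1" and T: "T \<subseteq> Kn_edges n"
  shows "measure_pmf.prob (Gnp n p) {E. T \<subseteq> E} = p ^ card T"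
proof -
  define B where "B e = (if e \<in> T then {True} else UNIV)" for e
  have "measure_pmf.prob (Gnp n p) {E. T \<subseteq> E}
      = measure_pmf.prob (Pi_pmf (Kn_edges n) False (\<lambda>_. bernoulli_pmf p)) (Pi (Kn_edges n) B)"
    unfolding Gnp_def measure_map_pmf
    by (rule arg_cong[where f = "measure_pmf.prob _"]) (use T in \<open>auto simp: B_def Pi_def\<close>)
  also have "\<dots> = (\<Prod>e\<in>Kn_edges n. measure_pmf.prob (bernoulli_pmf p) (B e))"
    by (rule measure_Pi_pmf_Pi) simp
  also have "\<dots> = (\<Prod>e\<in>Kn_edges n. if e \<in> T then p else 1)"
    using p by (intro prod.cong refl) (auto simp: B_def measure_pmf_single)
  also have "\<dots> = p ^ card T" using T by (simp add: prod.If_cases Int_absorb1)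
  finally show ?thesis .
qed

text \<open>An exponential moment bound: the expectation of
  \<open>(1 / 2) ^ card {j \<in> J. S j \<subseteq> E}\<close> factorises, and Markov's inequality
  gives the factor \<open>2 ^ k\<close>. Instead of an independence argument, the product is
  expanded over subsets \<open>I\<close> of \<open>J\<close>; each term is the probability that a
  fixed edge set is present.\<close>

lemma Gnp_lower_tail:
  assumes p: "0 \<le> p" "p \<le> 1" and J: "finite J"
    and S: "\<And>j. j \<in> J \<Longrightarrow> S j \<subseteq> Kn_edges n" "\<And>j. j \<in> J \<Longrightarrow> card (S j) \<le> b"
    and disj: "\<And>i j. i \<in> J \<Longrightarrow> j \<in> J \<Longrightarrow> i \<noteq> j \<Longrightarrow> S i \<inter> S j = {}"
  shows "measure_pmf.prob (Gnp n p) {E. card {j \<in> J. S j \<subseteq> E} \<le> k} \<le> 2 ^ k * (1 - p ^ b / 2) ^ card J"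
proof -
  \<comment> \<open>A factor is \<open>1 / 2\<close> if \<open>S j\<close> is present and 1
    otherwise; the form \<open>1 +\<close> is what \<open>prod_one_plus_Pow\<close> expands.\<close>
  define X where "X E = (\<Prod>j\<in>J. 1 + (if S j \<subseteq> E then - (1 / 2) else 0 :: real))" for E
  define P where "P = measure_pmf (Gnp n p)"
  have int: "integrable P f" for f :: "nat set set \<Rightarrow> real"
    unfolding P_def by (rule integrable_measure_pmf_finite) simp
  have X: "X E = (1 / 2) ^ card {j \<in> J. S j \<subseteq> E}" for E
  proof -
    have "X E = (\<Prod>j\<in>J. if S j \<subseteq> E then 1 / 2 else 1)" unfolding X_def by (intro prod.cong) auto
    also have "\<dots> = (1 / 2) ^ card {j \<in> J. S j \<subseteq> E}"
      using J by (simp add: prod.If_cases Int_def)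
    finally show ?thesis .
  qed
  have "(\<integral>E. X E \<partial>P) = (\<Sum>I\<in>Pow J. \<integral>E. (\<Prod>j\<in>I. if S j \<subseteq> E then - (1 / 2) else 0) \<partial>P)"
    unfolding X_def prod_one_plus_Pow[OF J] by (rule Bochner_Integration.integral_sum) (rule int)
  also have "\<dots> = (\<Sum>I\<in>Pow J. \<Prod>j\<in>I. - (p ^ card (S j) / 2))"
  proof (rule sum.cong)
    fix I assume "I \<in> Pow J"
    then have I: "I \<subseteq> J" "finite I" using J finite_subset by auto
    have "(\<Prod>j\<in>I. if S j \<subseteq> E then - (1 / 2) else 0 :: real) = (- (1 / 2)) ^ card I * indicator {E. (\<Union>j\<in>I. S j) \<subseteq> E} E" for E
    proof (cases "(\<Union>j\<in>I. S j) \<subseteq> E")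
      case True
      then have "(\<Prod>j\<in>I. if S j \<subseteq> E then - (1 / 2) else 0 :: real) = (\<Prod>j\<in>I. - (1 / 2))"
        by (intro prod.cong) auto
      then show ?thesis using True by simp
    next
      case False
      then obtain j where "j \<in> I" "\<not> S j \<subseteq> E" by blast
      then have "(\<Prod>j\<in>I. if S j \<subseteq> E then - (1 / 2) else 0 :: real) = 0" using I by (intro prod_zero) auto
      then show ?thesis using False by simp
    qed
    then have "(\<integral>E. (\<Prod>j\<in>I. if S j \<subseteq> E then - (1 / 2) else 0) \<partial>P)
        = (- (1 / 2)) ^ card I * measure_pmf.prob (Gnp n p) {E. (\<Union>j\<in>I. S j) \<subseteq> E}"
      by (simp add: P_def)
    also have "measure_pmf.prob (Gnp n p) {E. (\<Union>j\<in>I. S j) \<subseteq> E} = p ^ card (\<Union>j\<in>I. S j)"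
      using S(1) I by (intro prob_Gnp_supset p) auto
    also have "card (\<Union>j\<in>I. S j) = (\<Sum>j\<in>I. card (S j))"
    proof (rule card_UN_disjoint)
      show "\<forall>i\<in>I. finite (S i)" using S(1) I finite_subset[OF _ finite_Kn_edges] by blast
      show "\<forall>i\<in>I. \<forall>j\<in>I. i \<noteq> j \<longrightarrow> S i \<inter> S j = {}" using disj I by blast
    qed fact
    also have "(- (1 / 2)) ^ card I * p ^ (\<Sum>j\<in>I. card (S j)) = (\<Prod>j\<in>I. - (1 / 2) * p ^ card (S j))"
      by (simp only: prod.distrib power_sum prod_constant)
    finally show "(\<integral>E. (\<Prod>j\<in>I. if S j \<subseteq> E then - (1 / 2) else 0) \<partial>P) = (\<Prod>j\<in>I. - (p ^ card (S j) / 2))"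
      by simp
  qed simp
  also have "\<dots> = (\<Prod>j\<in>J. 1 + - (p ^ card (S j) / 2))" by (rule prod_one_plus_Pow[OF J, symmetric])
  also have "\<dots> \<le> (\<Prod>j\<in>J. 1 - p ^ b / 2)"
  proof (rule prod_mono)
    fix j assume j: "j \<in> J"
    have "p ^ b \<le> p ^ card (S j)" using S(2)[OF j] p by (intro power_decreasing) auto
    moreover have "p ^ card (S j) \<le> 1" using p by (simp add: power_le_one)
    ultimately show "0 \<le> 1 + - (p ^ card (S j) / 2) \<and> 1 + - (p ^ card (S j) / 2) \<le> 1 - p ^ b / 2" by simp
  qed
  finally have EX: "(\<integral>E. X E \<partial>P) \<le> (1 - p ^ b / 2) ^ card J" by simp
  have "measure_pmf.prob (Gnp n p) {E. card {j \<in> J. S j \<subseteq> E} \<le> k}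
      = (\<integral>E. indicator {E. card {j \<in> J. S j \<subseteq> E} \<le> k} E \<partial>P)" by (simp add: P_def)
  also have "\<dots> \<le> (\<integral>E. 2 ^ k * X E \<partial>P)"
  proof (rule integral_mono[OF int int])
    fix E
    show "indicator {E. card {j \<in> J. S j \<subseteq> E} \<le> k} E \<le> 2 ^ k * X E"
    proof (cases "card {j \<in> J. S j \<subseteq> E} \<le> k")
      case True
      then have "(1 / 2 :: real) ^ k \<le> X E" unfolding X by (intro power_decreasing) auto
      then have "2 ^ k * (1 / 2 :: real) ^ k \<le> 2 ^ k * X E" by (intro mult_left_mono) auto
      then show ?thesis using True by (simp add: power_divide)
    qed (simp add: X)
  qed
  also have "\<dots> = 2 ^ k * (\<integral>E. X E \<partial>P)" by simp
  also have "\<dots> \<le> 2 ^ k * (1 - p ^ b / 2) ^ card J" using EX by (intro mult_left_mono) auto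
  finally show ?thesis .
qed

lemma one_minus_power_le_exp:
  fixes x :: real assumes "0 \<le> x" "x \<le> 1" shows "(1 - x) ^ k \<le> exp (- x * k)"
proof -
  have "(1 - x) ^ k \<le> exp (- x) ^ k" using assms exp_ge_add_one_self[of "- x"] by (intro power_mono) auto
  also have "\<dots> = exp (- x * k)" by (simp add: exp_of_nat_mult[symmetric] mult.commute)
  finally show ?thesis .
qed

lemma two_power_le_exp: "(2::real) ^ k \<le> exp (real k)"
proof -
  have "(2::real) ^ k \<le> exp 1 ^ k" using exp_ge_add_one_self[of "1::real"] by (intro power_mono) auto
  then show ?thesis by (simp add: exp_of_nat_mult[symmetric])
qed

text \<open>After discarding the units that meet \<open>T\<close>, at most 14, different units
  depend on disjoint edge sets, so \<open>Gnp_lower_tail\<close> applies. The exponent 275 is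
  \<open>11 * 25\<close>: one end in the unit, the other among its 11 vertices or the at most 14 of
  \<open>T\<close>.\<close>

lemma prob_few_joined:
  assumes p: "0 \<le> p" "p \<le> 1" and fit: "11 * N \<le> n" and T: "T \<subseteq> {..<n}" "card T \<le> 14"
  shows "measure_pmf.prob (Gnp n p) {E. card {j \<in> {..<N}. joined_in E T j} \<le> k}
    \<le> 2 ^ k * (1 - p ^ 275 / 2) ^ (N - 14)"
proof -
  define J where "J = {j \<in> {..<N}. unit j \<inter> T = {}}"
  define S where "S j = (\<lambda>(x, y). {x, y}) ` {(x, y) \<in> unit j \<times> (unit j \<union> T). x \<noteq> y}" for j
  have fT: "finite T" using T(1) finite_subset by blast
  have uV: "unit j \<subseteq> {..<n}" if "j < N" for j using that fit unfolding unit_def by auto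
  have eq: "{j \<in> {..<N}. joined_in E T j} = {j \<in> J. S j \<subseteq> E}" for E
  proof -
    have "S j \<subseteq> E \<longleftrightarrow> (\<forall>x\<in>unit j. \<forall>y\<in>unit j \<union> T. x \<noteq> y \<longrightarrow> {x, y} \<in> E)" for j
      unfolding S_def by auto
    then show ?thesis unfolding J_def joined_in_def by blast
  qed
  have cJ: "N - 14 \<le> card J"
  proof -
    have "{..<N} = J \<union> {j \<in> {..<N}. unit j \<inter> T \<noteq> {}}" unfolding J_def by auto
    then have "N \<le> card J + card {j \<in> {..<N}. unit j \<inter> T \<noteq> {}}" by (metis card_Un_le card_lessThan)
    then show ?thesis using card_units_hit[OF fT, of N] T(2) by linarith
  qed
  have fJ: "finite J" unfolding J_def by simp
  have "measure_pmf.prob (Gnp n p) {E. card {j \<in> J. S j \<subseteq> E} \<le> k} \<le> 2 ^ k * (1 - p ^ 275 / 2) ^ card J"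
  proof (rule Gnp_lower_tail[OF p fJ])
    fix j assume j: "j \<in> J"
    then have "unit j \<union> T \<subseteq> {..<n}" using uV T unfolding J_def by auto
    then have "{x, y} \<in> Kn_edges n" if "x \<in> unit j" "y \<in> unit j \<union> T" "x \<noteq> y" for x y
      using that unfolding Kn_edges_def by blast
    then show "S j \<subseteq> Kn_edges n" unfolding S_def by auto
    have sub: "{(x, y) \<in> unit j \<times> (unit j \<union> T). x \<noteq> y} \<subseteq> unit j \<times> (unit j \<union> T)" by blast
    have fin: "finite (unit j \<times> (unit j \<union> T))" using fT by simp
    have "card (S j) \<le> card {(x, y) \<in> unit j \<times> (unit j \<union> T). x \<noteq> y}"
      unfolding S_def by (rule card_image_le[OF finite_subset[OF sub fin]])
    also have "\<dots> \<le> card (unit j \<times> (unit j \<union> T))" by (rule card_mono[OF fin sub])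
    also have "\<dots> = 11 * card (unit j \<union> T)" by (simp add: card_cartesian_product)
    also have "\<dots> \<le> 11 * 25" using card_Un_le[of "unit j" T] T(2) by simp
    finally show "card (S j) \<le> 275" by simp
  next
    fix i j assume ij: "i \<in> J" "j \<in> J" "i \<noteq> j"
    show "S i \<inter> S j = {}"
    proof (rule ccontr)
      assume "S i \<inter> S j \<noteq> {}"
      then obtain e where e: "e \<in> S i" "e \<in> S j" by blast
      obtain x y where xy: "x \<in> unit i" "y \<in> unit i \<union> T" "e = {x, y}" using e(1) unfolding S_def by auto
      obtain x' where x': "x' \<in> unit j" "x' \<in> e" using e(2) unfolding S_def by auto
      have "x' \<in> unit i \<union> T" using xy x' by blast
      moreover have "unit i \<inter> unit j = {}" "unit j \<inter> T = {}" using ij unit_disjoint unfolding J_def by auto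
      ultimately show False using x'(1) by blast
    qed
  qed
  also have "\<dots> \<le> 2 ^ k * (1 - p ^ 275 / 2) ^ (N - 14)"
  proof (intro mult_left_mono power_decreasing cJ)
    have "0 \<le> p ^ 275" "p ^ 275 \<le> 1" using p by (auto simp: power_le_one)
    then show "0 \<le> 1 - p ^ 275 / 2" "1 - p ^ 275 / 2 \<le> 1" by auto
  qed auto
  finally show ?thesis unfolding eq .
qed

text \<open>A union bound over \<open>T\<close>. The threshold \<open>q * N / 4\<close> is half of
  the exponent \<open>q / 2 * (N - 14)\<close> from the tail bound, so after bounding
  \<open>2 ^ k\<close> by \<open>exp k\<close> a decay of \<open>q * N / 4\<close> remains.\<close>

lemma prob_bad_tuple:
  assumes p: "0 < p" "p \<le> 1" and fit: "11 * N \<le> n" and q: "q = p ^ 275"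
  shows "measure_pmf.prob (Gnp n p) {E. \<exists>T\<subseteq>{..<n}. T \<noteq> {} \<and> card T \<le> 14 \<and>
      real (card {j \<in> {..<N}. joined_in E T j}) < q / 4 * N} \<le> real n ^ 14 * exp (7 * q - q * N / 4)"
proof -
  have q01: "0 < q" "q \<le> 1" using p q by (auto simp: power_le_one)
  define k where "k = nat \<lfloor>q / 4 * N\<rfloor>"
  define XS where "XS = {xs. set xs \<subseteq> {..<n} \<and> length xs = 14}"
  define bad where "bad T = {E. card {j \<in> {..<N}. joined_in E T j} \<le> k}" for T
  have kq: "real k \<le> q / 4 * N" unfolding k_def using q01 by (intro of_nat_floor) simp
  have XS: "finite XS" "card XS = n ^ 14" unfolding XS_def
    by (auto simp: finite_lists_length_eq card_lists_length_eq)
  have "{E. \<exists>T\<subseteq>{..<n}. T \<noteq> {} \<and> card T \<le> 14 \<and> real (card {j \<in> {..<N}. joined_in E T j}) < q / 4 * N}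
      \<subseteq> (\<Union>xs\<in>XS. bad (set xs))"
  proof
    fix E assume "E \<in> {E. \<exists>T\<subseteq>{..<n}. T \<noteq> {} \<and> card T \<le> 14 \<and> real (card {j \<in> {..<N}. joined_in E T j}) < q / 4 * N}"
    then obtain T where T: "T \<subseteq> {..<n}" "T \<noteq> {}" "card T \<le> 14" "real (card {j \<in> {..<N}. joined_in E T j}) < q / 4 * N"
      by blast
    have "finite T" using T(1) finite_subset by blast
    then obtain ys where ys: "set ys = T" "distinct ys" using finite_distinct_list by blast
    \<comment> \<open>Padding by a repeated element makes all sets lists of length 14, which number
      exactly \<open>n ^ 14\<close>.\<close>
    define xs where "xs = ys @ replicate (14 - length ys) (hd ys)"
    have "ys \<noteq> []" using ys T by auto
    then have "set xs = T" unfolding xs_def using ys by auto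
    moreover have "length xs = 14" unfolding xs_def using ys T(3) distinct_card[OF ys(2)] by simp
    ultimately have "xs \<in> XS" "set xs = T" unfolding XS_def using T by auto
    moreover have "int (card {j \<in> {..<N}. joined_in E T j}) \<le> \<lfloor>q / 4 * N\<rfloor>"
      using T(4) by (simp add: le_floor_iff)
    then have "card {j \<in> {..<N}. joined_in E T j} \<le> k" unfolding k_def by linarith
    ultimately show "E \<in> (\<Union>xs\<in>XS. bad (set xs))" unfolding bad_def by blast
  qed
  then have "measure_pmf.prob (Gnp n p) {E. \<exists>T\<subseteq>{..<n}. T \<noteq> {} \<and> card T \<le> 14 \<and>
      real (card {j \<in> {..<N}. joined_in E T j}) < q / 4 * N} \<le> measure_pmf.prob (Gnp n p) (\<Union>xs\<in>XS. bad (set xs))"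
    by (intro measure_pmf.finite_measure_mono) auto
  also have "\<dots> \<le> (\<Sum>xs\<in>XS. measure_pmf.prob (Gnp n p) (bad (set xs)))"
    using XS by (intro measure_pmf.finite_measure_subadditive_finite) auto
  also have "\<dots> \<le> (\<Sum>xs\<in>XS. exp (7 * q - q * N / 4))"
  proof (rule sum_mono)
    fix xs assume xs: "xs \<in> XS"
    have "measure_pmf.prob (Gnp n p) (bad (set xs)) \<le> 2 ^ k * (1 - p ^ 275 / 2) ^ (N - 14)"
      unfolding bad_def using xs card_length[of xs] p by (intro prob_few_joined fit) (auto simp: XS_def)
    also have "\<dots> \<le> exp (real k) * exp (- (q / 2) * real (N - 14))"
      unfolding q[symmetric] using q01 by (intro mult_mono two_power_le_exp one_minus_power_le_exp) auto
    also have "\<dots> = exp (real k - (q / 2) * real (N - 14))" by (simp add: exp_add[symmetric])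
    also have "\<dots> \<le> exp (7 * q - q * N / 4)"
    proof -
      have "real N - 14 \<le> real (N - 14)" by linarith
      then have "(q / 2) * (real N - 14) \<le> (q / 2) * real (N - 14)" using q01 by (intro mult_left_mono) auto
      then show ?thesis using kq by (simp add: algebra_simps)
    qed
    finally show "measure_pmf.prob (Gnp n p) (bad (set xs)) \<le> exp (7 * q - q * N / 4)" .
  qed
  also have "\<dots> = real n ^ 14 * exp (7 * q - q * N / 4)" using XS by simp
  finally show ?thesis .
qed

text \<open>A larger set contains at least as many edges, so sets of exactly \<open>K + 1\<close>
  vertices suffice, at most \<open>2 ^ n\<close> of them. With the factor \<open>2 ^ (4 * n)\<close>
  of the tail bound this costs \<open>exp (5 * n)\<close>, against a gain quadratic in
  \<open>K\<close>.\<close>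

lemma prob_sparse_set:
  assumes p: "0 < p" "p \<le> 1"
  shows "measure_pmf.prob (Gnp n p) {E. E \<subseteq> Kn_edges n \<and> (\<exists>X\<subseteq>{..<n}. K < card X \<and> card {e \<in> E. e \<subseteq> X} \<le> 4 * n)}
    \<le> exp (5 * real n - p / 4 * (real K * (real K + 1)))"
proof -
  define XS where "XS = {X. X \<subseteq> {..<n} \<and> card X = K + 1}"
  define J where "J X = {e. e \<subseteq> X \<and> card e = 2}" for X :: "nat set"
  define bad where "bad X = {E. card {e \<in> J X. {e} \<subseteq> E} \<le> 4 * n}" for X
  have XS: "finite XS" "card XS \<le> 2 ^ n"
  proof -
    have "XS \<subseteq> Pow {..<n}" unfolding XS_def by auto
    then show "finite XS" "card XS \<le> 2 ^ n" using finite_subset card_mono[of "Pow {..<n}" XS] by (auto simp: card_Pow)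
  qed
  have "{E. E \<subseteq> Kn_edges n \<and> (\<exists>X\<subseteq>{..<n}. K < card X \<and> card {e \<in> E. e \<subseteq> X} \<le> 4 * n)} \<subseteq> (\<Union>X\<in>XS. bad X)"
  proof
    fix E assume "E \<in> {E. E \<subseteq> Kn_edges n \<and> (\<exists>X\<subseteq>{..<n}. K < card X \<and> card {e \<in> E. e \<subseteq> X} \<le> 4 * n)}"
    then obtain X where E: "E \<subseteq> Kn_edges n" and X: "X \<subseteq> {..<n}" "K + 1 \<le> card X" "card {e \<in> E. e \<subseteq> X} \<le> 4 * n" by auto
    obtain Y where Y: "Y \<subseteq> X" "card Y = K + 1" using X(2) by (elim obtain_subset_with_card_n)
    have "finite E" using finite_subset[OF E] by simp
    then have "card {e \<in> J Y. {e} \<subseteq> E} \<le> card {e \<in> E. e \<subseteq> X}"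
      using Y unfolding J_def by (intro card_mono) auto
    then have "E \<in> bad Y" using X unfolding bad_def by simp
    moreover have "Y \<in> XS" using X Y unfolding XS_def by auto
    ultimately show "E \<in> (\<Union>X\<in>XS. bad X)" by blast
  qed
  then have "measure_pmf.prob (Gnp n p) {E. E \<subseteq> Kn_edges n \<and> (\<exists>X\<subseteq>{..<n}. K < card X \<and> card {e \<in> E. e \<subseteq> X} \<le> 4 * n)}
      \<le> measure_pmf.prob (Gnp n p) (\<Union>X\<in>XS. bad X)"
    by (intro measure_pmf.finite_measure_mono) auto
  also have "\<dots> \<le> (\<Sum>X\<in>XS. measure_pmf.prob (Gnp n p) (bad X))"
    using XS by (intro measure_pmf.finite_measure_subadditive_finite) auto
  also have "\<dots> \<le> (\<Sum>X\<in>XS. exp (4 * real n - p / 4 * (real K * (real K + 1))))"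
  proof (rule sum_mono)
    fix X assume X: "X \<in> XS"
    have fX: "finite X" using X finite_subset unfolding XS_def by blast
    have cJ: "card (J X) = (K + 1) choose 2" unfolding J_def using n_subsets[OF fX, of 2] X unfolding XS_def by simp
    have ch: "real (card (J X)) = real K * (real K + 1) / 2"
    proof -
      have "2 * ((K + 1) choose 2) = K * (K + 1)" by (simp add: choose_two)
      then have "real (2 * ((K + 1) choose 2)) = real (K * (K + 1))" by simp
      then show ?thesis unfolding cJ by (simp add: algebra_simps)
    qed
    have "measure_pmf.prob (Gnp n p) (bad X) \<le> 2 ^ (4 * n) * (1 - p ^ 1 / 2) ^ card (J X)"
      unfolding bad_def
    proof (rule Gnp_lower_tail)
      show "finite (J X)" unfolding J_def using fX by simp
      show "{e} \<subseteq> Kn_edges n" if "e \<in> J X" for e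
        using that X unfolding J_def XS_def Kn_edges_def by (auto simp: card_2_iff)
    qed (use p in auto)
    also have "\<dots> \<le> exp (real (4 * n)) * exp (- (p / 2) * real (card (J X)))"
      using p one_minus_power_le_exp[of "p / 2" "card (J X)"]
      by (intro mult_mono two_power_le_exp) auto
    also have "\<dots> = exp (4 * real n - p / 4 * (real K * (real K + 1)))"
      unfolding ch by (simp add: exp_add[symmetric] field_simps)
    finally show "measure_pmf.prob (Gnp n p) (bad X) \<le> exp (4 * real n - p / 4 * (real K * (real K + 1)))" .
  qed
  also have "\<dots> = real (card XS) * exp (4 * real n - p / 4 * (real K * (real K + 1)))" by simp
  also have "\<dots> \<le> exp n * exp (4 * real n - p / 4 * (real K * (real K + 1)))"
  proof (rule mult_right_mono)
    have "real (card XS) \<le> real (2 ^ n)" using XS by (simp only: of_nat_le_iff)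
    also have "\<dots> \<le> exp n" using two_power_le_exp[of n] by simp
    finally show "real (card XS) \<le> exp n" .
  qed simp
  also have "\<dots> = exp (5 * real n - p / 4 * (real K * (real K + 1)))" by (simp add: exp_add[symmetric])
  finally show ?thesis .
qed


section \<open>Choice of the constants and passage to the limit\<close>

definition pseudorandom :: "real \<Rightarrow> nat \<Rightarrow> nat \<Rightarrow> nat set set \<Rightarrow> bool" where
  "pseudorandom c K n E \<longleftrightarrow> E \<subseteq> Kn_edges n \<and>
     (\<forall>T\<subseteq>{..<n}. T \<noteq> {} \<longrightarrow> card T \<le> 14 \<longrightarrow>
        c * real (n div 11) \<le> real (card {j \<in> {..<n div 11}. joined_in E T j})) \<and>
     (\<forall>X\<subseteq>{..<n}. K < card X \<longrightarrow> 4 * n < card {e \<in> E. e \<subseteq> X})"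

lemma cube_times_power_le:
  assumes "0 < n" "0 \<le> c" "c \<le> 1" "3 * ln (real n) + real g \<le> c / 4 * real t"
  shows "real n ^ 3 * (1 - c / 4) ^ t \<le> (1 / 2) ^ g"
proof -
  have "real n ^ 3 = exp (ln (real n)) ^ 3" using assms by simp
  also have "\<dots> = exp (3 * ln (real n))" by (simp only: exp_of_nat_mult[symmetric] of_nat_numeral)
  finally have "real n ^ 3 * (1 - c / 4) ^ t \<le> exp (3 * ln (real n)) * exp (- (c / 4) * real t)"
    using mult_left_mono[OF one_minus_power_le_exp[of "c / 4" t], of "exp (3 * ln (real n))"] assms by simp
  also have "\<dots> = exp (3 * ln (real n) - c / 4 * real t)" by (simp add: exp_add[symmetric])
  also have "\<dots> \<le> exp (- real g)" using assms(4) by simp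
  also have "\<dots> = 1 / exp (real g)" by (simp add: exp_minus field_simps)
  also have "\<dots> \<le> 1 / 2 ^ g" using two_power_le_exp[of g] by (intro divide_left_mono) auto
  finally show ?thesis by (simp add: power_divide)
qed

lemma nat_floor_bounds:
  fixes y :: real assumes "0 \<le> y"
  shows "y - 1 \<le> real (nat \<lfloor>y\<rfloor>)" "real (nat \<lfloor>y\<rfloor>) \<le> y"
  using assms by linarith+

text \<open>The constants come from the two weight conditions: up to rounding
  \<open>c / 4 * t1\<close> is \<open>2 * b\<close> and \<open>c / 4 * L\<close> is
  \<open>2 * \<nu> * x\<close>, twice what \<open>G\<close> and \<open>N1\<close> require. The slack
  absorbs the logarithm and the rounding errors, which \<open>big\<close> makes small compared with
  \<open>\<nu> * x\<close>.\<close>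

lemma pseudorandom_red_wins:
  assumes c: "0 < c" "c \<le> 1" and n: "n = 2 * m" and beta: "\<beta> = c ^ 2 / 512"
    and nu: "\<nu> = c / 8 * (\<beta> / 10000)" and h: "h = nat \<lceil>1000 / \<beta>\<rceil>"
    and big: "3 * ln (real n) + 8 * real h + 1000 \<le> \<nu> * real (n div 11)" and n0: "0 < n"
    and ps: "pseudorandom c (nat \<lfloor>\<nu> * real (n div 11)\<rfloor>) n E"
  shows "red_has_winning_strategy n E"
proof -
  define N where "N = n div 11"
  define x where "x = real N"
  define b where "b = \<beta> * x"
  define t1 where "t1 = nat \<lfloor>c / 64 * x\<rfloor>"
  define G where "G = nat \<lfloor>b\<rfloor>"
  define D where "D = nat \<lfloor>b / 20\<rfloor>"
  define L where "L = nat \<lfloor>b / 10000\<rfloor>"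
  define N1 where "N1 = nat \<lfloor>\<nu> * x\<rfloor>"
  define N2 where "N2 = N1 + 11 * L"
  have x0: "0 \<le> x" unfolding x_def by simp
  have beta0: "0 < \<beta>" unfolding beta using c by simp
  have nu0: "0 < \<nu>" unfolding nu using c beta0 by simp
  have cc: "c ^ 2 \<le> c" using c by (simp add: power2_eq_square mult_left_le)
  have b0: "0 \<le> b" "0 \<le> c * x" unfolding b_def using beta0 x0 c by auto
  have b_cx: "b \<le> c * x / 512" using mult_right_mono[OF cc x0] unfolding b_def beta by simp
  have nux: "\<nu> * x = c / 8 * (b / 10000)" unfolding nu b_def by simp
  have "c * (b / 80000) \<le> 1 * (b / 80000)" using c b0 by (intro mult_right_mono) auto
  then have nub: "\<nu> * x \<le> b / 80000" unfolding nux by simp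
  have bigx: "3 * ln (real n) + 8 * real h + 1000 \<le> \<nu> * x" using big unfolding x_def N_def .
  have ln0: "0 \<le> ln (real n)" using n0 by simp
  have nx: "real n \<le> 11 * x + 10" "11 * x \<le> real n"
  proof -
    have "n \<le> 11 * N + 10" "11 * N \<le> n" unfolding N_def by auto
    then have "real n \<le> real (11 * N + 10)" "real (11 * N) \<le> real n" by (simp_all only: of_nat_le_iff)
    then show "real n \<le> 11 * x + 10" "11 * x \<le> real n" unfolding x_def by simp_all
  qed
  have fl: "c / 64 * x - 1 \<le> real t1" "real t1 \<le> c / 64 * x" "b - 1 \<le> real G" "real G \<le> b"
    "b / 20 - 1 \<le> real D" "real D \<le> b / 20" "b / 10000 - 1 \<le> real L" "real L \<le> b / 10000"
    "\<nu> * x - 1 \<le> real N1" "real N1 \<le> \<nu> * x"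
    unfolding t1_def G_def D_def L_def N1_def using b0 nu0 x0
    by (intro nat_floor_bounds; simp)+
  have "c * x \<le> 1 * x" using c x0 by (intro mult_right_mono) auto
  then have bx: "b \<le> x" using b_cx b0 by linarith
  have E: "E \<subseteq> Kn_edges n" using ps unfolding pseudorandom_def by blast
  have N1n: "real N1 < real n" using fl(10) nub bx nx b0 bigx ln0 by linarith
  interpret strategy n E m D h G N1 N2 t1 L N c
  proof
    show "E \<subseteq> Kn_edges n" by fact
    have "4 * n < card {e \<in> E. e \<subseteq> {..<n}}"
      using ps N1n unfolding pseudorandom_def N1_def x_def N_def by auto
    also have "\<dots> \<le> card E" using finite_subset[OF E] by (intro card_mono) auto
    finally show "4 * n < card E" .
    show "n = 2 * m" "0 < c" "c \<le> 1" by fact+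
    show "11 * N \<le> n" unfolding N_def by simp
    show "c * real N \<le> real (card {j \<in> {..<N}. joined_in E T j})" if "T \<subseteq> {..<n}" "T \<noteq> {}" "card T \<le> 14" for T
      using ps that unfolding pseudorandom_def N_def by blast
    show "4 * n < card {e \<in> E. e \<subseteq> X}" if "X \<subseteq> {..<n}" "N1 < card X" for X
      using ps that unfolding pseudorandom_def N1_def x_def N_def by blast
    have "4 \<le> real D" using fl(5) nub bigx ln0 by linarith
    then show "4 \<le> D" by linarith
    have N2r: "real N2 = real N1 + 11 * real L" unfolding N2_def by simp
    have "real N2 + 2 * real h + 2 \<le> real D" using N2r fl(5,8,10) nub bigx ln0 by linarith
    then show "N2 + 2 * h + 2 \<le> D" by linarith
    \<comment> \<open>The origin of 1000 in \<open>h\<close>: with \<open>D\<close> about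
      \<open>b / 20\<close> the product is about \<open>50 * x\<close>, well above
      \<open>2 * n\<close>, which is about \<open>22 * x\<close>.\<close>
    have "50 * x \<le> (real h + 1) * (b / 20)"
    proof -
      have "1000 / \<beta> \<le> real h + 1" unfolding h by linarith
      then have "1000 / \<beta> * (b / 20) \<le> (real h + 1) * (b / 20)" using b0 by (intro mult_right_mono) auto
      moreover have "1000 / \<beta> * (b / 20) = 50 * x" unfolding b_def using beta0 by simp
      ultimately show ?thesis by simp
    qed
    moreover have "(real h + 1) * (b / 20 - 1) \<le> (real h + 1) * real D" using fl(5) by (intro mult_left_mono) auto
    ultimately have "50 * x - (real h + 1) \<le> (real h + 1) * real D" by (simp add: algebra_simps)
    then have "2 * real n < (real h + 1) * real D" using nx bx nub b0 bigx ln0 by linarith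
    then have "real (2 * n) < real ((h + 1) * D)" by (simp add: algebra_simps)
    then show "2 * n < (h + 1) * D" by (simp only: of_nat_less_iff)
    show "N2 = N1 + 11 * L" by (rule N2_def)
    have "3 \<le> real N1" using fl(9) bigx ln0 by linarith
    then show "3 \<le> N1" by linarith
    have "real N2 \<le> real n" using N2r fl(8,10) nub bx nx b0 by linarith
    then show "N2 \<le> n" by linarith
    have "1 \<le> real L" using fl(7) nub bigx ln0 by linarith
    then show "1 \<le> L" by linarith
    have "3 * real D + 8 * real h + 6 + 10 * real N2 \<le> real G"
      using N2r fl(3,6,8,10) nub bigx ln0 by linarith
    then have "real (3 * (D + 2 * h + 2) + 2 * h + 10 * N2) \<le> real G" by simp
    then show "3 * (D + 2 * h + 2) + 2 * h + 10 * N2 \<le> G" by (simp only: of_nat_le_iff)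
    have "2 * real D + 8 * real t1 + 8 * real h + 8 + 2 * real L \<le> c * x"
      using fl(2,6,8) b_cx nub bigx ln0 b0 by linarith
    then show "2 * real (D + 4 * t1 + 4 * h + 4 + L) \<le> c * real N" unfolding x_def by simp
    have ct: "c / 4 * (c / 64 * x - 1) \<le> c / 4 * real t1" using fl(1) c by (intro mult_left_mono) auto
    have "c / 4 * (c / 64 * x - 1) = 2 * b - c / 4" unfolding b_def beta by (simp add: field_simps power2_eq_square)
    then have "3 * ln (real n) + real G \<le> c / 4 * real t1" using ct c fl(4) nub bigx by linarith
    then show "real n ^ 3 * (1 - c / 4) ^ t1 \<le> (1 / 2) ^ G" using c n0 by (intro cube_times_power_le) auto
    have cL: "c / 4 * (b / 10000 - 1) \<le> c / 4 * real L" using fl(7) c by (intro mult_left_mono) auto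
    have "c / 4 * (b / 10000 - 1) = 2 * (\<nu> * x) - c / 4" unfolding nux by (simp add: field_simps)
    then have "3 * ln (real n) + real (N1 + 1) \<le> c / 4 * real L" using cL c fl(10) bigx by simp
    then show "real n ^ 3 * (1 - c / 4) ^ L \<le> (1 / 2) ^ (N1 + 1)" using c n0 by (intro cube_times_power_le) auto
  qed
  show ?thesis by (rule strategy_red_wins)
qed

text \<open>Only even orders \<open>2 * m\<close> occur, because a graph with an odd number of
  vertices has no perfect matching.\<close>

theorem theorem1p1:
  fixes p :: real
  assumes "0 < p" and "p \<le> 1"
  shows "(\<lambda>m. measure_pmf.prob (Gnp (2 * m) p)
                 {E. red_has_winning_strategy (2 * m) E}) \<longlonglongrightarrow> 1"
proof -
  define q where "q = p ^ 275"
  define c where "c = q / 4"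
  define \<beta> where "\<beta> = c ^ 2 / 512"
  define \<nu> where "\<nu> = c / 8 * (\<beta> / 10000)"
  define h where "h = nat \<lceil>1000 / \<beta>\<rceil>"
  define K where "K m = nat \<lfloor>\<nu> * real (2 * m div 11)\<rfloor>" for m
  \<comment> \<open>\<open>(2 * real m - 10) / 11\<close> bounds \<open>2 * m div 11\<close> from
    below without rounding, so that the limits become elementary. The square is a lower bound for
    \<open>K m * (K m + 1)\<close>.\<close>
  define err where "err m = (2 * real m) ^ 14 * exp (7 * q - q * ((2 * real m - 10) / 11) / 4)
    + exp (10 * real m - p / 4 * (\<nu> * ((2 * real m - 10) / 11) - 1)\<^sup>2)" for m :: nat
  have q: "0 < q" "q \<le> 1" unfolding q_def using assms by (auto simp: power_le_one)
  have c: "0 < c" "c \<le> 1" unfolding c_def using q by auto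
  have nu: "0 < \<nu>" unfolding \<nu>_def \<beta>_def using c by simp
  have ev: "eventually (\<lambda>m. 3 * ln (2 * real m) + 8 * real h + 1000 \<le> \<nu> * ((2 * real m - 10) / 11)) sequentially"
    using nu by real_asymp
  have bound: "1 - err m \<le> measure_pmf.prob (Gnp (2 * m) p) {E. red_has_winning_strategy (2 * m) E}"
    if m: "0 < m" "3 * ln (2 * real m) + 8 * real h + 1000 \<le> \<nu> * ((2 * real m - 10) / 11)" for m
  proof -
    define n where "n = 2 * m"
    define bad1 where "bad1 = {E. \<exists>T\<subseteq>{..<n}. T \<noteq> {} \<and> card T \<le> 14 \<and>
      real (card {j \<in> {..<n div 11}. joined_in E T j}) < q / 4 * real (n div 11)}"
    define bad2 where "bad2 = {E. E \<subseteq> Kn_edges n \<and> (\<exists>X\<subseteq>{..<n}. K m < card X \<and> card {e \<in> E. e \<subseteq> X} \<le> 4 * n)}"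
    have "n \<le> 11 * (n div 11) + 10" by simp
    then have "real n \<le> real (11 * (n div 11) + 10)" by (simp only: of_nat_le_iff)
    then have N: "(2 * real m - 10) / 11 \<le> real (n div 11)" unfolding n_def by simp
    then have nuN: "\<nu> * ((2 * real m - 10) / 11) \<le> \<nu> * real (n div 11)" using nu by (intro mult_left_mono) auto
    have ln0: "0 \<le> ln (2 * real m)" using m(1) by simp
    have Km: "K m = nat \<lfloor>\<nu> * real (n div 11)\<rfloor>" unfolding K_def n_def ..
    have fit: "11 * (n div 11) \<le> n" by (rule times_div_less_eq_dividend)
    have good: "red_has_winning_strategy n E" if "E \<subseteq> Kn_edges n" "E \<notin> bad1" "E \<notin> bad2" for E
    proof (rule pseudorandom_red_wins[OF c n_def \<beta>_def \<nu>_def h_def])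
      show "3 * ln (real n) + 8 * real h + 1000 \<le> \<nu> * real (n div 11)" using m(2) nuN unfolding n_def by simp
      show "0 < n" using m unfolding n_def by simp
      show "pseudorandom c (nat \<lfloor>\<nu> * real (n div 11)\<rfloor>) n E"
        unfolding pseudorandom_def
      proof (intro conjI allI impI)
        show "E \<subseteq> Kn_edges n" by fact
        show "c * real (n div 11) \<le> real (card {j \<in> {..<n div 11}. joined_in E T j})"
          if "T \<subseteq> {..<n}" "T \<noteq> {}" "card T \<le> 14" for T
        proof (rule ccontr)
          assume "\<not> c * real (n div 11) \<le> real (card {j \<in> {..<n div 11}. joined_in E T j})"
          then have "E \<in> bad1" unfolding bad1_def c_def not_le using that by blast
          then show False using \<open>E \<notin> bad1\<close> by simp
        qed
        show "4 * n < card {e \<in> E. e \<subseteq> X}"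
          if "X \<subseteq> {..<n}" "nat \<lfloor>\<nu> * real (n div 11)\<rfloor> < card X" for X
        proof (rule ccontr)
          assume "\<not> 4 * n < card {e \<in> E. e \<subseteq> X}"
          then have "E \<in> bad2" unfolding bad2_def Km not_less using that \<open>E \<subseteq> Kn_edges n\<close> by blast
          then show False using \<open>E \<notin> bad2\<close> by simp
        qed
      qed
    qed
    have "measure_pmf.prob (Gnp n p) bad1 \<le> real n ^ 14 * exp (7 * q - q * real (n div 11) / 4)"
      unfolding bad1_def using prob_bad_tuple[OF assms fit q_def] .
    also have "\<dots> \<le> real n ^ 14 * exp (7 * q - q * ((2 * real m - 10) / 11) / 4)"
    proof -
      have "q * ((2 * real m - 10) / 11) \<le> q * real (n div 11)" using N q by (intro mult_left_mono) auto
      then have "exp (7 * q - q * real (n div 11) / 4) \<le> exp (7 * q - q * ((2 * real m - 10) / 11) / 4)"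
        by (subst exp_le_cancel_iff) linarith
      then show ?thesis by (intro mult_left_mono) auto
    qed
    finally have b1: "measure_pmf.prob (Gnp n p) bad1 \<le> (2 * real m) ^ 14 * exp (7 * q - q * ((2 * real m - 10) / 11) / 4)"
      unfolding n_def by simp
    have "measure_pmf.prob (Gnp n p) bad2 \<le> exp (5 * real n - p / 4 * (real (K m) * (real (K m) + 1)))"
      unfolding bad2_def by (rule prob_sparse_set) fact+
    also have "\<dots> \<le> exp (10 * real m - p / 4 * (\<nu> * ((2 * real m - 10) / 11) - 1)\<^sup>2)"
    proof -
      define y where "y = \<nu> * ((2 * real m - 10) / 11) - 1"
      have y0: "0 \<le> y" unfolding y_def using m(2) ln0 by linarith
      have "\<nu> * real (n div 11) - 1 \<le> real (K m)"
        unfolding Km using nu by (intro nat_floor_bounds) simp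
      then have "y \<le> real (K m)" unfolding y_def using nuN by linarith
      then have "y * y \<le> real (K m) * (real (K m) + 1)" using y0 by (intro mult_mono) auto
      then have "p / 4 * y\<^sup>2 \<le> p / 4 * (real (K m) * (real (K m) + 1))"
        using assms unfolding power2_eq_square by (intro mult_left_mono) auto
      moreover have "5 * real n = 10 * real m" unfolding n_def by simp
      ultimately show ?thesis unfolding y_def[symmetric] by (subst exp_le_cancel_iff) linarith
    qed
    finally have b2: "measure_pmf.prob (Gnp n p) bad2 \<le> exp (10 * real m - p / 4 * (\<nu> * ((2 * real m - 10) / 11) - 1)\<^sup>2)" .
    have "1 = measure_pmf.prob (Gnp n p) (set_pmf (Gnp n p))" by (simp add: measure_pmf.prob_eq_1 AE_measure_pmf_iff)
    also have "\<dots> \<le> measure_pmf.prob (Gnp n p) ({E. red_has_winning_strategy n E} \<union> (bad1 \<union> bad2))"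
      using set_Gnp[of n p] good by (intro measure_pmf.finite_measure_mono) auto
    also have "\<dots> \<le> measure_pmf.prob (Gnp n p) {E. red_has_winning_strategy n E} + measure_pmf.prob (Gnp n p) (bad1 \<union> bad2)"
      by (intro measure_Un_le) auto
    also have "measure_pmf.prob (Gnp n p) (bad1 \<union> bad2) \<le> measure_pmf.prob (Gnp n p) bad1 + measure_pmf.prob (Gnp n p) bad2"
      by (intro measure_Un_le) auto
    finally show ?thesis using b1 b2 unfolding err_def n_def by linarith
  qed
  \<comment> \<open>Exponential decay beats the polynomial; in the second term the negative
    quadratic part of the exponent beats the linear one.\<close>
  have "(\<lambda>m. (2 * real m) ^ 14 * exp (7 * q - q * ((2 * real m - 10) / 11) / 4)) \<longlonglongrightarrow> 0"
    using q by real_asymp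
  moreover have "(\<lambda>m. exp (10 * real m - p / 4 * (\<nu> * ((2 * real m - 10) / 11) - 1)\<^sup>2)) \<longlonglongrightarrow> 0"
    using assms nu by real_asymp
  ultimately have "err \<longlonglongrightarrow> 0" unfolding err_def by (rule tendsto_add_zero)
  then have lim: "(\<lambda>m. 1 - err m) \<longlonglongrightarrow> 1" using tendsto_diff[OF tendsto_const, of err 0 sequentially 1] by simp
  have ev': "eventually (\<lambda>m. 1 - err m \<le> measure_pmf.prob (Gnp (2 * m) p) {E. red_has_winning_strategy (2 * m) E}) sequentially"
    using ev eventually_gt_at_top[of 0] by eventually_elim (use bound in blast)
  show ?thesis
    by (rule tendsto_sandwich[OF ev' _ lim tendsto_const]) (simp add: eventually_sequentially)
qed

end
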